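(* Let $q>0$ be a constant with $q\neq1$. Let $\Omega\subset\mathbb{R}^2$ be an ellipse (the open region bounded by an ellipse) having one of its foci at the origin, and suppose its eccentricity $e$ satisfies $$\begin{cases}0<e^2<\dfrac34-\dfrac{1}{4\sqrt{q}} & \text{if } q>1 \text{ or } \tfrac14<q<1,\\[2mm] 0<e^2<q & \text{if } 0<q\le \tfrac14.\end{cases}$$ Let $\phi$ be a $C^1$ function on $\mathbb{S}^1$ which is not identically zero. Then there are at most finitely many wave numbers $k>0$ such that $\Omega$ is non-scattering in the presence of the incident wave $v=\mathbf{H}[k,\phi]$.
   Context: We identify $\mathbb{S}^1$ with $[0,2\pi)$ (and with $\mathbb{R}/(2\pi\mathbb{Z})$) via $\theta\mapsto(\cos\theta,\sin\theta)^T$; for $\xi\in\mathbb{S}^1$, $\theta_\xi$ denotes its angular coordinate. For $k>0$ and $\phi\in L^2(\mathbb{S}^1)$ the Herglotz wave is $\mathbf{H}[k,\phi](x)=\int_{-\pi}^{\pi}\phi(\xi)e^{\mathrm{i}k\xi\cdot x}\,d\theta_\xi$, $x\in\mathbb{R}^2$. For a bounded domain $\Omega$ with index of refraction the constant $q$, $\Omega$ is called non-scattering in the presence of the incident wave $\mathbf{H}[k,\phi]$ (at wave number $k$) if there exists $u\in H^1(\Omega)$ with $\Delta u+k^2qu=0$ in $\Omega$ and $u=\mathbf{H}[k,\phi]$, $\partial_\nu u=\partial_\nu\mathbf{H}[k,\phi]$ on $\partial\Omega$ ($\nu$ the outward unit normal). The eccentricity of an ellipse with semi-major axis $a$ and semi-minor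 axis $b$ is $\sqrt{1-b^2/a^2}$. *)

theory Defs
  imports "HOL-Analysis.Analysis"
begin

text \<open>Open region bounded by the ellipse with centre c, major axis in direction
  (cos t, sin t), semi-major axis a and semi-minor axis b (intended: 0 < b, b \<le> a).\<close>
definition ellipse_region :: "real^2 \<Rightarrow> real \<Rightarrow> real \<Rightarrow> real \<Rightarrow> (real^2) set" where
  "ellipse_region c t a b =
     {x. ((cos t * (x$1 - c$1) + sin t * (x$2 - c$2)) / a)\<^sup>2
       + ((- sin t * (x$1 - c$1) + cos t * (x$2 - c$2)) / b)\<^sup>2 < 1}"

definition ellipse_foci :: "real^2 \<Rightarrow> real \<Rightarrow> real \<Rightarrow> real \<Rightarrow> (real^2) set" where
  "ellipse_foci c t a b =
     {c + sqrt (a\<^sup>2 - b\<^sup>2) *\<^sub>R (vector [cos t, sin t]),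
      c - sqrt (a\<^sup>2 - b\<^sup>2) *\<^sub>R (vector [cos t, sin t])}"

definition eccentricity :: "real \<Rightarrow> real \<Rightarrow> real" where
  "eccentricity a b = sqrt (1 - b\<^sup>2 / a\<^sup>2)"

text \<open>The density phi on S^1 is represented as a 2pi-periodic function of the angle.\<close>
definition herglotz :: "real \<Rightarrow> (real \<Rightarrow> complex) \<Rightarrow> real^2 \<Rightarrow> complex" where
  "herglotz k \<phi> x =
     integral {-pi..pi} (\<lambda>t. \<phi> t * exp (\<i> * complex_of_real (k * (cos t * x$1 + sin t * x$2))))"

definition pd :: "(real^2 \<Rightarrow> complex) \<Rightarrow> 2 \<Rightarrow> real^2 \<Rightarrow> complex" where
  "pd \<psi> i x = frechet_derivative \<psi> (at x) (axis i 1)"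

definition test_fn :: "(real^2 \<Rightarrow> complex) \<Rightarrow> bool" where
  "test_fn \<psi> \<longleftrightarrow> (\<forall>x. \<psi> differentiable (at x))
     \<and> (\<forall>i. continuous_on UNIV (pd \<psi> i))
     \<and> compact (closure {x. \<psi> x \<noteq> 0})"

definition L2_on :: "(real^2) set \<Rightarrow> (real^2 \<Rightarrow> complex) \<Rightarrow> bool" where
  "L2_on \<Omega> f \<longleftrightarrow> set_borel_measurable lborel \<Omega> f
     \<and> set_integrable lborel \<Omega> (\<lambda>x. (cmod (f x))\<^sup>2)"

definition H1_grad :: "(real^2) set \<Rightarrow> (real^2 \<Rightarrow> complex) \<Rightarrow> (2 \<Rightarrow> real^2 \<Rightarrow> complex) \<Rightarrow> bool" where
  "H1_grad \<Omega> u g \<longleftrightarrow> L2_on \<Omega> u \<and> (\<forall>i. L2_on \<Omega> (g i))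
     \<and> (\<forall>\<psi> i. test_fn \<psi> \<and> closure {x. \<psi> x \<noteq> 0} \<subseteq> \<Omega> \<longrightarrow>
          (LINT x:\<Omega>|lborel. u x * pd \<psi> i x) = - (LINT x:\<Omega>|lborel. g i x * \<psi> x))"

definition H10 :: "(real^2) set \<Rightarrow> (real^2 \<Rightarrow> complex) \<Rightarrow> bool" where
  "H10 \<Omega> w \<longleftrightarrow> (\<exists>g. H1_grad \<Omega> w g \<and>
     (\<exists>\<psi> :: nat \<Rightarrow> real^2 \<Rightarrow> complex.
        (\<forall>n. test_fn (\<psi> n) \<and> closure {x. \<psi> n x \<noteq> 0} \<subseteq> \<Omega>) \<and>
        (\<lambda>n. LINT x:\<Omega>|lborel. (cmod (\<psi> n x - w x))\<^sup>2
              + (cmod (pd (\<psi> n) 1 x - g 1 x))\<^sup>2 + (cmod (pd (\<psi> n) 2 x - g 2 x))\<^sup>2)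
          \<longlonglongrightarrow> 0))"

text \<open>Non-scattering: there is u \<in> H^1(\<Omega>) with \<Delta>u + k^2 q u = 0 in \<Omega>, u = v and
  \<partial>_\<nu> u = \<partial>_\<nu> v on \<partial>\<Omega>. The Dirichlet condition is u - v \<in> H^1_0(\<Omega>); the equation
  together with the Neumann condition is expressed by Green's formula against all
  C^1 compactly supported test functions on R^2 (using \<Delta>v = -k^2 v):
  int_\<Omega> \<nabla>u.\<nabla>\<psi> - k^2 q u \<psi> = int_\<partial>\<Omega> \<partial>_\<nu>u \<psi> = int_\<partial>\<Omega> \<partial>_\<nu>v \<psi> = int_\<Omega> \<nabla>v.\<nabla>\<psi> - k^2 v \<psi>.\<close>
definition non_scattering :: "(real^2) set \<Rightarrow> real \<Rightarrow> real \<Rightarrow> (real^2 \<Rightarrow> complex) \<Rightarrow> bool" where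
  "non_scattering \<Omega> q k v \<longleftrightarrow> (\<exists>u gu gv.
      H1_grad \<Omega> u gu \<and> H1_grad \<Omega> v gv \<and> H10 \<Omega> (\<lambda>x. u x - v x) \<and>
      (\<forall>\<psi>. test_fn \<psi> \<longrightarrow>
         (LINT x:\<Omega>|lborel. gu 1 x * pd \<psi> 1 x + gu 2 x * pd \<psi> 2 x
                             - complex_of_real (k\<^sup>2 * q) * u x * \<psi> x)
       = (LINT x:\<Omega>|lborel. gv 1 x * pd \<psi> 1 x + gv 2 x * pd \<psi> 2 x
                             - complex_of_real (k\<^sup>2) * v x * \<psi> x)))"

end

theory Submission
  imports Defs "HOL-Complex_Analysis.Complex_Analysis" "HOL-Real_Asymp.Real_Asymp"
begin

text \<open>
  If \<open>\<Omega>\<close> is non-scattering at wave number \<open>k\<close>, Green's formula shows that the Herglotz wave \<open>v\<close> is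
  \<open>L\<^sup>2\<close>-orthogonal on \<open>\<Omega>\<close> to every plane wave \<open>exp (i k \<surd>q \<eta> \<cdot> x)\<close> with \<open>\<eta>\<close> a real unit vector. The divergence
  theorem turns this into \<open>H(k, \<eta>) = 0\<close> for all \<open>\<eta>\<close>, where \<open>H\<close> is an oscillatory integral over the density
  angle and the boundary of the ellipse, entire in \<open>k\<close>. Hence an infinite set of non-scattering wave
  numbers yields \<open>k\<^sub>n \<rightarrow> \<infinity>\<close> with \<open>H(k\<^sub>n, \<eta>) = 0\<close> for all \<open>\<eta>\<close>.

  Stationary phase in the density angle replaces \<open>v(x)\<close> by a combination of \<open>\<phi>(\<plusminus>x/r) exp (\<plusminus>i k r) / \<surd>(k r)\<close>
  with \<open>r = |x|\<close>. Since the origin is a focus, \<open>r\<close> is an affine function of \<open>x\<close> on the boundary, so in the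
  eccentric angle \<open>s\<close> every remaining phase has the form \<open>D + N cos (s - \<sigma>)\<close> and stationary phase applies
  again. Four terms with phases \<open>D\<^sub>1 \<plusminus> N\<^sub>1\<close>, \<open>D\<^sub>2 \<plusminus> N\<^sub>2\<close> depending on \<open>\<eta>\<close> remain. Testing against the
  conjugate phase of the first one and integrating over \<open>\<eta>\<close>, the other three disappear by the
  Riemann-Lebesgue lemma, because their phase differences are nowhere locally constant. Thus
  \<open>\<phi>\<close> vanishes in every direction reached by the first term, which is every direction as soon as \<open>e\<^sup>2 < q\<close>.

  The error of the first stationary phase expansion is only \<open>O(log k / k)\<close> while the main term is of
  order \<open>1/k\<close>; integrating over \<open>\<eta>\<close> before estimating gains an additional factor \<open>k\<close> to the power \<open>-1/4\<close>
  in \<open>L\<^sup>2\<close> of the boundary.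
\<close>

section \<open>Oscillatory integrals\<close>

text \<open>The plane waves have wave number k sqrt q because they then solve the equation of u.
  Integrating u - v, whose Cauchy data vanish, by parts against such a wave leaves k^2 (1 - q) times
  the integral of v against it.

  The passage to the boundary uses the vector field (sqrt q eta - omega) exp(i k (omega + sqrt q
  eta).x), where omega is the direction of the density angle. Its divergence is i k (q - 1) times
  the exponential, a factor that depends on neither direction, so no denominator |omega + sqrt q
  eta|^2 enters the amplitude of \<open>H\<close>.

  Both cases of the eccentricity hypothesis give e^2 < q. This says that the origin lies inside the
  ellipse with centre (-f, 0) and semi-axes a sqrt q, b sqrt q, which \<open>z1\<close> traces as
  eta goes round the circle. Consequently the frequencies N_1 and N_2 stay away from 0, which makes
  the second expansion uniform in eta, and the argument of \<open>z1\<close> takes every value,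
  which lets the first term reach every direction.

  The weight in the final integration over eta is the conjugate of the density times a real
  amplitude factor; it turns the limit into a nonzero constant times the integral of a nonnegative
  function.\<close>

lemma has_vector_derivative_cis [derivative_intros]:
  assumes "(f has_real_derivative f') (at x within S)"
  shows "((\<lambda>x. cis (f x)) has_vector_derivative (f' *\<^sub>R (\<i> * cis (f x)))) (at x within S)"
proof -
  have "(cis has_vector_derivative (\<i> * cis (f x))) (at (f x) within f ` S)"
    unfolding cis_conv_exp
    by (auto intro!: derivative_eq_intros has_vector_derivative_real_field)
  thus ?thesis
    using vector_diff_chain_within[OF assms[unfolded has_real_derivative_iff_has_vector_derivative]]
    by (auto simp: o_def)
qed

text \<open>Integration by parts without a quotient: \<open>Q\<close> is chosen so that i d' Q is
  the integrand of interest, and the term with \<open>Q'\<close> becomes the remainder.\<close>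

lemma osc_parts:
  fixes Q :: "real \<Rightarrow> complex"
  assumes "u \<le> v"
    and Q: "\<And>s. s \<in> {u..v} \<Longrightarrow> (Q has_vector_derivative Q' s) (at s within {u..v})"
    and d: "\<And>s. s \<in> {u..v} \<Longrightarrow> (d has_real_derivative d' s) (at s within {u..v})"
  shows "((\<lambda>s. (\<i> * of_real (d' s) * Q s + Q' s) * cis (d s)) has_integral
           (Q v * cis (d v) - Q u * cis (d u))) {u..v}"
proof (rule fundamental_theorem_of_calculus[OF assms(1)])
  fix s assume s: "s \<in> {u..v}"
  show "((\<lambda>s. Q s * cis (d s)) has_vector_derivative (\<i> * of_real (d' s) * Q s + Q' s) * cis (d s)) (at s within {u..v})"
    by (rule has_vector_derivative_eq_rhs)
       (rule has_vector_derivative_mult Q d has_vector_derivative_cis s | simp add: algebra_simps scaleR_conv_of_real)+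
qed

lemma norm_le_of_diff:
  fixes z w :: "'a::real_normed_vector"
  assumes "norm (z - w) \<le> A" "norm z \<le> B"
  shows "norm w \<le> A + B"
  using norm_triangle_ineq4[of z "z - w"] assms by simp

section \<open>The truncated Fresnel integral and its limit\<close>

definition Fres :: "real \<Rightarrow> complex" where
  "Fres T = integral {0..T} (\<lambda>u. cis (- (u\<^sup>2)))"

text \<open>One integration by parts with \<open>Q\<close> solving -2 i u Q = 1. The boundary terms
  contribute 1/(2S) + 1/(2T) and the remainder 1/(2S) - 1/(2T), which add up to 1/S.\<close>

lemma Fres_diff:
  assumes "0 < S" "S \<le> T"
  shows "norm (Fres T - Fres S) \<le> 1 / S"
proof -
  define Q where "Q = (\<lambda>u::real. \<i> * of_real (1 / (2 * u)))"
  define Q' where "Q' = (\<lambda>u::real. - \<i> * of_real (1 / (2 * u^2)))"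
  have 1: "((\<lambda>s. (\<i> * of_real (- 2 * s) * Q s + Q' s) * cis (-(s^2))) has_integral
           (Q T * cis (-(T^2)) - Q S * cis (-(S^2)))) {S..T}"
  proof (rule osc_parts)
    fix s assume s: "s \<in> {S..T}"
    have "((\<lambda>u. 1 / (2 * u)) has_real_derivative - (1 / (2 * s^2))) (at s within {S..T})"
      using s assms by (auto intro!: derivative_eq_intros simp: field_simps power2_eq_square)
    hence "((\<lambda>u. complex_of_real (1 / (2 * u))) has_vector_derivative of_real (- (1 / (2 * s^2)))) (at s within {S..T})"
      by (simp only: has_real_derivative_iff_has_vector_derivative has_vector_derivative_of_real)
    from has_vector_derivative_mult_right[OF this, of \<i>]
    show "(Q has_vector_derivative Q' s) (at s within {S..T})"
      by (simp add: Q_def Q'_def)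
  qed (use assms in \<open>auto intro!: derivative_eq_intros\<close>)
  have 2: "((\<lambda>s. 1 / (2 * s^2)) has_integral (- (1/(2 * T)) - - (1/(2 * S)))) {S..T}"
    using assms
    by (intro fundamental_theorem_of_calculus)
       (auto intro!: derivative_eq_intros simp: has_real_derivative_iff_has_vector_derivative[symmetric] field_simps power2_eq_square)
  have int: "(\<lambda>u. cis (- (u\<^sup>2))) integrable_on {A..B}" for A B
    by (intro integrable_continuous_real continuous_intros)
  have "Fres T = Fres S + integral {S..T} (\<lambda>u. cis (- (u\<^sup>2)))"
    unfolding Fres_def using assms int by (subst Henstock_Kurzweil_Integration.integral_combine) auto
  hence eq: "Fres T - Fres S = integral {S..T} (\<lambda>u. cis (- (u\<^sup>2)))" by simp
  have "((\<lambda>u. cis (- (u\<^sup>2))) has_integral (Fres T - Fres S)) {S..T}"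
    unfolding eq using int by (intro integrable_integral)
  from has_integral_diff[OF 1 this]
  have "((\<lambda>s. Q' s * cis (- (s\<^sup>2))) has_integral (Q T * cis (-(T^2)) - Q S * cis (-(S^2)) - (Fres T - Fres S))) {S..T}"
    using assms by (elim has_integral_eq[rotated]) (auto simp: Q_def field_simps)
  from has_integral_norm_bound_integral_component[OF this 2, of 1]
  have "norm (Q T * cis (-(T^2)) - Q S * cis (-(S^2)) - (Fres T - Fres S)) \<le> - (1/(2 * T)) - - (1/(2 * S))"
    using assms by (simp add: Q'_def norm_mult norm_divide norm_power)
  moreover have "norm (Q T * cis (-(T^2)) - Q S * cis (-(S^2))) \<le> 1 / (2 * T) + 1/(2 * S)"
    using assms by (intro order.trans[OF norm_triangle_ineq4]) (auto simp: Q_def norm_mult norm_divide)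
  ultimately have "norm (Fres T - Fres S) \<le> (- (1/(2 * T)) - - (1/(2 * S))) + (1 / (2 * T) + 1/(2 * S))"
    by (rule norm_le_of_diff)
  also have "\<dots> = 1 / S" using assms by (simp add: field_simps)
  finally show ?thesis .
qed

text \<open>The value is sqrt(pi)/2 times cis(-pi/4). The proof works with two facts about it: the
  rate of convergence and that it is not zero.\<close>

definition Fres_lim :: complex where
  "Fres_lim = lim (\<lambda>n. Fres (real n))"

lemma Fres_lim_bound:
  assumes "0 < T"
  shows "norm (Fres T - Fres_lim) \<le> 1 / T"
proof -
  have "Cauchy (\<lambda>n. Fres (real n))"
  proof (rule CauchyI')
    fix e :: real assume "e > 0"
    obtain M :: nat where M: "M > 1 / e" "M > 0"
      using reals_Archimedean2[of "max (1/e) 0"] by auto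
    show "\<exists>M. \<forall>m\<ge>M. \<forall>n>m. dist (Fres (real m)) (Fres (real n)) < e"
    proof (intro exI allI impI)
      fix m n assume mn: "M \<le> m" "m < n"
      hence "norm (Fres n - Fres m) \<le> 1 / m" using M by (intro Fres_diff) auto
      also have "\<dots> \<le> 1 / M" using mn M by (intro divide_left_mono) auto
      also have "\<dots> < e" using M \<open>e > 0\<close> by (simp add: field_simps)
      finally show "dist (Fres (real m)) (Fres (real n)) < e"
        by (simp add: dist_norm norm_minus_commute)
    qed
  qed
  hence "(\<lambda>n. Fres (real n)) \<longlonglongrightarrow> Fres_lim"
    unfolding Fres_lim_def by (simp add: Cauchy_convergent_iff convergent_LIMSEQ_iff)
  hence "(\<lambda>n. norm (Fres (real n) - Fres T)) \<longlonglongrightarrow> norm (Fres_lim - Fres T)"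
    by (intro tendsto_intros)
  moreover have "eventually (\<lambda>n. norm (Fres (real n) - Fres T) \<le> 1 / T) sequentially"
    using eventually_ge_at_top[of "nat \<lceil>T\<rceil>"]
    by eventually_elim (use assms in \<open>auto intro!: Fres_diff simp: nat_ceiling_le_eq\<close>)
  ultimately have "norm (Fres_lim - Fres T) \<le> 1 / T"
    by (intro tendsto_upperbound) auto
  thus ?thesis by (simp add: norm_minus_commute)
qed

lemma cos_ge_one_minus_sq: "cos (x::real) \<ge> 1 - x\<^sup>2 / 2"
proof -
  have "(sin (x/2))\<^sup>2 \<le> (x/2)\<^sup>2" using abs_sin_x_le_abs_x[of "x/2"] by (rule abs_le_square_iff[THEN iffD1])
  thus ?thesis using cos_double_sin[of "x/2"] by (simp add: power_divide)
qed

text \<open>At T = 6/5 the tail is at most 5/6, whereas cos(u^2) >= 1 - u^4/2 makes the real part of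
  \<open>Fres\<close> at least 6/5 - (6/5)^5/10, about 0.951.\<close>

lemma Fres_lim_nonzero: "Fres_lim \<noteq> 0"
proof
  assume "Fres_lim = 0"
  hence le: "norm (Fres (6/5)) \<le> 5/6" using Fres_lim_bound[of "6/5"] by simp
  have int: "(\<lambda>u. cis (- (u\<^sup>2))) integrable_on {0..6/5}"
    by (intro integrable_continuous_real continuous_intros)
  have 1: "((\<lambda>u. Re (cis (- (u\<^sup>2)))) has_integral Re (Fres (6/5))) {0..6/5}"
    unfolding Fres_def using has_integral_Re[OF integrable_integral[OF int]] .
  have 2: "((\<lambda>u::real. 1 - u^4 / 2) has_integral ((6/5) - (6/5)^5/10) - (0 - 0^5/10)) {0..6/5}"
    by (intro fundamental_theorem_of_calculus)
       (auto intro!: derivative_eq_intros simp: has_real_derivative_iff_has_vector_derivative[symmetric] field_simps)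
  have "((6/5) - (6/5)^5/10) - (0 - 0^5/10) \<le> Re (Fres (6/5))"
  proof (rule has_integral_le[OF 2 1])
    fix u :: real
    show "1 - u^4 / 2 \<le> Re (cis (- (u\<^sup>2)))"
      using cos_ge_one_minus_sq[of "u^2"] by (simp flip: power_mult)
  qed
  also have "\<dots> \<le> norm (Fres (6/5))" by (rule complex_Re_le_cmod)
  finally show False using le by (simp add: power_numeral_reduce)
qed

text \<open>The substitution \<open>u = \<surd>(2 l) sin (s/2)\<close> makes this an exact Fresnel integral. Every amplitude on \<open>[0, pi]\<close> is
  reduced to it by subtracting multiples of \<open>cos (s/2)\<close> and \<open>sin (s/2)\<close> that match it at both stationary points.\<close>

lemma integral_cos_half:
  assumes "l > 0"
  shows "((\<lambda>s. of_real (cos (s/2)) * cis (l * cos s)) has_integral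
           (of_real (sqrt (2/l)) * cis l * Fres (sqrt (2 * l)))) {0..pi}"
proof -
  define g where "g = (\<lambda>s. sqrt (2 * l) * sin (s/2))"
  have "((\<lambda>s. (sqrt (2 * l) * cos (s/2) / 2) *\<^sub>R cis (- ((g s)\<^sup>2))) has_integral
         integral {g 0..g pi} (\<lambda>u. cis (- (u\<^sup>2)))) {0..pi}"
  proof (rule has_integral_substitution[where c = 0 and d = "sqrt (2 * l)"])
    show "g 0 \<le> g pi" using assms by (simp add: g_def)
    show "g ` {0..pi} \<subseteq> {0..sqrt (2 * l)}"
      using assms by (auto simp: g_def intro!: mult_nonneg_nonneg sin_ge_zero mult_left_le)
    show "continuous_on {0..sqrt (2 * l)} (\<lambda>u. cis (- (u\<^sup>2)))" by (intro continuous_intros)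
    fix x show "(g has_real_derivative sqrt (2 * l) * cos (x / 2) / 2) (at x within {0..pi})"
      unfolding g_def by (auto intro!: derivative_eq_intros)
  qed auto
  hence "((\<lambda>s. (of_real (sqrt (2/l)) * cis l) * ((sqrt (2 * l) * cos (s/2) / 2) *\<^sub>R cis (- ((g s)\<^sup>2)))) has_integral
         (of_real (sqrt (2/l)) * cis l) * integral {g 0..g pi} (\<lambda>u. cis (- (u\<^sup>2)))) {0..pi}"
    by (rule has_integral_mult_right)
  moreover have "(of_real (sqrt (2/l)) * cis l) * ((sqrt (2 * l) * cos (s/2) / 2) *\<^sub>R cis (- ((g s)\<^sup>2)))
      = of_real (cos (s/2)) * cis (l * cos s)" for s
  proof -
    have A: "sqrt (2/l) * (sqrt (2 * l) * cos (s/2) / 2) = cos (s/2)"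
      using assms by (simp add: real_sqrt_divide real_sqrt_mult)
    have "l - (g s)\<^sup>2 = l * cos s"
    proof -
      have c: "cos s = 1 - 2 * (sin (s/2))\<^sup>2" using cos_double_sin[of "s/2"] by simp
      have "l - (g s)\<^sup>2 = l * (1 - 2 * (sin (s/2))\<^sup>2)"
        using assms by (simp add: g_def power_mult_distrib right_diff_distrib)
      thus ?thesis by (simp only: c)
    qed
    hence B: "cis l * cis (- ((g s)\<^sup>2)) = cis (l * cos s)" by (simp add: cis_mult)
    have "(of_real (sqrt (2/l)) * cis l) * ((sqrt (2 * l) * cos (s/2) / 2) *\<^sub>R cis (- ((g s)\<^sup>2)))
        = of_real (sqrt (2/l) * (sqrt (2 * l) * cos (s/2) / 2)) * (cis l * cis (- ((g s)\<^sup>2)))"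
      unfolding scaleR_conv_of_real of_real_mult by (simp only: mult_ac)
    thus ?thesis unfolding A B .
  qed
  ultimately show ?thesis by (simp add: g_def Fres_def)
qed

text \<open>The reflection s -> pi - s exchanges the two half-angle functions and conjugates the
  oscillating factor.\<close>

lemma integral_sin_half:
  assumes "l > 0"
  shows "((\<lambda>s. of_real (sin (s/2)) * cis (l * cos s)) has_integral
           cnj (of_real (sqrt (2/l)) * cis l * Fres (sqrt (2 * l)))) {0..pi}"
proof -
  have "((\<lambda>s. cnj (of_real (cos (s/2)) * cis (l * cos s))) has_integral
           cnj (of_real (sqrt (2/l)) * cis l * Fres (sqrt (2 * l)))) {0..pi}"
    using has_integral_linear[OF integral_cos_half[OF assms] bounded_linear_cnj] by (simp only: o_def)
  hence "((\<lambda>s. cnj (of_real (cos (s/2)) * cis (l * cos s))) \<circ> (\<lambda>s. (-1) *\<^sub>R s + pi) has_integral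
           cnj (of_real (sqrt (2/l)) * cis l * Fres (sqrt (2 * l)))) {0..pi}"
    using has_integral_affinity[of "\<lambda>s. cnj (of_real (cos (s/2)) * cis (l * cos s))" _ 0 pi "-1" pi]
    by (simp add: o_def)
  moreover have "cos ((pi - s)/2) = sin (s/2)" for s
    by (simp add: diff_divide_distrib cos_diff)
  ultimately show ?thesis by (simp add: o_def cis_cnj cos_diff)
qed

section \<open>Stationary phase with a C^1 amplitude\<close>

lemma sin_ge_linear:
  assumes "0 \<le> s" "s \<le> pi/2"
  shows "sin s \<ge> s / 3"
proof (cases "s \<le> pi/3")
  case True
  show ?thesis
  proof (cases "s = 0")
    case False
    hence "s > 0" using assms by simp
    from MVT2[OF this, of sin cos] obtain z where z: "0 < z" "z < s" "sin s - sin 0 = (s - 0) * cos z"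
      by (auto intro!: derivative_eq_intros)
    have "cos z \<ge> cos (pi/3)" using z True by (intro cos_monotone_0_pi_le) auto
    hence "s * cos z \<ge> s * (1/3)" using \<open>s > 0\<close> by (intro mult_left_mono) (auto simp: cos_60)
    thus ?thesis using z by simp
  qed auto
next
  case False
  have "sin s \<ge> sin (pi/3)" using False assms by (intro sin_monotone_2pi_le) auto
  moreover have "sqrt 3 \<ge> 17/10" by (rule real_le_rsqrt) (simp add: power2_eq_square)
  moreover have "s \<le> 2" using assms pi_less_4 by simp
  ultimately show ?thesis unfolding sin_60 by linarith
qed

lemma inverse_sin_le:
  assumes "0 < s" "s < pi"
  shows "1 / sin s \<le> 3 * (1 / s + 1 / (pi - s))"
proof (cases "s \<le> pi/2")
  case True
  hence "1 / sin s \<le> 3 / s" using sin_ge_linear[of s] assms sin_gt_zero[of s] by (simp add: field_simps)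
  thus ?thesis using assms by (simp add: add_increasing2 distrib_left)
next
  case False
  hence "1 / sin s \<le> 3 / (pi - s)" using sin_ge_linear[of "pi - s"] assms sin_gt_zero[of s] by (simp add: field_simps)
  thus ?thesis using assms by (simp add: add_increasing distrib_left)
qed

text \<open>Vanishing at both stationary points improves the general size 1/sqrt l to 1/l up to a
  logarithm. Within 1/sqrt l of an endpoint the amplitude is at most M/sqrt l, so each end piece
  contributes M/l. In between, R/sin is bounded and one integration by parts is possible; it leaves
  an integrand of size M/(l sin s), whose integral produces the logarithm. With a single derivative
  of \<open>R\<close> at hand, no further integration by parts is available.\<close>

lemma osc_remainder_bound:
  fixes R :: "real \<Rightarrow> complex"
  assumes R: "\<And>s. s \<in> {0..pi} \<Longrightarrow> (R has_vector_derivative R' s) (at s within {0..pi})"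
    and R': "\<And>s. s \<in> {0..pi} \<Longrightarrow> norm (R' s) \<le> M"
    and R0: "R 0 = 0" "R pi = 0" and l: "l \<ge> 1"
  shows "norm (integral {0..pi} (\<lambda>s. R s * cis (l * cos s))) \<le> 200 * M * (1 + ln l) / l"
proof -
  define d where "d = 1 / sqrt l"
  have d: "0 < d" "d \<le> 1" "d\<^sup>2 = 1 / l" "ln d = - ln l / 2" using l by (auto simp: d_def power_divide ln_div ln_sqrt)
  have dpi: "d < pi/2" using d pi_gt3 by linarith
  have M: "M \<ge> 0" by (rule order.trans[OF norm_ge_zero R'[of 0]]) simp
  have Lip: "norm (R x - R y) \<le> M * \<bar>x - y\<bar>" if "x \<in> {0..pi}" "y \<in> {0..pi}" for x y
  proof -
    have "norm (R x - R y) \<le> M * norm (x - y)"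
    proof (rule differentiable_bound[OF _ R[unfolded has_vector_derivative_def] _ that])
      fix s assume "s \<in> {0..pi}"
      from R'[OF this] show "onorm (\<lambda>x. x *\<^sub>R R' s) \<le> M"
        by (intro onorm_le) (simp add: mult.commute[of M] mult_left_mono)
    qed auto
    thus ?thesis by simp
  qed
  have Rs: "norm (R s) \<le> M * s" if "s \<in> {0..pi}" for s using Lip[of s 0] that R0 by simp
  have Rp: "norm (R s) \<le> M * (pi - s)" if "s \<in> {0..pi}" for s using Lip[of s pi] that R0 by simp
  have contR: "continuous_on {0..pi} R"
    using R by (rule continuous_on_vector_derivative)
  have Rsin: "norm (R s) \<le> 3 * M * sin s" if "s \<in> {0..pi}" for s
  proof (cases "s \<le> pi/2")
    case True
    have "M * s \<le> M * (3 * sin s)" using sin_ge_linear[of s] that True M by (intro mult_left_mono) auto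
    thus ?thesis using Rs[OF that] by simp
  next
    case False
    have "M * (pi - s) \<le> M * (3 * sin s)" using sin_ge_linear[of "pi - s"] that False M by (intro mult_left_mono) auto
    thus ?thesis using Rp[OF that] by simp
  qed
  have int: "(\<lambda>s. R s * cis (l * cos s)) integrable_on {x..y}" if "0 \<le> x" "y \<le> pi" for x y
    by (intro integrable_continuous_real continuous_intros continuous_on_subset[OF contR]) (use that in auto)
  let ?I = "\<lambda>x y. integral {x..y} (\<lambda>s. R s * cis (l * cos s))"
  have split: "?I 0 pi = ?I 0 d + ?I d (pi - d) + ?I (pi - d) pi"
    using d dpi int by (simp add: Henstock_Kurzweil_Integration.integral_combine)
  have e1: "norm (?I 0 d) \<le> M / l"
  proof -
    have "norm (?I 0 d) \<le> (M * d) * (d - 0)"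
    proof (rule integral_bound)
      show "continuous_on {0..d} (\<lambda>s. R s * cis (l * cos s))"
        by (intro continuous_intros continuous_on_subset[OF contR]) (use d dpi in auto)
      fix s assume s: "s \<in> {0..d}"
      have "norm (R s) \<le> M * s" using Rs[of s] s dpi by auto
      also have "\<dots> \<le> M * d" using s M by (intro mult_left_mono) auto
      finally show "norm (R s * cis (l * cos s)) \<le> M * d" by (simp add: norm_mult)
    qed (use d in auto)
    thus ?thesis using d by (simp add: power2_eq_square mult.assoc)
  qed
  have e3: "norm (?I (pi - d) pi) \<le> M / l"
  proof -
    have "norm (?I (pi - d) pi) \<le> (M * d) * (pi - (pi - d))"
    proof (rule integral_bound)
      show "continuous_on {pi - d..pi} (\<lambda>s. R s * cis (l * cos s))"
        by (intro continuous_intros continuous_on_subset[OF contR]) (use d dpi in auto)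
      fix s assume s: "s \<in> {pi - d..pi}"
      have "norm (R s) \<le> M * (pi - s)" using Rp[of s] s dpi by auto
      also have "\<dots> \<le> M * d" using s M by (intro mult_left_mono) auto
      finally show "norm (R s * cis (l * cos s)) \<le> M * d" by (simp add: norm_mult)
    qed (use d in auto)
    thus ?thesis using d by (simp add: power2_eq_square mult.assoc)
  qed
  have e2: "norm (?I d (pi - d)) \<le> (6 * M + 24 * M * (2 * ln pi + ln l)) / l"
  proof -
    define Q where "Q = (\<lambda>s. R s * (\<i> * of_real (1 / (l * sin s))))"
    define Q' where "Q' = (\<lambda>s. R s * (\<i> * of_real (- cos s / (l * (sin s)\<^sup>2))) + R' s * (\<i> * of_real (1 / (l * sin s))))"
    have sinpos: "sin s > 0" if "s \<in> {d..pi - d}" for s using that d by (intro sin_gt_zero) auto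
    have *: "((\<lambda>s. (\<i> * of_real (- l * sin s) * Q s + Q' s) * cis (l * cos s)) has_integral
           (Q (pi - d) * cis (l * cos (pi - d)) - Q d * cis (l * cos d))) {d..pi - d}"
    proof (rule osc_parts)
      fix s assume s: "s \<in> {d..pi - d}"
      have "((\<lambda>s. 1 / (l * sin s)) has_real_derivative - cos s / (l * (sin s)\<^sup>2)) (at s within {d..pi - d})"
        using sinpos[OF s] l by (auto intro!: derivative_eq_intros simp: field_simps power2_eq_square)
      hence "((\<lambda>s. complex_of_real (1 / (l * sin s))) has_vector_derivative of_real (- cos s / (l * (sin s)\<^sup>2))) (at s within {d..pi - d})"
        by (simp only: has_real_derivative_iff_has_vector_derivative has_vector_derivative_of_real)
      from has_vector_derivative_mult_right[OF this, of \<i>]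
      show "(Q has_vector_derivative Q' s) (at s within {d..pi - d})"
        unfolding Q_def Q'_def
        by (intro has_vector_derivative_mult has_vector_derivative_within_subset[OF R]) (use s d in auto)
    qed (use d dpi in \<open>auto intro!: derivative_eq_intros\<close>)
    have "((\<lambda>s. R s * cis (l * cos s)) has_integral ?I d (pi - d)) {d..pi - d}"
      using int[of d "pi - d"] d by (intro integrable_integral) auto
    from has_integral_diff[OF * this]
    have "((\<lambda>s. Q' s * cis (l * cos s)) has_integral
           (Q (pi - d) * cis (l * cos (pi - d)) - Q d * cis (l * cos d)) - ?I d (pi - d)) {d..pi - d}"
    proof (rule has_integral_eq[rotated])
      fix s assume s: "s \<in> {d..pi - d}"
      show "(\<i> * of_real (- l * sin s) * Q s + Q' s) * cis (l * cos s) - R s * cis (l * cos s) = Q' s * cis (l * cos s)"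
        using sinpos[OF s] l by (simp add: Q_def field_simps)
    qed
    moreover have "((\<lambda>s. 4 * M / l * (3 * (1 / s + 1 / (pi - s)))) has_integral
        (4 * M / l * (3 * (ln (pi - d) - ln (pi - (pi - d))))) - 4 * M / l * (3 * (ln d - ln (pi - d)))) {d..pi - d}"
      using d dpi by (intro fundamental_theorem_of_calculus)
       (auto intro!: derivative_eq_intros simp: has_real_derivative_iff_has_vector_derivative[symmetric])
    ultimately have "norm ((Q (pi - d) * cis (l * cos (pi - d)) - Q d * cis (l * cos d)) - ?I d (pi - d))
       \<le> ((4 * M / l * (3 * (ln (pi - d) - ln (pi - (pi - d))))) - 4 * M / l * (3 * (ln d - ln (pi - d)))) \<bullet> 1"
    proof (rule has_integral_norm_bound_integral_component)
      fix s assume s: "s \<in> {d..pi - d}"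
      hence s': "s \<in> {0..pi}" using d by auto
      have "norm (Q' s) \<le> norm (R s) * (\<bar>cos s\<bar> / (l * (sin s)\<^sup>2)) + norm (R' s) * (1 / (l * sin s))"
        unfolding Q'_def using sinpos[OF s] l
        by (intro order.trans[OF norm_triangle_ineq]) (simp add: norm_mult norm_divide norm_power)
      also have "\<dots> \<le> (3 * M * sin s) * (1 / (l * (sin s)\<^sup>2)) + M * (1 / (l * sin s))"
        using sinpos[OF s] l Rsin[OF s'] R'[OF s'] M
        by (intro add_mono mult_mono divide_right_mono) auto
      also have "\<dots> = 4 * M / l * (1 / sin s)" using sinpos[OF s] l by (simp add: field_simps power2_eq_square)
      also have "\<dots> \<le> 4 * M / l * (3 * (1 / s + 1 / (pi - s)))"
        using inverse_sin_le[of s] s d dpi M l by (intro mult_left_mono) auto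
      finally show "norm (Q' s * cis (l * cos s)) \<le> (4 * M / l * (3 * (1 / s + 1 / (pi - s)))) \<bullet> 1"
        by (simp add: norm_mult)
    qed
    also have "\<dots> = 24 * M / l * (ln (pi - d) - ln d)" using l by (simp add: field_simps)
    also have "\<dots> \<le> 24 * M / l * (ln pi + ln l / 2)"
      using d dpi M l by (intro mult_left_mono) auto
    also have "\<dots> \<le> 24 * M / l * (2 * ln pi + ln l)"
      using M l pi_gt3 by (intro mult_left_mono) auto
    finally have A: "norm ((Q (pi - d) * cis (l * cos (pi - d)) - Q d * cis (l * cos d)) - ?I d (pi - d)) \<le> 24 * M / l * (2 * ln pi + ln l)" .
    have Qb: "norm (Q s) \<le> 3 * M / l" if s: "s \<in> {d..pi - d}" for s
    proof -
      have "norm (Q s) = norm (R s) / (l * sin s)" using sinpos[OF s] l by (simp add: Q_def norm_mult norm_divide)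
      also have "\<dots> \<le> 3 * M * sin s / (l * sin s)"
        using sinpos[OF s] l Rsin[of s] s d by (intro divide_right_mono) auto
      finally show ?thesis using sinpos[OF s] by simp
    qed
    have "norm (Q (pi - d) * cis (l * cos (pi - d)) - Q d * cis (l * cos d)) \<le> 3 * M / l + 3 * M / l"
      using Qb[of d] Qb[of "pi - d"] dpi by (intro order.trans[OF norm_triangle_ineq4] add_mono) (auto simp: norm_mult)
    from norm_le_of_diff[OF A this] show ?thesis using l by (simp add: field_simps)
  qed
  have lnpi: "ln pi \<le> 2"
  proof -
    have "ln (sqrt pi) \<le> sqrt pi - 1" by (intro ln_le_minus_one) auto
    moreover have "sqrt pi \<le> 2" by (rule real_le_lsqrt) (use pi_less_4 in auto)
    ultimately show ?thesis by (simp add: ln_sqrt)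
  qed
  have "norm (?I 0 pi) \<le> M / l + (6 * M + 24 * M * (2 * ln pi + ln l)) / l + M / l"
    unfolding split using e1 e2 e3 by (intro order.trans[OF norm_triangle_ineq] add_mono) auto
  also have "\<dots> = (8 * M + 48 * M * ln pi + 24 * M * ln l) / l" using l by (simp add: field_simps)
  also have "\<dots> \<le> (200 * M * (1 + ln l)) / l"
  proof (rule divide_right_mono)
    have "M * ln pi \<le> M * 2" "M * ln l \<ge> 0" using M lnpi l by (auto intro: mult_left_mono)
    thus "8 * M + 48 * M * ln pi + 24 * M * ln l \<le> 200 * M * (1 + ln l)"
      using M by (simp add: algebra_simps)
  qed (use l in auto)
  finally show ?thesis .
qed

text \<open>The half-angle interpolant of \<open>F\<close> integrates to Fresnel integrals exactly,
  and the remainder vanishes at 0 and pi with derivative at most 2M. Replacing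
  \<open>Fres (sqrt (2 * l))\<close> by its limit costs sqrt(2/l) / sqrt(2l) = 1/l at each endpoint,
  whence 402 = 200 * 2 + 2.\<close>

lemma stationary_phase_half:
  fixes F :: "real \<Rightarrow> complex"
  assumes F: "\<And>s. s \<in> {0..pi} \<Longrightarrow> (F has_vector_derivative F' s) (at s within {0..pi})"
    and M: "\<And>s. s \<in> {0..pi} \<Longrightarrow> norm (F s) \<le> M" "\<And>s. s \<in> {0..pi} \<Longrightarrow> norm (F' s) \<le> M"
    and l: "l \<ge> 1"
  shows "norm (integral {0..pi} (\<lambda>s. F s * cis (l * cos s))
           - of_real (sqrt (2/l)) * (Fres_lim * cis l * F 0 + cnj Fres_lim * cis (-l) * F pi))
         \<le> 402 * M * (1 + ln l) / l"
proof -
  define R where "R = (\<lambda>s. F s - (F 0 * of_real (cos (s/2)) + F pi * of_real (sin (s/2))))"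
  define b where "b = of_real (sqrt (2/l)) * cis l * Fres (sqrt (2 * l))"
  have M0: "M \<ge> 0" by (rule order.trans[OF norm_ge_zero M(1)[of 0]]) simp
  have contF: "continuous_on {0..pi} F" using F by (rule continuous_on_vector_derivative)
  have R: "norm (integral {0..pi} (\<lambda>s. R s * cis (l * cos s))) \<le> 200 * (2 * M) * (1 + ln l) / l"
  proof (rule osc_remainder_bound)
    fix s assume s: "s \<in> {0..pi}"
    have 1: "((\<lambda>s. of_real (cos (s/2))) has_vector_derivative complex_of_real (- sin (s/2) / 2)) (at s within {0..pi})"
      by (auto intro!: derivative_eq_intros has_vector_derivative_of_real simp: has_real_derivative_iff_has_vector_derivative[symmetric] simp del: of_real_divide of_real_minus)
    have 2: "((\<lambda>s. of_real (sin (s/2))) has_vector_derivative complex_of_real (cos (s/2) / 2)) (at s within {0..pi})"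
      by (auto intro!: derivative_eq_intros has_vector_derivative_of_real simp: has_real_derivative_iff_has_vector_derivative[symmetric] simp del: of_real_divide of_real_minus)
    show "(R has_vector_derivative F' s - (F 0 * of_real (- sin (s/2) / 2) + F pi * of_real (cos (s/2) / 2))) (at s within {0..pi})"
      unfolding R_def using F[OF s] 1 2
      by (intro has_vector_derivative_diff has_vector_derivative_add has_vector_derivative_mult_right)
    have "norm (F' s - (F 0 * of_real (- sin (s/2) / 2) + F pi * of_real (cos (s/2) / 2)))
       \<le> norm (F' s) + (norm (F 0) * (\<bar>sin (s/2)\<bar> / 2) + norm (F pi) * (\<bar>cos (s/2)\<bar> / 2))"
      by (intro order.trans[OF norm_triangle_ineq4] add_mono order.refl order.trans[OF norm_triangle_ineq])
         (auto simp: norm_mult norm_divide)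
    also have "\<dots> \<le> M + (M * (1 / 2) + M * (1 / 2))"
      using M s M0 by (intro add_mono mult_mono) auto
    finally show "norm (F' s - (F 0 * of_real (- sin (s/2) / 2) + F pi * of_real (cos (s/2) / 2))) \<le> 2 * M"
      by simp
  qed (use l in \<open>auto simp: R_def\<close>)
  have hF: "((\<lambda>s. F s * cis (l * cos s)) has_integral integral {0..pi} (\<lambda>s. F s * cis (l * cos s))) {0..pi}"
    by (intro integrable_integral integrable_continuous_real continuous_intros contF)
  have hb: "((\<lambda>s. F 0 * (of_real (cos (s/2)) * cis (l * cos s)) + F pi * (of_real (sin (s/2)) * cis (l * cos s)))
       has_integral (F 0 * b + F pi * cnj b)) {0..pi}"
    unfolding b_def using l
    by (intro has_integral_add has_integral_mult_right integral_cos_half integral_sin_half) auto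
  have "((\<lambda>s. R s * cis (l * cos s)) has_integral integral {0..pi} (\<lambda>s. F s * cis (l * cos s)) - (F 0 * b + F pi * cnj b)) {0..pi}"
    using has_integral_diff[OF hF hb] by (simp add: R_def algebra_simps)
  hence eq: "integral {0..pi} (\<lambda>s. R s * cis (l * cos s)) = integral {0..pi} (\<lambda>s. F s * cis (l * cos s)) - (F 0 * b + F pi * cnj b)"
    by (rule integral_unique)
  define K where "K = of_real (sqrt (2/l)) * cis l * Fres_lim"
  have bK: "norm (b - K) \<le> 1 / l"
  proof -
    have "b - K = of_real (sqrt (2/l)) * cis l * (Fres (sqrt (2 * l)) - Fres_lim)" by (simp add: b_def K_def algebra_simps)
    hence "norm (b - K) = sqrt (2/l) * norm (Fres (sqrt (2 * l)) - Fres_lim)" using l by (simp add: norm_mult)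
    also have "\<dots> \<le> sqrt (2/l) * (1 / sqrt (2 * l))" using l by (intro mult_left_mono Fres_lim_bound) auto
    also have "\<dots> = 1 / l" using l by (simp add: real_sqrt_divide real_sqrt_mult)
    finally show ?thesis .
  qed
  have E: "norm (F 0 * (b - K) + F pi * cnj (b - K)) \<le> M * (1/l) + M * (1/l)"
  proof -
    have "norm (F z) * norm (b - K) \<le> M * (1/l)" if "z \<in> {0..pi}" for z
      using mult_mono[OF M(1)[OF that] bK M0 norm_ge_zero] .
    from this[of 0] this[of pi] show ?thesis
      by (intro order.trans[OF norm_triangle_ineq] add_mono) (simp_all only: norm_mult complex_mod_cnj, auto)
  qed
  have "integral {0..pi} (\<lambda>s. F s * cis (l * cos s))
           - of_real (sqrt (2/l)) * (Fres_lim * cis l * F 0 + cnj Fres_lim * cis (-l) * F pi)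
      = integral {0..pi} (\<lambda>s. R s * cis (l * cos s)) + (F 0 * (b - K) + F pi * cnj (b - K))"
    unfolding eq by (simp add: K_def algebra_simps cis_cnj)
  hence "norm (integral {0..pi} (\<lambda>s. F s * cis (l * cos s))
           - of_real (sqrt (2/l)) * (Fres_lim * cis l * F 0 + cnj Fres_lim * cis (-l) * F pi))
      \<le> 200 * (2 * M) * (1 + ln l) / l + (M * (1/l) + M * (1/l))"
    by (simp only:) (rule order.trans[OF norm_triangle_ineq add_mono[OF R E]])
  also have "\<dots> = (400 * M * (1 + ln l) + 2 * M) / l" using l by (simp add: field_simps)
  also have "\<dots> \<le> (402 * M * (1 + ln l)) / l"
    using l M0 by (intro divide_right_mono) (auto simp: algebra_simps)
  finally show ?thesis .
qed

text \<open>For an antiderivative g of \<open>h\<close>, the function g(x + pi) - g(x - pi) has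
  derivative 0 by periodicity. The interval of half-length pi + |sigma| is large enough to compare
  its values at 0 and at \<open>\<sigma>\<close>.\<close>

lemma integral_periodic_shift:
  fixes h :: "real \<Rightarrow> 'a::euclidean_space"
  assumes cont: "continuous_on UNIV h" and per: "\<And>s. h (s + 2 * pi) = h s"
  shows "integral {-pi..pi} (\<lambda>s. h (s + \<sigma>)) = integral {-pi..pi} h"
proof -
  define L where "L = pi + \<bar>\<sigma>\<bar>"
  have "continuous_on {-L..L} h" using cont continuous_on_subset by blast
  from antiderivative_continuous[OF this] obtain g
    where g: "\<And>x. x \<in> {-L..L} \<Longrightarrow> (g has_vector_derivative h x) (at x within {-L..L})" by blast
  have gs: "((\<lambda>x. g (x + c)) has_vector_derivative h (x + c)) (at x within S)"
    if "(\<lambda>x. x + c) ` S \<subseteq> {-L..L}" "x \<in> S" for S c x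
  proof -
    have "((\<lambda>x. x + c) has_vector_derivative 1) (at x within S)" by (auto intro!: derivative_eq_intros)
    from vector_diff_chain_within[OF this has_vector_derivative_within_subset[OF g that(1)]] that
    show ?thesis by (auto simp: o_def)
  qed
  let ?S = "{-\<bar>\<sigma>\<bar>..\<bar>\<sigma>\<bar>}"
  have "\<exists>c. \<forall>x\<in>?S. g (x + pi) - g (x + (-pi)) = c"
  proof (rule has_vector_derivative_zero_constant)
    fix x assume x: "x \<in> ?S"
    have "h (x + pi) = h (x + (-pi))" using per[of "x - pi"] by (simp add: algebra_simps)
    thus "((\<lambda>x. g (x + pi) - g (x + (-pi))) has_vector_derivative 0) (at x within ?S)"
      using has_vector_derivative_diff[OF gs[of pi ?S x] gs[of "-pi" ?S x]] x by (auto simp: L_def)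
  qed auto
  then obtain c0 where c0: "\<And>x. x \<in> ?S \<Longrightarrow> g (x + pi) - g (x + (-pi)) = c0" by blast
  have "0 \<in> ?S" "\<sigma> \<in> ?S" by auto
  from c0[OF this(1)] c0[OF this(2)]
  have c: "g (0 + pi) - g (0 + (-pi)) = g (\<sigma> + pi) - g (\<sigma> + (-pi))" by simp
  have "((\<lambda>s. h (s + c)) has_integral g (pi + c) - g (- pi + c)) {-pi..pi}" if "\<bar>c\<bar> \<le> \<bar>\<sigma>\<bar>" for c
    by (intro fundamental_theorem_of_calculus gs) (use that in \<open>auto simp: L_def\<close>)
  from this[of \<sigma>, THEN integral_unique] this[of 0, THEN integral_unique] c show ?thesis
    by (simp add: add.commute)
qed

text \<open>After centring at \<open>\<sigma>\<close>, the two halves of the period share the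
  stationary points \<open>\<sigma>\<close> and \<open>\<sigma> + pi\<close>. Each half gives the
  same leading term, so sqrt(2/l) becomes 2 sqrt(2/l) = sqrt(8/l) and the error constant
  doubles.\<close>

lemma stationary_phase:
  fixes G :: "real \<Rightarrow> complex"
  assumes G: "\<And>s. (G has_vector_derivative G' s) (at s)"
    and per: "\<And>s. G (s + 2 * pi) = G s"
    and M: "\<And>s. norm (G s) \<le> M" "\<And>s. norm (G' s) \<le> M"
    and l: "l \<ge> 1"
  shows "norm (integral {-pi..pi} (\<lambda>s. G s * cis (l * cos (s - \<sigma>)))
           - of_real (sqrt (8/l)) * (Fres_lim * cis l * G \<sigma> + cnj Fres_lim * cis (-l) * G (\<sigma> + pi)))
         \<le> 804 * M * (1 + ln l) / l"
proof -
  have contG: "continuous_on UNIV G"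
    using G by (intro continuous_on_vector_derivative) auto
  have "integral {-pi..pi} (\<lambda>s. G (s + \<sigma>) * cis (l * cos (s + \<sigma> - \<sigma>))) = integral {-pi..pi} (\<lambda>s. G s * cis (l * cos (s - \<sigma>)))"
  proof (rule integral_periodic_shift[of "\<lambda>s. G s * cis (l * cos (s - \<sigma>))"])
    fix s
    have "cos (s + 2 * pi - \<sigma>) = cos (s - \<sigma>)" by (metis add_diff_eq add.commute cos_periodic diff_add_eq)
    thus "G (s + 2 * pi) * cis (l * cos (s + 2 * pi - \<sigma>)) = G s * cis (l * cos (s - \<sigma>))" by (simp only: per)
  qed (intro continuous_intros contG)
  hence shift: "integral {-pi..pi} (\<lambda>s. G s * cis (l * cos (s - \<sigma>))) = integral {-pi..pi} (\<lambda>s. G (s + \<sigma>) * cis (l * cos s))"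
    by simp
  have cont2: "continuous_on A (\<lambda>s. G (f s))" if "continuous_on A f" for A and f :: "real \<Rightarrow> real"
    by (rule continuous_on_compose2[OF contG that]) auto
  have "integral {-pi..0} (\<lambda>s. G (s + \<sigma>) * cis (l * cos s)) + integral {0..pi} (\<lambda>s. G (s + \<sigma>) * cis (l * cos s))
      = integral {-pi..pi} (\<lambda>s. G (s + \<sigma>) * cis (l * cos s))"
    by (intro Henstock_Kurzweil_Integration.integral_combine integrable_continuous_real continuous_intros cont2) auto
  moreover have "integral {-pi..0} (\<lambda>s. G (s + \<sigma>) * cis (l * cos s)) = integral {0..pi} (\<lambda>s. G (\<sigma> - s) * cis (l * cos s))"
    using Henstock_Kurzweil_Integration.integral_reflect_real[of pi 0 "\<lambda>s. G (\<sigma> - s) * cis (l * cos s)"] by (simp add: add.commute)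
  ultimately have eq: "integral {-pi..pi} (\<lambda>s. G s * cis (l * cos (s - \<sigma>))) =
     integral {0..pi} (\<lambda>s. G (\<sigma> - s) * cis (l * cos s)) + integral {0..pi} (\<lambda>s. G (s + \<sigma>) * cis (l * cos s))"
    unfolding shift by simp
  have GG: "G (\<sigma> - pi) = G (\<sigma> + pi)" using per[of "\<sigma> - pi"] by (simp add: algebra_simps)
  have h1: "norm (integral {0..pi} (\<lambda>s. G (\<sigma> - s) * cis (l * cos s))
           - of_real (sqrt (2/l)) * (Fres_lim * cis l * G \<sigma> + cnj Fres_lim * cis (-l) * G (\<sigma> + pi)))
         \<le> 402 * M * (1 + ln l) / l"
  proof -
    have "norm (integral {0..pi} (\<lambda>s. G (\<sigma> - s) * cis (l * cos s))
           - of_real (sqrt (2/l)) * (Fres_lim * cis l * G (\<sigma> - 0) + cnj Fres_lim * cis (-l) * G (\<sigma> - pi)))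
         \<le> 402 * M * (1 + ln l) / l"
    proof (rule stationary_phase_half[OF _ M(1) _ l])
      fix s
      have "((\<lambda>s. \<sigma> - s) has_vector_derivative -1) (at s)" by (auto intro!: derivative_eq_intros)
      from vector_diff_chain_at[OF this G]
      have "((\<lambda>s. G (\<sigma> - s)) has_vector_derivative - G' (\<sigma> - s)) (at s)" by (simp add: o_def)
      thus "((\<lambda>s. G (\<sigma> - s)) has_vector_derivative - G' (\<sigma> - s)) (at s within {0..pi})"
        by (rule has_vector_derivative_at_within)
      show "norm (- G' (\<sigma> - s)) \<le> M" using M(2) by simp
    qed
    thus ?thesis by (simp add: GG add.commute)
  qed
  have h2: "norm (integral {0..pi} (\<lambda>s. G (s + \<sigma>) * cis (l * cos s))
           - of_real (sqrt (2/l)) * (Fres_lim * cis l * G \<sigma> + cnj Fres_lim * cis (-l) * G (\<sigma> + pi)))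
         \<le> 402 * M * (1 + ln l) / l"
  proof -
    have "norm (integral {0..pi} (\<lambda>s. G (s + \<sigma>) * cis (l * cos s))
           - of_real (sqrt (2/l)) * (Fres_lim * cis l * G (0 + \<sigma>) + cnj Fres_lim * cis (-l) * G (pi + \<sigma>)))
         \<le> 402 * M * (1 + ln l) / l"
    proof (rule stationary_phase_half[OF _ M(1) _ l])
      fix s
      have "((\<lambda>s. s + \<sigma>) has_vector_derivative 1) (at s)" by (auto intro!: derivative_eq_intros)
      from vector_diff_chain_at[OF this G]
      have "((\<lambda>s. G (s + \<sigma>)) has_vector_derivative  G' (s + \<sigma>)) (at s)" by (simp add: o_def)
      thus "((\<lambda>s. G (s + \<sigma>)) has_vector_derivative  G' (s + \<sigma>)) (at s within {0..pi})"
        by (rule has_vector_derivative_at_within)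
      show "norm ( G' (s + \<sigma>)) \<le> M" using M(2) by simp
    qed
    thus ?thesis by (simp add: GG add.commute)
  qed
  have s8: "sqrt (8/l) = sqrt (2/l) + sqrt (2/l)"
  proof -
    have "sqrt (8/l) = sqrt (2^2 * (2/l))" by simp
    thus ?thesis by (simp only: real_sqrt_mult) simp
  qed
  have "norm (integral {-pi..pi} (\<lambda>s. G s * cis (l * cos (s - \<sigma>)))
           - of_real (sqrt (8/l)) * (Fres_lim * cis l * G \<sigma> + cnj Fres_lim * cis (-l) * G (\<sigma> + pi)))
       \<le> 402 * M * (1 + ln l) / l + 402 * M * (1 + ln l) / l"
    unfolding eq s8
    by (rule order.trans[OF _ add_mono[OF h1 h2]], rule order.trans[OF _ norm_triangle_ineq])
       (simp add: algebra_simps)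
  also have "\<dots> = 804 * M * (1 + ln l) / l" by simp
  finally show ?thesis .
qed

text \<open>Integration by parts would need a derivative of g/d', but both functions are only
  continuous. So g/d' is approximated uniformly by a polynomial \<open>P\<close>; then d' P cis(k d)
  can be integrated by parts, with d' supplied by the phase itself.\<close>

lemma riemann_lebesgue_phase:
  fixes g :: "real \<Rightarrow> complex" and d d' :: "real \<Rightarrow> real"
  assumes uv: "u \<le> v" and g: "continuous_on {u..v} g"
    and d: "\<And>x. x \<in> {u..v} \<Longrightarrow> (d has_real_derivative d' x) (at x within {u..v})"
    and d': "continuous_on {u..v} d'" "\<And>x. x \<in> {u..v} \<Longrightarrow> d' x \<noteq> 0"
  shows "((\<lambda>k. integral {u..v} (\<lambda>x. g x * cis (k * d x))) \<longlongrightarrow> 0) at_top"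
proof (rule tendstoI)
  fix e :: real assume e: "e > 0"
  have contd: "continuous_on {u..v} d" using d by (rule DERIV_continuous_on)
  have "bounded (d' ` {u..v})" by (intro compact_imp_bounded compact_continuous_image d') auto
  then obtain B where B: "B > 0" "\<And>x. x \<in> {u..v} \<Longrightarrow> \<bar>d' x\<bar> \<le> B"
    unfolding bounded_pos by auto
  define h where "h = (\<lambda>x. g x / of_real (d' x))"
  have conth: "continuous_on {u..v} h" unfolding h_def using d' g by (intro continuous_intros) auto
  \<comment> \<open>Makes the approximation error at most e/2 for all k; the added 1 keeps the
    denominator positive when u = v.\<close>
  define e1 where "e1 = e / (2 * B * (v - u + 1))"
  have e1: "e1 > 0" using e B uv by (simp add: e1_def)
  obtain P where P: "polynomial_function P" "\<And>x. x \<in> {u..v} \<Longrightarrow> norm (h x - P x) < e1"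
    using Stone_Weierstrass_polynomial_function[OF _ conth e1] by auto
  obtain P' where P': "polynomial_function P'" "\<And>x. (P has_vector_derivative P' x) (at x)"
    using has_vector_derivative_polynomial_function[OF P(1)] by blast
  have contP: "continuous_on S P" "continuous_on S P'" for S
    using P P' continuous_on_polymonial_function by blast+
  have "bounded (P' ` {u..v})" by (intro compact_imp_bounded compact_continuous_image contP) auto
  then obtain C where C: "C > 0" "\<And>x. x \<in> {u..v} \<Longrightarrow> norm (P' x) \<le> C"
    unfolding bounded_pos by auto
  define D where "D = norm (P v) + norm (P u) + C * (v - u)"
  have main: "norm (integral {u..v} (\<lambda>x. g x * cis (k * d x))) \<le> e / 2 + D / k" if k: "k > 0" for k
  proof -
    have "((\<lambda>s. (\<i> * of_real (k * d' s) * P s + P' s) * cis (k * d s)) has_integral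
           (P v * cis (k * d v) - P u * cis (k * d u))) {u..v}"
      by (rule osc_parts[OF uv]) (auto intro!: derivative_eq_intros P' d has_vector_derivative_at_within[OF P'(2)])
    moreover have "((\<lambda>s. P' s * cis (k * d s)) has_integral integral {u..v} (\<lambda>s. P' s * cis (k * d s))) {u..v}"
      by (intro integrable_integral integrable_continuous_real continuous_intros contd contP)
    ultimately have "((\<lambda>s. (\<i> * of_real (k * d' s) * P s + P' s) * cis (k * d s) - P' s * cis (k * d s)) has_integral
           (P v * cis (k * d v) - P u * cis (k * d u)) - integral {u..v} (\<lambda>s. P' s * cis (k * d s))) {u..v}"
      by (rule has_integral_diff)
    hence "((\<lambda>s. (- \<i> / of_real k) * ((\<i> * of_real (k * d' s) * P s + P' s) * cis (k * d s) - P' s * cis (k * d s))) has_integral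
           (- \<i> / of_real k) * ((P v * cis (k * d v) - P u * cis (k * d u)) - integral {u..v} (\<lambda>s. P' s * cis (k * d s)))) {u..v}"
      by (rule has_integral_mult_right)
    hence 1: "((\<lambda>s. of_real (d' s) * P s * cis (k * d s)) has_integral
           (- \<i> / of_real k) * ((P v * cis (k * d v) - P u * cis (k * d u)) - integral {u..v} (\<lambda>s. P' s * cis (k * d s)))) {u..v}"
      using k by (elim has_integral_eq[rotated]) (simp add: field_simps)
    have nP: "norm (integral {u..v} (\<lambda>s. P' s * cis (k * d s))) \<le> C * (v - u)"
      using C uv by (intro integral_bound continuous_intros contd contP) (auto simp: norm_mult)
    have "norm ((P v * cis (k * d v) - P u * cis (k * d u)) - integral {u..v} (\<lambda>s. P' s * cis (k * d s)))
        \<le> (norm (P v) + norm (P u)) + C * (v - u)"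
      by (intro order.trans[OF norm_triangle_ineq4] add_mono nP) (auto simp: norm_mult)
    hence n1: "norm ((- \<i> / of_real k) * ((P v * cis (k * d v) - P u * cis (k * d u)) - integral {u..v} (\<lambda>s. P' s * cis (k * d s)))) \<le> D / k"
      using k by (simp add: norm_mult norm_divide D_def divide_right_mono)
    have 2: "((\<lambda>s. (h s - P s) * of_real (d' s) * cis (k * d s)) has_integral integral {u..v} (\<lambda>s. (h s - P s) * of_real (d' s) * cis (k * d s))) {u..v}"
      by (intro integrable_integral integrable_continuous_real continuous_intros contd contP conth d')
    have n2: "norm (integral {u..v} (\<lambda>s. (h s - P s) * of_real (d' s) * cis (k * d s))) \<le> (e1 * B) * (v - u)"
    proof (rule integral_bound[OF uv])
      show "continuous_on {u..v} (\<lambda>s. (h s - P s) * of_real (d' s) * cis (k * d s))"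
        by (intro continuous_intros contd contP conth d')
      fix s assume s: "s \<in> {u..v}"
      show "norm ((h s - P s) * of_real (d' s) * cis (k * d s)) \<le> e1 * B"
        using P(2)[OF s] B(2)[OF s] e1 by (auto simp: norm_mult intro!: mult_mono)
    qed
    have "((\<lambda>s. g s * cis (k * d s)) has_integral
        (integral {u..v} (\<lambda>s. (h s - P s) * of_real (d' s) * cis (k * d s)) +
        (- \<i> / of_real k) * ((P v * cis (k * d v) - P u * cis (k * d u)) - integral {u..v} (\<lambda>s. P' s * cis (k * d s))))) {u..v}"
      using has_integral_add[OF 2 1] d'(2) by (elim has_integral_eq[rotated]) (simp add: h_def field_simps)
    hence "norm (integral {u..v} (\<lambda>x. g x * cis (k * d x))) \<le> (e1 * B) * (v - u) + D / k"
      using n1 n2 by (simp only: integral_unique) (rule order.trans[OF norm_triangle_ineq add_mono])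
    moreover have "(e1 * B) * (v - u) \<le> e / 2"
    proof -
      have "(e1 * B) * (v - u) = (e / 2) * ((v - u) / (v - u + 1))" using B by (simp add: e1_def)
      also have "\<dots> \<le> (e / 2) * 1" using e uv by (intro mult_left_mono) auto
      finally show ?thesis by simp
    qed
    ultimately show ?thesis by linarith
  qed
  have "eventually (\<lambda>k. k > max 0 (2 * D / e)) at_top" by (rule eventually_gt_at_top)
  thus "eventually (\<lambda>k. dist (integral {u..v} (\<lambda>x. g x * cis (k * d x))) 0 < e) at_top"
  proof eventually_elim
    case (elim k)
    hence "D / k < e / 2" using e by (simp add: field_simps)
    moreover have "k > 0" using elim by simp
    ultimately have "norm (integral {u..v} (\<lambda>x. g x * cis (k * d x))) < e" using main[of k] by linarith
    thus ?case by simp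
  qed
qed

section \<open>Functions of a direction, represented as 2 pi periodic functions of an angle\<close>

lemma periodic_2pi_int:
  fixes G :: "real \<Rightarrow> 'a"
  assumes per: "\<And>s. G (s + 2 * pi) = G s"
  shows "G (s + 2 * pi * of_int n) = G s"
proof -
  have nat: "G (s + 2 * pi * of_nat n) = G s" for n s
  proof (induction n arbitrary: s)
    case (Suc n)
    have "s + 2 * pi * of_nat (Suc n) = (s + 2 * pi * of_nat n) + 2 * pi" by (simp add: algebra_simps)
    thus ?case using Suc per by metis
  qed simp
  show ?thesis
  proof (cases n rule: int_cases2)
    case (nonneg m) thus ?thesis using nat by simp
  next
    case (nonpos m)
    thus ?thesis using nat[of "s + 2 * pi * of_int n" m] by simp
  qed
qed

lemma periodic_cis_cong:
  fixes G :: "real \<Rightarrow> 'a"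
  assumes per: "\<And>s. G (s + 2 * pi) = G s" and eq: "cis x = cis y"
  shows "G x = G y"
proof -
  have "cos x = cos y \<and> sin x = sin y" using arg_cong[OF eq, of Re] arg_cong[OF eq, of Im] by simp
  then obtain n where "x = y + 2 * n * pi" "n \<in> \<int>"
    using sin_cos_eq_iff[of x y] by (auto)
  thus ?thesis using periodic_2pi_int[of G y, OF per] by (auto elim!: Ints_cases simp: algebra_simps)
qed

text \<open>On the branch cut, \<open>Arg w\<close> is replaced by \<open>Arg (- w) + pi\<close>,
  which is continuous there and differs from it by a multiple of 2 pi, invisible to
  \<open>G\<close>.\<close>

lemma continuous_on_periodic_Arg:
  fixes G :: "real \<Rightarrow> 'a::topological_space"
  assumes per: "\<And>s. G (s + 2 * pi) = G s" and cont: "continuous_on UNIV G"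
  shows "continuous_on (- {0}) (\<lambda>z. G (Arg z))"
proof (rule continuous_at_imp_continuous_on, rule ballI)
  fix z :: complex assume "z \<in> - {0}"
  hence z: "z \<noteq> 0" by simp
  have Gc: "isCont G x" for x using cont by (simp add: continuous_on_eq_continuous_at)
  show "isCont (\<lambda>z. G (Arg z)) z"
  proof (cases "z \<in> \<real>\<^sub>\<le>\<^sub>0")
    case False
    thus ?thesis using continuous_at_Arg Gc by (intro isCont_o2[where f = Arg and g = G]) auto
  next
    case True
    hence nz: "- z \<notin> \<real>\<^sub>\<le>\<^sub>0" using z by (auto simp: complex_nonpos_Reals_iff complex_eq_iff)
    have "isCont (\<lambda>w. Arg (- w)) z"
      using continuous_at_Arg[OF nz] by (intro isCont_o2[where f = uminus and g = Arg]) auto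
    hence "isCont (\<lambda>w. G (Arg (- w) + pi)) z"
      using Gc by (intro isCont_o2[where f = "\<lambda>w. Arg (- w) + pi" and g = G]) (auto intro!: continuous_intros)
    moreover have "eventually (\<lambda>w. w \<in> - {0}) (nhds z)"
      using z by (intro eventually_nhds_in_open) auto
    hence "eventually (\<lambda>w. G (Arg w) = G (Arg (- w) + pi)) (nhds z)"
    proof (eventually_elim)
      case (elim w)
      have "cis (Arg w) = cis (Arg (- w) + pi)"
        using elim by (simp add: cis_Arg sgn_minus flip: cis_mult)
      thus ?case by (intro periodic_cis_cong[of G, OF per])
    qed
    ultimately show ?thesis by (simp add: isCont_cong)
  qed
qed

definition C1_periodic :: "(real \<Rightarrow> complex) \<Rightarrow> bool" where
  "C1_periodic G \<longleftrightarrow> G C1_differentiable_on UNIV \<and> (\<forall>s. G (s + 2 * pi) = G s)"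

lemma C1_periodicI:
  assumes "\<And>s. (G has_vector_derivative G' s) (at s)" "continuous_on UNIV G'" "\<And>s. G (s + 2 * pi) = G s"
  shows "C1_periodic G"
  using assms unfolding C1_periodic_def C1_differentiable_on_def by blast

lemma C1_periodicE:
  assumes "C1_periodic G"
  obtains G' where "\<And>s. (G has_vector_derivative G' s) (at s)" "continuous_on UNIV G'" "\<And>s. G (s + 2 * pi) = G s"
  using assms unfolding C1_periodic_def C1_differentiable_on_def by blast

lemma C1_periodic_per: "C1_periodic G \<Longrightarrow> G (s + 2 * pi) = G s"
  by (simp add: C1_periodic_def)

lemma C1_periodic_continuous: "C1_periodic G \<Longrightarrow> continuous_on UNIV G"
  by (elim C1_periodicE) (rule continuous_on_vector_derivative, auto)

lemma C1_periodic_mult: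
  assumes "C1_periodic F" "C1_periodic G"
  shows "C1_periodic (\<lambda>s. F s * G s)"
proof -
  obtain F' where F: "\<And>s. (F has_vector_derivative F' s) (at s)" "continuous_on UNIV F'" "\<And>s. F (s + 2 * pi) = F s"
    using C1_periodicE[OF assms(1)] by blast
  obtain G' where G: "\<And>s. (G has_vector_derivative G' s) (at s)" "continuous_on UNIV G'" "\<And>s. G (s + 2 * pi) = G s"
    using C1_periodicE[OF assms(2)] by blast
  show ?thesis
  proof (rule C1_periodicI)
    show "((\<lambda>s. F s * G s) has_vector_derivative F s * G' s + F' s * G s) (at s)" for s
      by (rule has_vector_derivative_mult[OF F(1) G(1)])
    show "continuous_on UNIV (\<lambda>s. F s * G' s + F' s * G s)"
      by (intro continuous_intros F G assms C1_periodic_continuous)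
  qed (simp add: F G)
qed

lemma C1_periodic_of_real:
  assumes "\<And>s. (g has_real_derivative g' s) (at s)" "continuous_on UNIV g'" "\<And>s. g (s + 2 * pi) = g s"
  shows "C1_periodic (\<lambda>s. complex_of_real (g s))"
proof (rule C1_periodicI)
  show "((\<lambda>s. complex_of_real (g s)) has_vector_derivative of_real (g' s)) (at s)" for s
    using assms(1) by (intro has_vector_derivative_of_real) (simp add: has_real_derivative_iff_has_vector_derivative)
  show "continuous_on UNIV (\<lambda>s. complex_of_real (g' s))" by (intro continuous_intros assms)
qed (simp add: assms)

text \<open>The periodicity hypothesis is about \<open>cis (h s)\<close> because the angles
  substituted later, such as \<open>th\<close>, grow by 2 pi over a period.\<close>

lemma C1_periodic_lift:
  fixes h h' :: "real \<Rightarrow> real"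
  assumes "C1_periodic G" "\<And>s. (h has_real_derivative h' s) (at s)" "continuous_on UNIV h'"
    "\<And>s. cis (h (s + 2 * pi)) = cis (h s)"
  shows "C1_periodic (\<lambda>s. G (h s))"
proof -
  obtain G' where G: "\<And>s. (G has_vector_derivative G' s) (at s)" "continuous_on UNIV G'" "\<And>s. G (s + 2 * pi) = G s"
    using C1_periodicE[OF assms(1)] by blast
  have ch: "continuous_on UNIV h" by (rule DERIV_continuous_on) (rule assms(2))
  show ?thesis
  proof (rule C1_periodicI)
    show "((\<lambda>s. G (h s)) has_vector_derivative h' s *\<^sub>R G' (h s)) (at s)" for s
      using vector_diff_chain_at[OF assms(2)[unfolded has_real_derivative_iff_has_vector_derivative] G(1)]
      by (simp add: o_def)
    show "continuous_on UNIV (\<lambda>s. h' s *\<^sub>R G' (h s))"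
      by (intro continuous_intros assms continuous_on_compose2[OF G(2) ch]) auto
    show "G (h (s + 2 * pi)) = G (h s)" for s by (rule periodic_cis_cong[of G, OF G(3) assms(4)])
  qed
qed

lemma periodic_reduce:
  fixes x :: real
  obtains y where "y \<in> {-pi..pi}" "\<And>G :: real \<Rightarrow> 'a. (\<And>s. G (s + 2 * pi) = G s) \<Longrightarrow> G x = G y"
proof
  show "Arg (cis x) \<in> {-pi..pi}" using mpi_less_Arg[of "cis x"] Arg_le_pi[of "cis x"] by auto
  fix G :: "real \<Rightarrow> 'a" assume "\<And>s. G (s + 2 * pi) = G s"
  thus "G x = G (Arg (cis x))" by (rule periodic_cis_cong) (simp add: cis_Arg sgn_eq)
qed

lemma periodic_bounded:
  fixes G :: "real \<Rightarrow> 'a::real_normed_vector"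
  assumes "continuous_on UNIV G" "\<And>s. G (s + 2 * pi) = G s"
  obtains M where "M > 0" "\<And>s. norm (G s) \<le> M"
proof -
  have "bounded (G ` {-pi..pi})"
    by (intro compact_imp_bounded compact_continuous_image continuous_on_subset[OF assms(1)]) auto
  then obtain M where M: "M > 0" "\<And>s. s \<in> {-pi..pi} \<Longrightarrow> norm (G s) \<le> M"
    unfolding bounded_pos by blast
  have "norm (G s) \<le> M" for s
  proof -
    obtain y where "y \<in> {-pi..pi}" "G s = G y" using periodic_reduce[of s] assms(2) by metis
    thus ?thesis using M by auto
  qed
  thus thesis using M that by blast
qed

lemma stationary_phase_C1_periodic:
  assumes "C1_periodic G"
  obtains C where "C > 0"
    "\<And>l \<sigma>. l \<ge> 1 \<Longrightarrow> norm (integral {-pi..pi} (\<lambda>s. G s * cis (l * cos (s - \<sigma>)))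
           - of_real (sqrt (8/l)) * (Fres_lim * cis l * G \<sigma> + cnj Fres_lim * cis (-l) * G (\<sigma> + pi)))
         \<le> C * (1 + ln l) / l"
proof -
  obtain G' where G: "\<And>s. (G has_vector_derivative G' s) (at s)" "continuous_on UNIV G'" "\<And>s. G (s + 2 * pi) = G s"
    using C1_periodicE[OF assms] by blast
  have per': "G' (s + 2 * pi) = G' s" for s
  proof (rule vector_derivative_unique_at[OF _ G(1)])
    have "((\<lambda>s. s + 2 * pi) has_vector_derivative 1) (at s)" by (auto intro!: derivative_eq_intros)
    from vector_diff_chain_at[OF this G(1)]
    show "(G has_vector_derivative G' (s + 2 * pi)) (at s)" by (simp add: o_def G(3))
  qed
  obtain M1 where M1: "M1 > 0" "\<And>s. norm (G s) \<le> M1"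
    using periodic_bounded[OF C1_periodic_continuous[OF assms] G(3)] by blast
  obtain M2 where M2: "M2 > 0" "\<And>s. norm (G' s) \<le> M2"
    using periodic_bounded[OF G(2) per'] by blast
  define M where "M = max M1 M2"
  have M: "\<And>s. norm (G s) \<le> M" "\<And>s. norm (G' s) \<le> M" "M > 0"
    using M1 M2 by (auto simp: M_def intro: max.coboundedI1 max.coboundedI2)
  show thesis
    by (rule that[of "804 * M"]) (use M stationary_phase[OF G(1) G(3) M(1,2)] in auto)
qed

text \<open>Uniformity in \<open>N\<close> is the point: the frequency will be k times the distance
  of a boundary point from the focus, and later k times the modulus of \<open>z1\<close> or
  \<open>z2\<close>. Multiplication by sqrt k makes the leading term of order one.\<close>

lemma stationary_phase_scaled:
  assumes "C1_periodic G" and m: "0 < m1"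
  obtains C k0 where "C > 0" "k0 \<ge> 1"
    "\<And>k N \<sigma>. k \<ge> k0 \<Longrightarrow> m1 \<le> N \<Longrightarrow> N \<le> m2 \<Longrightarrow>
        norm (of_real (sqrt k) * integral {-pi..pi} (\<lambda>s. G s * cis (k * N * cos (s - \<sigma>)))
           - of_real (sqrt (8/N)) * (Fres_lim * cis (k * N) * G \<sigma> + cnj Fres_lim * cis (- (k * N)) * G (\<sigma> + pi)))
         \<le> C * (1 + ln k) / sqrt k"
proof -
  obtain C where C: "C > 0"
    "\<And>l \<sigma>. l \<ge> 1 \<Longrightarrow> norm (integral {-pi..pi} (\<lambda>s. G s * cis (l * cos (s - \<sigma>)))
           - of_real (sqrt (8/l)) * (Fres_lim * cis l * G \<sigma> + cnj Fres_lim * cis (-l) * G (\<sigma> + pi)))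
         \<le> C * (1 + ln l) / l"
    using stationary_phase_C1_periodic[OF assms(1)] by blast
  define A where "A = 1 + \<bar>ln m2\<bar>"
  show thesis
  proof (rule that[of "C * A / m1" "max 1 (1/m1)"])
    fix k N \<sigma> assume k: "max 1 (1/m1) \<le> k" and N: "m1 \<le> N" "N \<le> m2"
    have k1: "k \<ge> 1" using k by simp
    have km: "k * m1 \<ge> 1" using k m by (simp add: field_simps)
    have l1: "k * N \<ge> 1" using order.trans[OF km mult_left_mono[of m1 N k]] N k1 by simp
    have Np: "N > 0" using N m by simp
    let ?I = "integral {-pi..pi} (\<lambda>s. G s * cis (k * N * cos (s - \<sigma>)))"
    let ?X = "Fres_lim * cis (k * N) * G \<sigma> + cnj Fres_lim * cis (- (k * N)) * G (\<sigma> + pi)"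
    have "sqrt k * sqrt (8/(k * N)) = sqrt (8/N)" using k1 Np by (simp flip: real_sqrt_mult)
    hence e: "complex_of_real (sqrt (8/N)) = of_real (sqrt k) * of_real (sqrt (8/(k * N)))"
      by (metis of_real_mult)
    have "of_real (sqrt k) * ?I - of_real (sqrt (8/N)) * ?X = of_real (sqrt k) * (?I - of_real (sqrt (8/(k * N))) * ?X)"
      unfolding e by (simp only: right_diff_distrib mult.assoc)
    hence "norm (of_real (sqrt k) * ?I - of_real (sqrt (8/N)) * ?X) = sqrt k * norm (?I - of_real (sqrt (8/(k * N))) * ?X)"
      using k1 by (simp only: norm_mult) simp
    also have "\<dots> \<le> sqrt k * (C * (1 + ln (k * N)) / (k * N))"
      using C(2)[OF l1, of \<sigma>] k1 by (intro mult_left_mono) auto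
    also have "\<dots> \<le> sqrt k * (C * (A * (1 + ln k)) / (k * m1))"
    proof (intro mult_left_mono frac_le)
      have "ln N \<le> \<bar>ln m2\<bar>" using N Np by (auto intro: order.trans[OF ln_mono abs_ge_self])
      moreover have "0 \<le> \<bar>ln m2\<bar> * ln k" using k1 by simp
      moreover have "1 + ln (k * N) = 1 + ln k + ln N" using k1 Np by (simp add: ln_mult)
      moreover have "A * (1 + ln k) = 1 + ln k + \<bar>ln m2\<bar> + \<bar>ln m2\<bar> * ln k" by (simp add: A_def algebra_simps)
      ultimately show "1 + ln (k * N) \<le> A * (1 + ln k)" by linarith
      show "0 \<le> C * (A * (1 + ln k))" using C k1 by (simp add: A_def)
    qed (use C k1 m N in auto)
    also have "\<dots> = C * A / m1 * (1 + ln k) / sqrt k"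
      using k1 m by (simp add: field_simps)
    finally show "norm (of_real (sqrt k) * ?I - of_real (sqrt (8/N)) * ?X) \<le> C * A / m1 * (1 + ln k) / sqrt k" .
  qed (use C m in \<open>auto simp: A_def intro!: divide_pos_pos mult_pos_pos\<close>)
qed

section \<open>L^2 bounds for oscillatory integrals depending on a parameter\<close>

lemma integral_swap_rect:
  fixes h :: "real \<Rightarrow> real \<Rightarrow> complex"
  assumes "continuous_on ({u..v} \<times> {p..r}) (\<lambda>(x,s). h x s)"
  shows "integral {u..v} (\<lambda>x. integral {p..r} (h x)) = integral {p..r} (\<lambda>s. integral {u..v} (\<lambda>x. h x s))"
  using integral_swap_continuous[of u p v r h] assms by (simp add: cbox_Pair_eq)

lemma continuous_on_integral_rect:
  fixes h :: "real \<Rightarrow> real \<Rightarrow> complex"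
  assumes "continuous_on ({u..v} \<times> {p..r}) (\<lambda>(x,s). h x s)"
  shows "continuous_on {p..r} (\<lambda>s. integral {u..v} (\<lambda>x. h x s))"
proof -
  have "continuous_on ({p..r} \<times> cbox u v) (\<lambda>(s,x). h x s)"
  proof -
    have "continuous_on ({p..r} \<times> cbox u v) (\<lambda>z. (\<lambda>(x,s). h x s) (snd z, fst z))"
      by (rule continuous_on_compose2[OF assms]) (auto intro!: continuous_intros)
    thus ?thesis by (simp add: case_prod_beta)
  qed
  from integral_continuous_on_param[OF this] show ?thesis by simp
qed

lemma has_integral_inverse_sqrt_dist:
  fixes u v y m :: real
  assumes "u \<le> y" "y \<le> v" "m > 0"
  shows "((\<lambda>x. 1 / sqrt (1 + m * \<bar>x - y\<bar>)) has_integral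
     (2 * sqrt (1 + m * (y - u)) / m - 2 / m) + (2 * sqrt (1 + m * (v - y)) / m - 2 / m)) {u..v}"
proof -
  have "((\<lambda>x. 1 / sqrt (1 + m * \<bar>x - y\<bar>)) has_integral
     (- 2 * sqrt (1 + m * (y - y)) / m) - (- 2 * sqrt (1 + m * (y - u)) / m)) {u..y}"
  proof (rule fundamental_theorem_of_calculus[OF assms(1)])
    fix x assume x: "x \<in> {u..y}"
    have p: "1 + m * (y - x) > 0" using x assms by (intro add_pos_nonneg) auto
    have "((\<lambda>x. - 2 * sqrt (1 + m * (y - x)) / m) has_real_derivative 1 / sqrt (1 + m * (y - x))) (at x within {u..y})"
      using p assms by (auto intro!: derivative_eq_intros simp: field_simps)
    thus "((\<lambda>x. - 2 * sqrt (1 + m * (y - x)) / m) has_vector_derivative 1 / sqrt (1 + m * \<bar>x - y\<bar>)) (at x within {u..y})"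
      using x by (simp add: has_real_derivative_iff_has_vector_derivative)
  qed
  moreover have "((\<lambda>x. 1 / sqrt (1 + m * \<bar>x - y\<bar>)) has_integral
     (2 * sqrt (1 + m * (v - y)) / m) - (2 * sqrt (1 + m * (y - y)) / m)) {y..v}"
  proof (rule fundamental_theorem_of_calculus[OF assms(2)])
    fix x assume x: "x \<in> {y..v}"
    have p: "1 + m * (x - y) > 0" using x assms by (intro add_pos_nonneg) auto
    have "((\<lambda>x. 2 * sqrt (1 + m * (x - y)) / m) has_real_derivative 1 / sqrt (1 + m * (x - y))) (at x within {y..v})"
      using p assms by (auto intro!: derivative_eq_intros simp: field_simps)
    thus "((\<lambda>x. 2 * sqrt (1 + m * (x - y)) / m) has_vector_derivative 1 / sqrt (1 + m * \<bar>x - y\<bar>)) (at x within {y..v})"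
      using x by (simp add: has_real_derivative_iff_has_vector_derivative)
  qed
  ultimately show ?thesis
    using has_integral_combine[OF assms(1,2)] by fastforce
qed

text \<open>A T T* argument: the square is expanded into a double integral over x and y, and the
  s-integral is estimated before those two. Integrating the kernel bound over x gives at most 4 C
  sqrt(1 + m (v - u)) / m for every y, and the y-integral adds the factor v - u.\<close>

lemma kernel_L2_bound:
  fixes w :: "real \<Rightarrow> real \<Rightarrow> complex"
  assumes uv: "u \<le> v" and cont: "continuous_on ({u..v} \<times> {p..r}) (\<lambda>(x,s). w x s)"
    and C: "C \<ge> 0" and m: "m > 0"
    and K: "\<And>x y. x \<in> {u..v} \<Longrightarrow> y \<in> {u..v} \<Longrightarrow>
        norm (integral {p..r} (\<lambda>s. w x s * cnj (w y s))) \<le> C / sqrt (1 + m * \<bar>x - y\<bar>)"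
  shows "integral {p..r} (\<lambda>s. (norm (integral {u..v} (\<lambda>x. w x s)))\<^sup>2) \<le> C * (4 * sqrt (1 + m * (v - u)) / m) * (v - u)"
proof -
  define W where "W = (\<lambda>s. integral {u..v} (\<lambda>x. w x s))"
  have contW: "continuous_on {p..r} W" unfolding W_def by (rule continuous_on_integral_rect[OF cont])
  have cy: "continuous_on {p..r} (w y)" if "y \<in> {u..v}" for y
  proof -
    have "continuous_on {p..r} (\<lambda>s. (\<lambda>(x,s). w x s) (y, s))"
      by (rule continuous_on_compose2[OF cont]) (use that in \<open>auto intro!: continuous_intros\<close>)
    thus ?thesis by simp
  qed
  have cW2: "continuous_on ({u..v} \<times> {p..r}) (\<lambda>z. W (snd z))"
    by (rule continuous_on_compose2[OF contW]) (auto intro!: continuous_intros)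
  have 1: "W s * cnj (W s) = integral {u..v} (\<lambda>y. W s * cnj (w y s))" if "s \<in> {p..r}" for s
    by (simp add: W_def integral_mult_right integral_cnj)
  have "integral {p..r} (\<lambda>s. W s * cnj (W s)) = integral {p..r} (\<lambda>s. integral {u..v} (\<lambda>y. W s * cnj (w y s)))"
    by (intro integral_cong 1)
  also have "\<dots> = integral {u..v} (\<lambda>y. integral {p..r} (\<lambda>s. W s * cnj (w y s)))"
    by (rule integral_swap_rect[symmetric])
       (use cW2 cont in \<open>auto simp: case_prod_beta intro!: continuous_intros\<close>)
  finally have eq: "integral {p..r} (\<lambda>s. W s * cnj (W s)) = integral {u..v} (\<lambda>y. integral {p..r} (\<lambda>s. W s * cnj (w y s)))" .
  have in2: "norm (integral {p..r} (\<lambda>s. W s * cnj (w y s))) \<le> C * (4 * sqrt (1 + m * (v - u)) / m)" if y: "y \<in> {u..v}" for y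
  proof -
    have cc: "continuous_on ({u..v} \<times> {p..r}) (\<lambda>(x,s). w x s * cnj (w y s))"
    proof -
      have "continuous_on ({u..v} \<times> {p..r}) (\<lambda>z. w y (snd z))"
        by (rule continuous_on_compose2[OF cy[OF y]]) (auto intro!: continuous_intros)
      thus ?thesis using cont by (auto simp: case_prod_beta intro!: continuous_intros)
    qed
    have "integral {p..r} (\<lambda>s. W s * cnj (w y s)) = integral {p..r} (\<lambda>s. integral {u..v} (\<lambda>x. w x s * cnj (w y s)))"
      by (simp add: W_def)
    also have "\<dots> = integral {u..v} (\<lambda>x. integral {p..r} (\<lambda>s. w x s * cnj (w y s)))"
      by (rule integral_swap_rect[symmetric, OF cc])
    finally have e: "integral {p..r} (\<lambda>s. W s * cnj (w y s)) = integral {u..v} (\<lambda>x. integral {p..r} (\<lambda>s. w x s * cnj (w y s)))" .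
    have hi: "((\<lambda>x. C * (1 / sqrt (1 + m * \<bar>x - y\<bar>))) has_integral
       C * ((2 * sqrt (1 + m * (y - u)) / m - 2 / m) + (2 * sqrt (1 + m * (v - y)) / m - 2 / m))) {u..v}"
      using y m by (intro has_integral_mult_right has_integral_inverse_sqrt_dist) auto
    have "(\<lambda>x. integral {p..r} (\<lambda>s. w x s * cnj (w y s))) integrable_on {u..v}"
    proof (rule integrable_continuous_real)
      have "continuous_on ({u..v} \<times> cbox p r) (\<lambda>(x,s). w x s * cnj (w y s))" using cc by simp
      from integral_continuous_on_param[OF this]
      show "continuous_on {u..v} (\<lambda>x. integral {p..r} (\<lambda>s. w x s * cnj (w y s)))" by simp
    qed
    hence "norm (integral {p..r} (\<lambda>s. W s * cnj (w y s))) \<le> integral {u..v} (\<lambda>x. C * (1 / sqrt (1 + m * \<bar>x - y\<bar>)))"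
      unfolding e using hi K y by (intro integral_norm_bound_integral) auto
    also have "\<dots> = C * ((2 * sqrt (1 + m * (y - u)) / m - 2 / m) + (2 * sqrt (1 + m * (v - y)) / m - 2 / m))"
      using hi by (rule integral_unique)
    also have "\<dots> \<le> C * ((2 * sqrt (1 + m * (v - u)) / m - 0) + (2 * sqrt (1 + m * (v - u)) / m - 0))"
      using y m C by (intro mult_left_mono add_mono diff_mono divide_right_mono real_sqrt_le_mono) auto
    finally show ?thesis by (simp add: algebra_simps)
  qed
  have "norm (integral {p..r} (\<lambda>s. W s * cnj (W s))) \<le> C * (4 * sqrt (1 + m * (v - u)) / m) * (v - u)"
    unfolding eq
  proof (rule integral_bound[OF uv])
    have "continuous_on ({u..v} \<times> cbox p r) (\<lambda>(y,s). W s * cnj (w y s))"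
      using cW2 cont by (auto simp: case_prod_beta intro!: continuous_intros)
    from integral_continuous_on_param[OF this]
    show "continuous_on {u..v} (\<lambda>y. integral {p..r} (\<lambda>s. W s * cnj (w y s)))" by simp
  qed (use in2 in auto)
  moreover have "integral {p..r} (\<lambda>s. W s * cnj (W s)) = of_real (integral {p..r} (\<lambda>s. (norm (W s))\<^sup>2))"
  proof -
    have "(\<lambda>s. (norm (W s))\<^sup>2) integrable_on {p..r}"
      by (intro integrable_continuous_real continuous_intros contW)
    from has_integral_linear[OF integrable_integral[OF this] bounded_linear_of_real[where 'a = complex]]
    have "((\<lambda>s. complex_of_real ((norm (W s))\<^sup>2)) has_integral of_real (integral {p..r} (\<lambda>s. (norm (W s))\<^sup>2))) {p..r}"
      by (simp only: o_def)
    thus ?thesis by (simp only: complex_norm_square integral_unique)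
  qed
  ultimately show ?thesis unfolding W_def by (simp add: abs_le_iff)
qed

section \<open>The ellipse with a focus at the origin\<close>

text \<open>Normalised position: the major axis is the first coordinate axis and the centre is (-f,
  0), so that one focus is the origin. Here \<open>f\<close> is half the distance between the foci,
  and \<open>f_less\<close> says e^2 < q.\<close>

locale focal_ellipse =
  fixes a b f q :: real
  assumes b_pos: "0 < b" and f_pos: "0 < f" and a_pos: "0 < a" and abf: "a\<^sup>2 = b\<^sup>2 + f\<^sup>2"
    and q_pos: "0 < q" and q_ne: "q \<noteq> 1" and f_less: "f\<^sup>2 < q * a\<^sup>2"
begin

lemma f_less_a: "f < a"
proof (rule power2_less_imp_less)
  show "f\<^sup>2 < a\<^sup>2" using abf b_pos by simp
qed (use a_pos in simp)

text \<open>\<open>rr\<close> is the distance of the boundary point (\<open>xx\<close>,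
  \<open>yy\<close>) from the origin: with b^2 = a^2 - f^2, the sum of the squares of its
  coordinates is (a - f cos s)^2.\<close>

definition xx :: "real \<Rightarrow> real" where "xx s = a * cos s - f"
definition yy :: "real \<Rightarrow> real" where "yy s = b * sin s"
definition rr :: "real \<Rightarrow> real" where "rr s = a - f * cos s"

lemma rr_ge: "a - f \<le> rr s" and rr_le: "rr s \<le> a + f"
proof -
  have "f * cos s \<le> f * 1" "f * (-1) \<le> f * cos s" using f_pos by (intro mult_left_mono; simp)+
  thus "a - f \<le> rr s" "rr s \<le> a + f" by (simp_all add: rr_def)
qed

lemma rr_pos: "rr s > 0" using rr_ge[of s] f_less_a by simp

text \<open>\<open>th\<close> is a smooth lift of the true anomaly as a function of the eccentric anomaly.\<close>

definition bb :: real where "bb = f / (a + b)"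
definition th :: "real \<Rightarrow> real" where
  "th s = s + 2 * arctan (bb * sin s / (1 - bb * cos s))"

lemma bb: "0 < bb" "bb < 1" using f_pos a_pos b_pos f_less_a by (auto simp: bb_def)

lemma bb_den: "1 - bb * cos s > 0"
proof -
  have "bb * cos s \<le> bb * 1" using bb by (intro mult_left_mono) auto
  thus ?thesis using bb by linarith
qed

text \<open>With beta = \<open>bb\<close>, the boundary point x + i y equals (a + b)/2 * e^(i s) *
  (1 - beta e^(-i s))^2, because beta (a + b) = f and beta^2 (a + b) = a - b. Its argument is
  therefore s + 2 arg(1 - beta e^(-i s)), which is \<open>th\<close>. In the proof, P + i R is the
  factor 1 - beta e^(-i s).\<close>

lemma cis_th: "of_real (rr s) * cis (th s) = Complex (xx s) (yy s)"
proof -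
  define P where "P = 1 - bb * cos s"
  define R where "R = bb * sin s"
  define y where "y = R / P"
  have P: "P > 0" using bb_den by (simp add: P_def)
  have ab: "a + b > 0" using a_pos b_pos by simp
  have sc: "(sin s)\<^sup>2 = 1 - (cos s)\<^sup>2" by (simp add: sin_squared_eq)
  have bb2: "bb\<^sup>2 * (a + b) = a - b"
  proof -
    have "f\<^sup>2 = (a - b) * (a + b)" using abf by (simp add: algebra_simps power2_eq_square)
    thus ?thesis using ab by (simp add: bb_def power_divide power2_eq_square)
  qed
  have bf: "bb * (a + b) = f" using ab by (simp add: bb_def)
  have PR: "(P\<^sup>2 + R\<^sup>2) * (a + b) = 2 * rr s"
  proof -
    have e: "P\<^sup>2 + R\<^sup>2 = 1 + bb\<^sup>2 - 2 * bb * cos s"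
      unfolding P_def R_def power_mult_distrib sc by (simp add: power2_eq_square algebra_simps)
    have "(P\<^sup>2 + R\<^sup>2) * (a + b) = (a + b) + bb\<^sup>2 * (a + b) - 2 * (bb * (a + b)) * cos s"
      unfolding e by (simp add: algebra_simps)
    thus ?thesis unfolding bb2 bf rr_def by simp
  qed
  have X: "(cos s * (P\<^sup>2 - R\<^sup>2) - sin s * (2 * P * R)) * (a + b) = 2 * xx s"
  proof -
    have "cos s * (P\<^sup>2 - R\<^sup>2) - sin s * (2 * P * R)
       = cos s * (1 - 2 * bb * cos s + bb\<^sup>2 * (cos s)\<^sup>2 - bb\<^sup>2 * (sin s)\<^sup>2) - 2 * bb * (sin s)\<^sup>2 + 2 * bb\<^sup>2 * cos s * (sin s)\<^sup>2"
      unfolding P_def R_def by (simp add: power2_eq_square algebra_simps)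
    also have "\<dots> = (1 + bb\<^sup>2) * cos s - 2 * bb"
      unfolding sc by (simp add: power2_eq_square algebra_simps)
    finally have e: "cos s * (P\<^sup>2 - R\<^sup>2) - sin s * (2 * P * R) = (1 + bb\<^sup>2) * cos s - 2 * bb" .
    have "(cos s * (P\<^sup>2 - R\<^sup>2) - sin s * (2 * P * R)) * (a + b)
       = ((a + b) + bb\<^sup>2 * (a + b)) * cos s - 2 * (bb * (a + b))" unfolding e by (simp add: algebra_simps)
    thus ?thesis unfolding bb2 bf xx_def by (simp add: algebra_simps)
  qed
  have Y: "(sin s * (P\<^sup>2 - R\<^sup>2) + cos s * (2 * P * R)) * (a + b) = 2 * yy s"
  proof -
    have "sin s * (P\<^sup>2 - R\<^sup>2) + cos s * (2 * P * R)
       = sin s * (1 - bb\<^sup>2 * (cos s)\<^sup>2 - bb\<^sup>2 * (sin s)\<^sup>2)"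
      unfolding P_def R_def by (simp add: power2_eq_square algebra_simps)
    also have "\<dots> = (1 - bb\<^sup>2) * sin s"
      unfolding sc by (simp add: power2_eq_square algebra_simps)
    finally have e: "sin s * (P\<^sup>2 - R\<^sup>2) + cos s * (2 * P * R) = (1 - bb\<^sup>2) * sin s" .
    have "(sin s * (P\<^sup>2 - R\<^sup>2) + cos s * (2 * P * R)) * (a + b)
       = ((a + b) - bb\<^sup>2 * (a + b)) * sin s" unfolding e by (simp add: algebra_simps)
    thus ?thesis unfolding bb2 yy_def by simp
  qed
  have PRp: "P\<^sup>2 + R\<^sup>2 > 0" using P by (simp add: add_pos_nonneg)
  have y2: "1 + y\<^sup>2 = (P\<^sup>2 + R\<^sup>2) / P\<^sup>2" using P by (simp add: y_def power_divide field_simps)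
  have sq: "(cos (arctan y))\<^sup>2 = P\<^sup>2 / (P\<^sup>2 + R\<^sup>2)" 
    by (simp add: cos_arctan power_divide y2)
  have sn: "sin (arctan y) = y * cos (arctan y)" by (simp add: sin_arctan cos_arctan)
  have c2: "cos (2 * arctan y) = (P\<^sup>2 - R\<^sup>2) / (P\<^sup>2 + R\<^sup>2)"
  proof -
    have "y\<^sup>2 * (P\<^sup>2 / (P\<^sup>2 + R\<^sup>2)) = R\<^sup>2 / (P\<^sup>2 + R\<^sup>2)" using P by (simp add: y_def power_divide)
    thus ?thesis unfolding cos_double sn power_mult_distrib sq by (simp only: diff_divide_distrib)
  qed
  have s2: "sin (2 * arctan y) = 2 * P * R / (P\<^sup>2 + R\<^sup>2)"
  proof -
    have "sin (2 * arctan y) = 2 * y * (cos (arctan y))\<^sup>2" by (simp add: sin_double sn power2_eq_square)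
    thus ?thesis unfolding sq using P by (simp add: y_def power2_eq_square)
  qed
  have "th s = s + 2 * arctan y" by (simp add: th_def y_def P_def R_def)
  hence "cos (th s) = (cos s * (P\<^sup>2 - R\<^sup>2) - sin s * (2 * P * R)) / (P\<^sup>2 + R\<^sup>2)"
        "sin (th s) = (sin s * (P\<^sup>2 - R\<^sup>2) + cos s * (2 * P * R)) / (P\<^sup>2 + R\<^sup>2)"
    by (simp_all add: cos_add sin_add c2 s2 diff_divide_distrib add_divide_distrib right_diff_distrib)
  moreover have "rr s * (A / (P\<^sup>2 + R\<^sup>2)) = x" if "A * (a + b) = 2 * x" for A x
  proof -
    have r: "rr s = (P\<^sup>2 + R\<^sup>2) * (a + b) / 2" and x: "x = A * (a + b) / 2" using PR that by simp_all
    have "S * (a + b) / 2 * (A / S) = A * (a + b) / 2" if "S > 0" for S :: real using that by simp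
    from this[OF PRp] show ?thesis unfolding r x .
  qed
  ultimately have "rr s * cos (th s) = xx s" "rr s * sin (th s) = yy s" using X Y by presburger+
  thus ?thesis by (simp add: complex_eq_iff)
qed

lemma cos_th: "rr s * cos (th s) = xx s" and sin_th: "rr s * sin (th s) = yy s"
  using arg_cong[OF cis_th[of s], of Re] arg_cong[OF cis_th[of s], of Im] by simp_all

lemma th_periodic: "th (s + 2 * pi) = th s + 2 * pi"
  by (simp add: th_def)

lemma cis_th_periodic: "cis (th (s + 2 * pi)) = cis (th s)"
  by (simp add: th_periodic complex_eq_iff)

lemma th_deriv:
  obtains th' where "\<And>s. (th has_real_derivative th' s) (at s)" "continuous_on UNIV th'"
proof
  define y where "y = (\<lambda>s. bb * sin s / (1 - bb * cos s))"
  define y' where "y' = (\<lambda>s. (bb * cos s * (1 - bb * cos s) - bb * sin s * (bb * sin s)) / ((1 - bb * cos s) * (1 - bb * cos s)))"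
  have d: "1 - bb * cos s \<noteq> 0" for s using bb_den[of s] by simp
  have dy: "(y has_real_derivative y' s) (at s)" for s
    unfolding y_def y'_def using d[of s] by (auto intro!: derivative_eq_intros)
  have thy: "th = (\<lambda>s. s + 2 * arctan (y s))" by (simp add: th_def y_def fun_eq_iff)
  show "(th has_real_derivative 1 + 2 * (inverse (1 + (y s)\<^sup>2) * y' s)) (at s)" for s
    unfolding thy by (intro DERIV_add DERIV_ident DERIV_cmult DERIV_chain2[OF DERIV_arctan dy])
  have yc: "continuous_on UNIV y" unfolding y_def using d by (intro continuous_intros) auto
  have yc': "continuous_on UNIV y'" unfolding y'_def using d by (intro continuous_intros) auto
  show "continuous_on UNIV (\<lambda>s. 1 + 2 * (inverse (1 + (y s)\<^sup>2) * y' s))"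
    by (intro continuous_intros yc yc') (auto simp: add_nonneg_eq_0_iff)
qed

lemma th_continuous: "continuous_on UNIV th"
  using th_deriv DERIV_continuous_on by metis

text \<open>\<open>th s - s\<close> is periodic and vanishes at 0, so \<open>th\<close> fixes all
  multiples of 2 pi and the intermediate value theorem applies between them. Every direction is thus
  the direction of a boundary point seen from the focus.\<close>

lemma th_surj: obtains s where "th s = y"
proof -
  have n: "th (2 * pi * of_int n) = 2 * pi * of_int n" for n :: int
  proof -
    have "(\<lambda>s. th s - s) (0 + 2 * pi * of_int n) = (\<lambda>s. th s - s) 0"
      by (rule periodic_2pi_int) (simp add: th_periodic)
    thus ?thesis by (simp add: th_def)
  qed
  define m where "m = \<lceil>\<bar>y\<bar> / (2 * pi)\<rceil>"
  have m: "\<bar>y\<bar> \<le> 2 * pi * of_int m"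
  proof -
    have "\<bar>y\<bar> / (2 * pi) \<le> of_int m" by (simp add: m_def)
    thus ?thesis by (simp add: divide_le_eq mult.commute)
  qed
  have "\<exists>x\<ge>2 * pi * of_int (- m). x \<le> 2 * pi * of_int m \<and> th x = y"
  proof (rule IVT')
    show "th (2 * pi * of_int (- m)) \<le> y" "y \<le> th (2 * pi * of_int m)"
      unfolding n using m by auto
    show "2 * pi * real_of_int (- m) \<le> 2 * pi * real_of_int m" using m by simp
    show "continuous_on {2 * pi * real_of_int (- m)..2 * pi * real_of_int m} th"
      using th_continuous by (rule continuous_on_subset) auto
  qed
  thus thesis using that by blast
qed

lemma rr_deriv: "(rr has_real_derivative f * sin s) (at s)"
  unfolding rr_def by (auto intro!: derivative_eq_intros)

lemma rr_continuous [continuous_intros]: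
  fixes g :: "'x::t2_space \<Rightarrow> real"
  shows "continuous_on S g \<Longrightarrow> continuous_on S (\<lambda>x. rr (g x))"
  unfolding rr_def by (intro continuous_intros)

lemma xx_continuous [continuous_intros]:
  fixes g :: "'x::t2_space \<Rightarrow> real"
  shows "continuous_on S g \<Longrightarrow> continuous_on S (\<lambda>x. xx (g x))"
  unfolding xx_def by (intro continuous_intros)

lemma yy_continuous [continuous_intros]:
  fixes g :: "'x::t2_space \<Rightarrow> real"
  shows "continuous_on S g \<Longrightarrow> continuous_on S (\<lambda>x. yy (g x))"
  unfolding yy_def by (intro continuous_intros)

lemma C1_periodic_inv_sqrt_rr: "C1_periodic (\<lambda>s. complex_of_real (1 / sqrt (rr s)))"
proof (rule C1_periodic_of_real)
  show "((\<lambda>s. 1 / sqrt (rr s)) has_real_derivative - (f * sin s / (2 * sqrt (rr s))) / rr s) (at s)" for s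
    using rr_pos[of s] by (auto intro!: derivative_eq_intros rr_deriv simp: field_simps)
  show "continuous_on UNIV (\<lambda>s. - (f * sin s / (2 * sqrt (rr s))) / rr s)"
    using rr_pos by (intro continuous_intros) (auto simp: less_imp_neq[symmetric])
qed (simp add: rr_def)

text \<open>Polar data of the phases in the eccentric angle: the non-constant part of +r or -r plus
  the test phase is Re(conj(z) e^(i s)) with z = \<open>z1\<close> or \<open>z2\<close>. As \<alpha>
  varies, they trace ellipses with semi-axes a sqrt q, b sqrt q and centres (-f, 0) and (f,
  0).\<close>

definition z1 :: "real \<Rightarrow> complex" where
  "z1 \<alpha> = Complex (a * sqrt q * cos \<alpha> - f) (b * sqrt q * sin \<alpha>)"
definition z2 :: "real \<Rightarrow> complex" where
  "z2 \<alpha> = Complex (a * sqrt q * cos \<alpha> + f) (b * sqrt q * sin \<alpha>)"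

lemma f_less_aq: "f < a * sqrt q"
proof (rule power2_less_imp_less)
  show "f\<^sup>2 < (a * sqrt q)\<^sup>2" using f_less q_pos by (simp add: power_mult_distrib mult.commute)
qed (use a_pos q_pos in simp)

text \<open>The imaginary part vanishes only where cos \<alpha> is 1 or -1; there the real part has
  the terms a sqrt q and f up to sign, and these cannot cancel since f < a sqrt q.\<close>

lemma z1_nz: "z1 \<alpha> \<noteq> 0" and z2_nz: "z2 \<alpha> \<noteq> 0"
proof -
  have 1: "\<bar>a * sqrt q * cos \<alpha>\<bar> = a * sqrt q" if "sin \<alpha> = 0"
  proof -
    have "cos \<alpha> = 1 \<or> cos \<alpha> = -1" using that sin_zero_abs_cos_one by fastforce
    thus ?thesis using a_pos q_pos by auto
  qed
  have "b * sqrt q \<noteq> 0" using b_pos q_pos by simp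
  thus "z1 \<alpha> \<noteq> 0" "z2 \<alpha> \<noteq> 0" using 1 f_less_aq f_pos by (auto simp: z1_def z2_def complex_eq_iff)
qed

lemma phase_plus:
  "rr s + sqrt q * (cos \<alpha> * xx s + sin \<alpha> * yy s)
     = (a - f * sqrt q * cos \<alpha>) + cmod (z1 \<alpha>) * cos (s - Arg (z1 \<alpha>))"
proof -
  have "cmod (z1 \<alpha>) * cos (Arg (z1 \<alpha>)) = Re (z1 \<alpha>)" "cmod (z1 \<alpha>) * sin (Arg (z1 \<alpha>)) = Im (z1 \<alpha>)"
    using rcis_cmod_Arg[of "z1 \<alpha>"] by (metis Re_rcis, metis Im_rcis)
  hence "cmod (z1 \<alpha>) * cos (s - Arg (z1 \<alpha>)) = cos s * Re (z1 \<alpha>) + sin s * Im (z1 \<alpha>)"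
    by (simp add: cos_diff algebra_simps)
  thus ?thesis by (simp add: z1_def rr_def xx_def yy_def algebra_simps)
qed

lemma phase_minus:
  "- rr s + sqrt q * (cos \<alpha> * xx s + sin \<alpha> * yy s)
     = (- a - f * sqrt q * cos \<alpha>) + cmod (z2 \<alpha>) * cos (s - Arg (z2 \<alpha>))"
proof -
  have "cmod (z2 \<alpha>) * cos (Arg (z2 \<alpha>)) = Re (z2 \<alpha>)" "cmod (z2 \<alpha>) * sin (Arg (z2 \<alpha>)) = Im (z2 \<alpha>)"
    using rcis_cmod_Arg[of "z2 \<alpha>"] by (metis Re_rcis, metis Im_rcis)
  hence "cmod (z2 \<alpha>) * cos (s - Arg (z2 \<alpha>)) = cos s * Re (z2 \<alpha>) + sin s * Im (z2 \<alpha>)"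
    by (simp add: cos_diff algebra_simps)
  thus ?thesis by (simp add: z2_def rr_def xx_def yy_def algebra_simps)
qed

section \<open>Expansion of the Herglotz wave on the boundary\<close>

definition V :: "(real \<Rightarrow> complex) \<Rightarrow> real \<Rightarrow> real \<Rightarrow> complex" where
  "V G k s = integral {-pi..pi} (\<lambda>\<theta>. G \<theta> * cis (k * (cos \<theta> * xx s + sin \<theta> * yy s)))"

definition V_lead :: "(real \<Rightarrow> complex) \<Rightarrow> real \<Rightarrow> real \<Rightarrow> complex" where
  "V_lead G k s = of_real (sqrt (8 / rr s)) *
     (Fres_lim * cis (k * rr s) * G (th s) + cnj Fres_lim * cis (- (k * rr s)) * G (th s + pi))"

lemma V_asymp:
  assumes "C1_periodic G"
  obtains C k0 where "C > 0" "k0 \<ge> 1"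
    "\<And>k s. k \<ge> k0 \<Longrightarrow> norm (of_real (sqrt k) * V G k s - V_lead G k s) \<le> C * (1 + ln k) / sqrt k"
proof -
  have "a - f > 0" using f_less_a by simp
  from stationary_phase_scaled[OF assms this, of "a + f"] obtain C k0 where C: "C > 0" "k0 \<ge> 1"
    "\<And>k N \<sigma>. k \<ge> k0 \<Longrightarrow> a - f \<le> N \<Longrightarrow> N \<le> a + f \<Longrightarrow>
        norm (of_real (sqrt k) * integral {-pi..pi} (\<lambda>s. G s * cis (k * N * cos (s - \<sigma>)))
           - of_real (sqrt (8/N)) * (Fres_lim * cis (k * N) * G \<sigma> + cnj Fres_lim * cis (- (k * N)) * G (\<sigma> + pi)))
         \<le> C * (1 + ln k) / sqrt k" by blast
  have eq: "V G k s = integral {-pi..pi} (\<lambda>\<theta>. G \<theta> * cis (k * rr s * cos (\<theta> - th s)))" for k s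
  proof -
    have "k * (cos \<theta> * xx s + sin \<theta> * yy s) = k * rr s * cos (\<theta> - th s)" for \<theta>
      by (simp add: cos_diff algebra_simps flip: cos_th sin_th)
    thus ?thesis by (simp only: V_def)
  qed
  show thesis
    by (rule that[OF C(1,2)]) (unfold eq V_lead_def, rule C(3)[OF _ rr_ge rr_le])
qed

lemma V_continuous:
  assumes "C1_periodic G"
  shows "continuous_on {-pi..pi} (V G k)"
  unfolding V_def
proof (rule continuous_on_integral_rect)
  have "continuous_on ({- pi..pi} \<times> {- pi..pi}) (\<lambda>z::real \<times> real. G (fst z))"
    by (rule continuous_on_compose2[OF C1_periodic_continuous[OF assms]]) (auto intro!: continuous_intros)
  thus "continuous_on ({- pi..pi} \<times> {- pi..pi}) (\<lambda>(\<theta>, s). G \<theta> * cis (k * (cos \<theta> * xx s + sin \<theta> * yy s)))"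
    by (auto simp: case_prod_beta intro!: continuous_intros)
qed

lemma V_lead_continuous:
  assumes "C1_periodic G"
  shows "continuous_on A (V_lead G k)"
proof -
  have cG: "continuous_on A (\<lambda>s. G (g s))" if "continuous_on A g" for g
    by (rule continuous_on_compose2[OF C1_periodic_continuous[OF assms] that]) auto
  have "continuous_on A th" using th_continuous continuous_on_subset by blast
  thus ?thesis unfolding V_lead_def using rr_pos
    by (intro continuous_intros cG) (auto simp: less_imp_neq[symmetric])
qed

section \<open>The gain from averaging over the direction of the test wave\<close>

definition ph :: "real \<Rightarrow> real \<Rightarrow> real" where
  "ph \<alpha> s = sqrt q * (cos \<alpha> * xx s + sin \<alpha> * yy s)"

lemma ph_continuous [continuous_intros]:
  fixes g h :: "'x::t2_space \<Rightarrow> real"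
  shows "continuous_on S g \<Longrightarrow> continuous_on S h \<Longrightarrow> continuous_on S (\<lambda>x. ph (g x) (h x))"
  unfolding ph_def by (intro continuous_intros)

lemma swap_osc:
  assumes g: "continuous_on {u..v} g" and Y: "continuous_on {-pi..pi} Y"
  shows "integral {u..v} (\<lambda>\<alpha>. g \<alpha> * integral {-pi..pi} (\<lambda>s. Y s * cis (k * ph \<alpha> s)))
       = integral {-pi..pi} (\<lambda>s. Y s * integral {u..v} (\<lambda>\<alpha>. g \<alpha> * cis (k * ph \<alpha> s)))"
proof -
  have eq: "g \<alpha> * (Y s * cis (k * ph \<alpha> s)) = Y s * (g \<alpha> * cis (k * ph \<alpha> s))" for \<alpha> s by (simp only: mult_ac)
  have "integral {u..v} (\<lambda>\<alpha>. g \<alpha> * integral {-pi..pi} (\<lambda>s. Y s * cis (k * ph \<alpha> s)))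
      = integral {u..v} (\<lambda>\<alpha>. integral {-pi..pi} (\<lambda>s. g \<alpha> * (Y s * cis (k * ph \<alpha> s))))"
    by (simp only: integral_mult_right)
  also have "\<dots> = integral {-pi..pi} (\<lambda>s. integral {u..v} (\<lambda>\<alpha>. g \<alpha> * (Y s * cis (k * ph \<alpha> s))))"
  proof (rule integral_swap_rect)
    have "continuous_on ({u..v} \<times> {-pi..pi}) (\<lambda>z. g (fst z))" "continuous_on ({u..v} \<times> {-pi..pi}) (\<lambda>z. Y (snd z))"
      by (rule continuous_on_compose2[OF g], auto intro!: continuous_intros,
          rule continuous_on_compose2[OF Y], auto intro!: continuous_intros)
    thus "continuous_on ({u..v} \<times> {-pi..pi}) (\<lambda>(\<alpha>, s). g \<alpha> * (Y s * cis (k * ph \<alpha> s)))"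
      by (auto simp: case_prod_beta intro!: continuous_intros)
  qed
  finally show ?thesis by (simp only: eq integral_mult_right)
qed

text \<open>A difference of two test phases is again a constant plus |z| cos(s - arg z), where |z|
  dominates the chord between the two directions and hence a multiple of |x - y|. The integral then
  decays like that of a Bessel function, (k |z|)^(-1/2).\<close>

lemma osc_kernel_bound:
  obtains C c where "C > 0" "c > 0"
    "\<And>k x y. k > 0 \<Longrightarrow> \<bar>x - y\<bar> \<le> 1 \<Longrightarrow>
       norm (integral {-pi..pi} (\<lambda>s. cis (k * (ph x s - ph y s)))) \<le> C / sqrt (1 + k * c * \<bar>x - y\<bar>)"
proof -
  have "C1_periodic (\<lambda>_. of_real 1)" by (rule C1_periodic_of_real[where g' = "\<lambda>_. 0"]) auto
  from stationary_phase_C1_periodic[OF this] obtain C0 where C0: "C0 > 0"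
    "\<And>l \<sigma>. l \<ge> 1 \<Longrightarrow> norm (integral {-pi..pi} (\<lambda>s. cis (l * cos (s - \<sigma>)))
           - of_real (sqrt (8/l)) * (Fres_lim * cis l + cnj Fres_lim * cis (-l)))
         \<le> C0 * (1 + ln l) / l" by auto
  \<comment> \<open>For l >= 1 the leading term uses sqrt 8 <= 4 and the error uses 1 + ln l <= 2
    sqrt l; for l < 1 the trivial bound 2 pi serves. The outer 2 pays for the passage from sqrt l to
    sqrt(1 + l).\<close>
  define C where "C = 2 * (8 * norm Fres_lim + 2 * C0 + 2 * pi)"
  have C: "C > 0" using C0 pi_gt_zero norm_ge_zero[of Fres_lim] unfolding C_def
    by (intro mult_pos_pos add_nonneg_pos) auto
  have J: "norm (integral {-pi..pi} (\<lambda>s. cis (l * cos (s - \<sigma>)))) \<le> C / sqrt (1 + l)" if "l \<ge> 0" for l \<sigma>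
  proof (cases "l \<ge> 1")
    case True
    have ln: "1 + ln l \<le> 2 * sqrt l"
      using ln_le_minus_one[of "sqrt l"] True by (simp add: ln_sqrt)
    let ?I = "integral {-pi..pi} (\<lambda>s. cis (l * cos (s - \<sigma>)))"
    let ?L = "of_real (sqrt (8/l)) * (Fres_lim * cis l + cnj Fres_lim * cis (-l))"
    have "norm ?L \<le> (4 / sqrt l) * (norm Fres_lim + norm Fres_lim)"
      unfolding norm_mult
    proof (intro mult_mono)
      have "sqrt 8 \<le> 4" by (rule real_le_lsqrt) auto
      thus "norm (complex_of_real (sqrt (8/l))) \<le> 4 / sqrt l" using True unfolding norm_of_real
        by (simp add: real_sqrt_divide divide_right_mono)
      show "norm (Fres_lim * cis l + cnj Fres_lim * cis (-l)) \<le> norm Fres_lim + norm Fres_lim"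
        by (rule order.trans[OF norm_triangle_ineq]) (simp add: norm_mult)
    qed (use True in auto)
    moreover have "norm (?I - ?L) \<le> 2 * C0 / sqrt l"
    proof -
      have "C0 * (1 + ln l) / l \<le> C0 * (2 * sqrt l) / l" using ln C0 True by (intro divide_right_mono mult_left_mono) auto
      also have "\<dots> = 2 * C0 / sqrt l" using True by (simp add: real_div_sqrt field_simps)
      finally show ?thesis using C0(2)[OF True] by (rule order.trans[rotated])
    qed
    ultimately have "norm ?I \<le> 2 * C0 / sqrt l + (4 / sqrt l) * (norm Fres_lim + norm Fres_lim)"
      using norm_triangle_ineq[of "?I - ?L" ?L] by simp
    also have "\<dots> = (8 * norm Fres_lim + 2 * C0) / sqrt l" using True by (simp add: field_simps)
    also have "\<dots> \<le> (8 * norm Fres_lim + 2 * C0) / (sqrt (1 + l) / 2)"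
    proof (rule divide_left_mono)
      show "sqrt (1 + l) / 2 \<le> sqrt l"
        using real_sqrt_le_mono[of "1 + l" "4 * l"] True by (simp add: real_sqrt_mult)
    qed (use True C0 in auto)
    also have "\<dots> = (2 * (8 * norm Fres_lim + 2 * C0)) / sqrt (1 + l)" by simp
    also have "\<dots> \<le> C / sqrt (1 + l)" using True pi_gt_zero by (intro divide_right_mono) (auto simp: C_def)
    finally show ?thesis .
  next
    case False
    have "norm (integral {-pi..pi} (\<lambda>s. cis (l * cos (s - \<sigma>)))) \<le> 1 * (pi - - pi)"
      by (rule integral_bound) (auto intro!: continuous_intros)
    also have "\<dots> \<le> C / 2" using C0 norm_ge_zero[of Fres_lim] by (simp add: C_def)
    also have "\<dots> \<le> C / sqrt (1 + l)"
    proof (rule divide_left_mono)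
      show "sqrt (1 + l) \<le> 2" by (rule real_le_lsqrt) (use False that in auto)
    qed (use C that in auto)
    finally show ?thesis .
  qed
  \<comment> \<open>The chord is 2 sin(|x - y|/2), at least |x - y|/3 by
    \<open>sin_ge_linear\<close>, and it is stretched at least by sqrt q times the smaller
    semi-axis.\<close>
  define c where "c = sqrt q * b / 3"
  have c: "c > 0" using q_pos b_pos by (simp add: c_def)
  show thesis
  proof (rule that[OF C c])
    fix k x y :: real assume k: "k > 0" and xy: "\<bar>x - y\<bar> \<le> 1"
    define p1 where "p1 = sqrt q * (cos x - cos y)"
    define p2 where "p2 = sqrt q * (sin x - sin y)"
    define z where "z = Complex (a * p1) (b * p2)"
    have "cmod z * cos (Arg z) = Re z" "cmod z * sin (Arg z) = Im z"
      using rcis_cmod_Arg[of z] by (metis Re_rcis, metis Im_rcis)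
    hence zc: "cmod z * cos (s - Arg z) = cos s * (a * p1) + sin s * (b * p2)" for s
      by (simp add: cos_diff z_def algebra_simps)
    have ph: "ph x s - ph y s = - (f * p1) + cmod z * cos (s - Arg z)" for s
      unfolding zc by (simp add: ph_def p1_def p2_def xx_def yy_def algebra_simps)
    have "(\<lambda>s. cis (k * (ph x s - ph y s))) = (\<lambda>s. cis (- (k * f * p1)) * cis (k * cmod z * cos (s - Arg z)))"
      by (simp add: ph cis_mult algebra_simps)
    hence "norm (integral {-pi..pi} (\<lambda>s. cis (k * (ph x s - ph y s))))
        = norm (integral {-pi..pi} (\<lambda>s. cis (k * cmod z * cos (s - Arg z))))"
      by (simp add: norm_mult)
    also have "\<dots> \<le> C / sqrt (1 + k * cmod z)" using k by (intro J) auto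
    also have "\<dots> \<le> C / sqrt (1 + k * c * \<bar>x - y\<bar>)"
    proof (intro divide_left_mono real_sqrt_le_mono add_left_mono)
      have "(cos x - cos y)\<^sup>2 + (sin x - sin y)\<^sup>2 = (2 * sin (\<bar>x - y\<bar> / 2))\<^sup>2"
      proof -
        have "(cos x - cos y)\<^sup>2 + (sin x - sin y)\<^sup>2 = ((cos x)\<^sup>2 + (sin x)\<^sup>2) + ((cos y)\<^sup>2 + (sin y)\<^sup>2) - 2 * (cos x * cos y + sin x * sin y)"
          by (simp add: power2_eq_square algebra_simps)
        also have "\<dots> = 2 - 2 * cos (x - y)" by (simp add: cos_diff)
        also have "cos (x - y) = cos (2 * (\<bar>x - y\<bar> / 2))" by simp
        finally show ?thesis unfolding cos_double_sin by (simp add: power_mult_distrib)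
      qed
      moreover have "(sqrt q * b)\<^sup>2 * ((cos x - cos y)\<^sup>2 + (sin x - sin y)\<^sup>2) \<le> (cmod z)\<^sup>2"
      proof -
        have "b\<^sup>2 * p1\<^sup>2 \<le> a\<^sup>2 * p1\<^sup>2" using abf by (intro mult_right_mono) auto
        hence "b\<^sup>2 * (p1\<^sup>2 + p2\<^sup>2) \<le> (cmod z)\<^sup>2" by (simp add: z_def cmod_power2 power_mult_distrib algebra_simps)
        moreover have "(sqrt q * b)\<^sup>2 * ((cos x - cos y)\<^sup>2 + (sin x - sin y)\<^sup>2) = b\<^sup>2 * (p1\<^sup>2 + p2\<^sup>2)"
          by (simp only: p1_def p2_def power_mult_distrib distrib_left mult_ac)
        ultimately show ?thesis by simp
      qed
      ultimately have "(sqrt q * b * (2 * sin (\<bar>x - y\<bar> / 2)))\<^sup>2 \<le> (cmod z)\<^sup>2"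
        by (simp only: power_mult_distrib)
      hence "sqrt q * b * (2 * sin (\<bar>x - y\<bar> / 2)) \<le> cmod z" by (rule power2_le_imp_le) simp
      moreover have "sqrt q * b * (\<bar>x - y\<bar> / 3) \<le> sqrt q * b * (2 * sin (\<bar>x - y\<bar> / 2))"
        using sin_ge_linear[of "\<bar>x - y\<bar> / 2"] xy pi_gt3 q_pos b_pos by (intro mult_left_mono) auto
      ultimately have "c * \<bar>x - y\<bar> \<le> cmod z" by (simp add: c_def)
      hence "k * (c * \<bar>x - y\<bar>) \<le> k * cmod z" using k by (intro mult_left_mono) auto
      thus "k * c * \<bar>x - y\<bar> \<le> k * cmod z" by (simp only: mult.assoc)
    qed (use C c k in \<open>auto intro!: mult_pos_pos add_pos_nonneg\<close>)
    finally show "norm (integral {-pi..pi} (\<lambda>s. cis (k * (ph x s - ph y s)))) \<le> C / sqrt (1 + k * c * \<bar>x - y\<bar>)" .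
  qed
qed

text \<open>The phase \<open>\<Psi>\<close> depends on \<alpha> alone, so in the kernel it leaves
  the s-integral as a factor of modulus one. \<open>kernel_L2_bound\<close> gives O(k^(-1/2)) for
  the square integral. The inequality 2 t |W| <= t^2 |W|^2 + 1 with t = k^(1/4) balances its two
  terms and yields the L^1 bound.\<close>

lemma W_bound:
  assumes uv: "u \<le> v" "v - u \<le> 1" and chi: "continuous_on {u..v} g" and Psi: "continuous_on {u..v} \<Psi>"
  obtains C where "C > 0"
    "\<And>k. k \<ge> 1 \<Longrightarrow> integral {-pi..pi} (\<lambda>s. norm (integral {u..v} (\<lambda>\<alpha>. g \<alpha> * cis (- (k * \<Psi> \<alpha>)) * cis (k * ph \<alpha> s))))
        \<le> C / k powr (1/4)"
proof -
  obtain C c where C: "C > 0" "c > 0"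
    "\<And>k x y. k > 0 \<Longrightarrow> \<bar>x - y\<bar> \<le> 1 \<Longrightarrow>
       norm (integral {-pi..pi} (\<lambda>s. cis (k * (ph x s - ph y s)))) \<le> C / sqrt (1 + k * c * \<bar>x - y\<bar>)"
    using osc_kernel_bound by blast
  have "bounded (g ` {u..v})" by (intro compact_imp_bounded compact_continuous_image chi) auto
  then obtain B where B: "B > 0" "\<And>x. x \<in> {u..v} \<Longrightarrow> norm (g x) \<le> B"
    unfolding bounded_pos by blast
  define D where "D = B * B * C * (4 * sqrt (1 + c) / c)"
  have D: "D > 0" using B C by (simp add: D_def)
  show thesis
  proof (rule that[of "(D + 2 * pi) / 2"])
    fix k :: real assume k: "k \<ge> 1"
    define w where "w = (\<lambda>\<alpha> s. g \<alpha> * cis (- (k * \<Psi> \<alpha>)) * cis (k * ph \<alpha> s))"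
    define W where "W = (\<lambda>s. integral {u..v} (\<lambda>\<alpha>. w \<alpha> s))"
    define t where "t = k powr (1/4)"
    have t: "t > 0" using k by (simp add: t_def)
    have t2: "t * t = sqrt k" using k by (simp add: t_def powr_half_sqrt flip: powr_add)
    have cont: "continuous_on ({u..v} \<times> {-pi..pi}) (\<lambda>(x,s). w x s)"
    proof -
      have "continuous_on ({u..v} \<times> {-pi..pi}) (\<lambda>z. g (fst z))" "continuous_on ({u..v} \<times> {-pi..pi}) (\<lambda>z. \<Psi> (fst z))"
        by (rule continuous_on_compose2[OF chi], auto intro!: continuous_intros,
            rule continuous_on_compose2[OF Psi], auto intro!: continuous_intros)
      thus ?thesis unfolding w_def by (auto simp: case_prod_beta intro!: continuous_intros)
    qed
    have contW: "continuous_on {-pi..pi} W" unfolding W_def by (rule continuous_on_integral_rect[OF cont])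
    have L2: "integral {-pi..pi} (\<lambda>s. (norm (W s))\<^sup>2) \<le> B * B * C * (4 * sqrt (1 + k * c * (v - u)) / (k * c)) * (v - u)"
      unfolding W_def
    proof (rule kernel_L2_bound[OF uv(1) cont])
      fix x y assume xy: "x \<in> {u..v}" "y \<in> {u..v}"
      have "w x s * cnj (w y s) = (g x * cnj (g y) * cis (- (k * \<Psi> x)) * cis (k * \<Psi> y)) * cis (k * (ph x s - ph y s))" for s
      proof -
        have "w x s * cnj (w y s) = (g x * cnj (g y)) * ((cis (- (k * \<Psi> x)) * cis (k * ph x s)) * (cis (k * \<Psi> y) * cis (- (k * ph y s))))"
          by (simp only: w_def complex_cnj_mult cis_cnj minus_minus mult_ac)
        also have "(cis (- (k * \<Psi> x)) * cis (k * ph x s)) * (cis (k * \<Psi> y) * cis (- (k * ph y s)))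
           = cis (- (k * \<Psi> x)) * cis (k * \<Psi> y) * cis (k * (ph x s - ph y s))"
          by (simp add: cis_mult algebra_simps)
        finally show ?thesis by (simp only: mult.assoc)
      qed
      hence "norm (integral {-pi..pi} (\<lambda>s. w x s * cnj (w y s)))
         = norm (g x) * norm (g y) * norm (integral {-pi..pi} (\<lambda>s. cis (k * (ph x s - ph y s))))"
        by (simp add: norm_mult)
      also have "\<dots> \<le> B * B * (C / sqrt (1 + k * c * \<bar>x - y\<bar>))"
        using B xy k uv C(1) by (intro mult_mono C(3)) auto
      finally show "norm (integral {-pi..pi} (\<lambda>s. w x s * cnj (w y s))) \<le> B * B * C / sqrt (1 + k * c * \<bar>x - y\<bar>)" by simp
    qed (use B C k in auto)
    also have "\<dots> \<le> B * B * C * (4 * (sqrt k * sqrt (1 + c)) / (k * c)) * 1"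
    proof (intro mult_mono divide_right_mono)
      have "k * c * (v - u) \<le> k * c * 1" using k C uv by (intro mult_left_mono) auto
      hence "1 + k * c * (v - u) \<le> k * (1 + c)" using k by (simp add: algebra_simps)
      thus "sqrt (1 + k * c * (v - u)) \<le> sqrt k * sqrt (1 + c)" by (simp flip: real_sqrt_mult)
    qed (use uv B C k in auto)
    also have "\<dots> = D / sqrt k"
    proof -
      have "sqrt k / k = 1 / sqrt k" using k by (simp add: real_div_sqrt field_simps)
      moreover have "B * B * C * (4 * (sqrt k * sqrt (1 + c)) / (k * c)) * 1 = D * (sqrt k / k)"
        by (simp add: D_def mult_ac)
      ultimately show ?thesis by simp
    qed
    finally have L2': "integral {-pi..pi} (\<lambda>s. (norm (W s))\<^sup>2) \<le> D / (t * t)" by (simp add: t2)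
    have int2: "(\<lambda>s. (norm (W s))\<^sup>2) integrable_on {-pi..pi}"
      by (intro integrable_continuous_real continuous_intros contW)
    have "integral {-pi..pi} (\<lambda>s. norm (W s)) \<le> integral {-pi..pi} (\<lambda>s. t / 2 * (norm (W s))\<^sup>2 + 1 / (2 * t))"
    proof (rule integral_le)
      fix s
      have "0 \<le> (t * norm (W s) - 1)\<^sup>2" by simp
      hence "2 * t * norm (W s) \<le> t * t * (norm (W s))\<^sup>2 + 1" by (simp add: power2_eq_square algebra_simps)
      thus "norm (W s) \<le> t / 2 * (norm (W s))\<^sup>2 + 1 / (2 * t)" using t by (simp add: field_simps)
    qed (intro integrable_continuous_real continuous_intros contW | use t in simp)+
    also have "\<dots> = t / 2 * integral {-pi..pi} (\<lambda>s. (norm (W s))\<^sup>2) + 2 * pi * (1 / (2 * t))"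
      using integral_unique[OF has_integral_add[OF has_integral_mult_right[OF integrable_integral[OF int2], of "t / 2"]
        has_integral_const_real[of "1 / (2 * t)" "-pi" pi]]] by simp
    also have "\<dots> \<le> t / 2 * (D / (t * t)) + 2 * pi * (1 / (2 * t))"
      using t L2' by (intro add_right_mono mult_left_mono) auto
    also have "\<dots> = (D + 2 * pi) / 2 / t" using t by (simp add: field_simps)
    finally show "integral {-pi..pi} (\<lambda>s. norm (integral {u..v} (\<lambda>\<alpha>. g \<alpha> * cis (- (k * \<Psi> \<alpha>)) * cis (k * ph \<alpha> s))))
        \<le> (D + 2 * pi) / 2 / k powr (1/4)" by (simp add: W_def w_def t_def)
  qed (use D in \<open>simp add: add_pos_pos\<close>)
qed

section \<open>The second stationary phase expansion, in the eccentric angle\<close>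

lemma z_periodic: "z1 (s + 2 * pi) = z1 s" "z2 (s + 2 * pi) = z2 s"
  by (simp_all add: z1_def z2_def)

lemma z_continuous: "continuous_on S z1" "continuous_on S z2"
  unfolding z1_def z2_def complex_eq_iff Complex_eq by (intro continuous_intros)+

lemma z_bounds:
  obtains m M where "m > 0" "\<forall>\<alpha>. m \<le> cmod (z1 \<alpha>) \<and> cmod (z1 \<alpha>) \<le> M \<and> m \<le> cmod (z2 \<alpha>) \<and> cmod (z2 \<alpha>) \<le> M"
proof -
  obtain M1 where M1: "\<And>s. norm (z1 s) \<le> M1" using periodic_bounded[of z1] z_continuous z_periodic by metis
  obtain M2 where M2: "\<And>s. norm (z2 s) \<le> M2" using periodic_bounded[of z2] z_continuous z_periodic by metis
  have ci: "continuous_on UNIV (\<lambda>s. inverse (z1 s))" "continuous_on UNIV (\<lambda>s. inverse (z2 s))"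
    using z1_nz z2_nz by (intro continuous_intros z_continuous; simp)+
  obtain L1 where L1: "L1 > 0" "\<And>s. norm (inverse (z1 s)) \<le> L1"
    using periodic_bounded[OF ci(1)] z_periodic by (metis (no_types, lifting))
  obtain L2 where L2: "L2 > 0" "\<And>s. norm (inverse (z2 s)) \<le> L2"
    using periodic_bounded[OF ci(2)] z_periodic by (metis (no_types, lifting))
  have lower: "1 / max L1 L2 \<le> cmod z" if "norm (inverse z) \<le> L" "L \<le> max L1 L2" "z \<noteq> 0" for z :: complex and L
  proof -
    have "1 / cmod z \<le> max L1 L2" using order.trans[OF that(1,2)] by (simp add: norm_divide inverse_eq_divide)
    thus ?thesis using that L1 by (simp add: field_simps less_max_iff_disj)
  qed
  show thesis
    by (rule that[of "1 / max L1 L2" "max M1 M2"])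
       (use L1 M1 M2 lower[OF L1(2) _ z1_nz] lower[OF L2(2) _ z2_nz] in \<open>auto intro: max.coboundedI1 max.coboundedI2 simp: less_max_iff_disj\<close>)
qed

text \<open>The amplitude left on the boundary by the first expansion. The offset \<open>c\<close>
  is 0 for the part with phase +r, where the density is evaluated in the direction of the boundary
  point, and pi for the part with phase -r, where it is evaluated in the opposite direction.\<close>

definition amp :: "(real \<Rightarrow> complex) \<Rightarrow> (real \<Rightarrow> complex) \<Rightarrow> real \<Rightarrow> real \<Rightarrow> complex" where
  "amp n G c s = n s * of_real (1 / sqrt (rr s)) * G (th s + c)"

lemma amp_C1_periodic:
  assumes "C1_periodic n" "C1_periodic G"
  shows "C1_periodic (amp n G c)"
  unfolding amp_def
proof (intro C1_periodic_mult assms C1_periodic_inv_sqrt_rr)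
  obtain th' where th': "\<And>s. (th has_real_derivative th' s) (at s)" "continuous_on UNIV th'" using th_deriv by blast
  show "C1_periodic (\<lambda>s. G (th s + c))"
  proof (rule C1_periodic_lift[OF assms(2) _ th'(2)])
    show "((\<lambda>s. th s + c) has_real_derivative th' s) (at s)" for s
      using th'(1) by (auto intro!: derivative_eq_intros)
    show "cis (th (s + 2 * pi) + c) = cis (th s + c)" for s by (simp add: cis_th_periodic flip: cis_mult)
  qed
qed

definition D1 :: "real \<Rightarrow> real" where "D1 \<alpha> = a - f * sqrt q * cos \<alpha>"
definition D2 :: "real \<Rightarrow> real" where "D2 \<alpha> = - a - f * sqrt q * cos \<alpha>"

text \<open>Two signs of r in the first expansion times two stationary points in the second. Both
  factors sqrt k have been taken out, so that the terms are bounded in k.\<close>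

definition T_lead :: "(real \<Rightarrow> complex) \<Rightarrow> (real \<Rightarrow> complex) \<Rightarrow> real \<Rightarrow> real \<Rightarrow> complex" where
  "T_lead n G k \<alpha> =
     of_real (sqrt 8) * Fres_lim * cis (k * D1 \<alpha>) * (of_real (sqrt (8 / cmod (z1 \<alpha>))) *
       (Fres_lim * cis (k * cmod (z1 \<alpha>)) * amp n G 0 (Arg (z1 \<alpha>))
        + cnj Fres_lim * cis (- (k * cmod (z1 \<alpha>))) * amp n G 0 (Arg (z1 \<alpha>) + pi)))
   + of_real (sqrt 8) * cnj Fres_lim * cis (k * D2 \<alpha>) * (of_real (sqrt (8 / cmod (z2 \<alpha>))) *
       (Fres_lim * cis (k * cmod (z2 \<alpha>)) * amp n G pi (Arg (z2 \<alpha>))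
        + cnj Fres_lim * cis (- (k * cmod (z2 \<alpha>))) * amp n G pi (Arg (z2 \<alpha>) + pi)))"

text \<open>For each sign of r, the boundary phase times the test wave is a factor independent of s
  times one oscillating cosine, by \<open>phase_plus\<close> and \<open>phase_minus\<close>. The
  moduli of \<open>z1\<close> and \<open>z2\<close> stay in a compact part of the positive axis, so
  the error is uniform in \<alpha>.\<close>

lemma lead_asymp:
  assumes n: "C1_periodic n" and G: "C1_periodic G"
  obtains C k0 where "C > 0" "k0 \<ge> 1"
    "\<And>k \<alpha>. k \<ge> k0 \<Longrightarrow> norm (of_real (sqrt k) * integral {-pi..pi} (\<lambda>s. n s * V_lead G k s * cis (k * ph \<alpha> s)) - T_lead n G k \<alpha>)
        \<le> C * (1 + ln k) / sqrt k"
proof -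
  obtain m M where "m > 0" "\<forall>\<alpha>. m \<le> cmod (z1 \<alpha>) \<and> cmod (z1 \<alpha>) \<le> M \<and> m \<le> cmod (z2 \<alpha>) \<and> cmod (z2 \<alpha>) \<le> M"
    by (rule z_bounds)
  hence m: "m > 0" "m \<le> cmod (z1 \<alpha>)" "cmod (z1 \<alpha>) \<le> M" "m \<le> cmod (z2 \<alpha>)" "cmod (z2 \<alpha>) \<le> M" for \<alpha>
    by auto
  note A1 = amp_C1_periodic[OF n G, of 0] and A2 = amp_C1_periodic[OF n G, of pi]
  let ?J = "\<lambda>A k z. integral {-pi..pi} (\<lambda>s. A s * cis (k * cmod z * cos (s - Arg z)))"
  let ?L = "\<lambda>A k z. of_real (sqrt (8/cmod z)) * (Fres_lim * cis (k * cmod z) * A (Arg z) + cnj Fres_lim * cis (- (k * cmod z)) * A (Arg z + pi))"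
  obtain C1 k1 where C1: "C1 > 0" "k1 \<ge> 1" and B1:
    "\<And>k N \<sigma>. k \<ge> k1 \<Longrightarrow> m \<le> N \<Longrightarrow> N \<le> M \<Longrightarrow>
        norm (of_real (sqrt k) * integral {-pi..pi} (\<lambda>s. amp n G 0 s * cis (k * N * cos (s - \<sigma>)))
           - of_real (sqrt (8/N)) * (Fres_lim * cis (k * N) * amp n G 0 \<sigma> + cnj Fres_lim * cis (- (k * N)) * amp n G 0 (\<sigma> + pi)))
         \<le> C1 * (1 + ln k) / sqrt k"
    using stationary_phase_scaled[OF A1 m(1), of M] by blast
  note B1 = B1[OF _ m(2) m(3)]
  obtain C2 k2 where C2: "C2 > 0" "k2 \<ge> 1" and B2:
    "\<And>k N \<sigma>. k \<ge> k2 \<Longrightarrow> m \<le> N \<Longrightarrow> N \<le> M \<Longrightarrow>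
        norm (of_real (sqrt k) * integral {-pi..pi} (\<lambda>s. amp n G pi s * cis (k * N * cos (s - \<sigma>)))
           - of_real (sqrt (8/N)) * (Fres_lim * cis (k * N) * amp n G pi \<sigma> + cnj Fres_lim * cis (- (k * N)) * amp n G pi (\<sigma> + pi)))
         \<le> C2 * (1 + ln k) / sqrt k"
    using stationary_phase_scaled[OF A2 m(1), of M] by blast
  note B2 = B2[OF _ m(4) m(5)]
  have eq: "integral {-pi..pi} (\<lambda>s. n s * V_lead G k s * cis (k * ph \<alpha> s))
     = of_real (sqrt 8) * Fres_lim * cis (k * D1 \<alpha>) * ?J (amp n G 0) k (z1 \<alpha>)
     + of_real (sqrt 8) * cnj Fres_lim * cis (k * D2 \<alpha>) * ?J (amp n G pi) k (z2 \<alpha>)" for k \<alpha>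
  proof -
    have "n s * V_lead G k s * cis (k * ph \<alpha> s) =
       of_real (sqrt 8) * Fres_lim * cis (k * D1 \<alpha>) * (amp n G 0 s * cis (k * cmod (z1 \<alpha>) * cos (s - Arg (z1 \<alpha>))))
     + of_real (sqrt 8) * cnj Fres_lim * cis (k * D2 \<alpha>) * (amp n G pi s * cis (k * cmod (z2 \<alpha>) * cos (s - Arg (z2 \<alpha>))))" for s
    proof -
      have p1: "cis (k * rr s) * cis (k * ph \<alpha> s) = cis (k * D1 \<alpha>) * cis (k * cmod (z1 \<alpha>) * cos (s - Arg (z1 \<alpha>)))"
        using arg_cong[OF phase_plus[of s \<alpha>], of "\<lambda>x. k * x"] unfolding ph_def D1_def
        by (simp only: cis_mult distrib_left mult.assoc)
      have p2: "cis (- (k * rr s)) * cis (k * ph \<alpha> s) = cis (k * D2 \<alpha>) * cis (k * cmod (z2 \<alpha>) * cos (s - Arg (z2 \<alpha>)))"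
        using arg_cong[OF phase_minus[of s \<alpha>], of "\<lambda>x. k * x"] unfolding ph_def D2_def
        by (simp only: cis_mult distrib_left mult.assoc mult_minus_right)
      have s8: "complex_of_real (sqrt (8 / rr s)) = of_real (sqrt 8) * of_real (1 / sqrt (rr s))"
        by (simp add: real_sqrt_divide)
      have "n s * V_lead G k s * cis (k * ph \<alpha> s) =
          of_real (sqrt 8) * Fres_lim * amp n G 0 s * (cis (k * rr s) * cis (k * ph \<alpha> s))
        + of_real (sqrt 8) * cnj Fres_lim * amp n G pi s * (cis (- (k * rr s)) * cis (k * ph \<alpha> s))"
        unfolding V_lead_def s8 amp_def add_0_right by (simp only: distrib_left distrib_right mult_ac)
      thus ?thesis unfolding p1 p2 by (simp only: mult_ac)
    qed
    moreover have cA: "continuous_on {-pi..pi} (amp n G c)" for c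
      by (rule continuous_on_subset[OF C1_periodic_continuous[OF amp_C1_periodic[OF n G]]]) auto
    have "(\<lambda>s. amp n G c s * cis (k * cmod z * cos (s - Arg z))) integrable_on {-pi..pi}" for c k z
      by (intro integrable_continuous_real continuous_intros cA)
    hence "((\<lambda>s. of_real (sqrt 8) * Fres_lim * cis (k * D1 \<alpha>) * (amp n G 0 s * cis (k * cmod (z1 \<alpha>) * cos (s - Arg (z1 \<alpha>))))
     + of_real (sqrt 8) * cnj Fres_lim * cis (k * D2 \<alpha>) * (amp n G pi s * cis (k * cmod (z2 \<alpha>) * cos (s - Arg (z2 \<alpha>)))))
      has_integral of_real (sqrt 8) * Fres_lim * cis (k * D1 \<alpha>) * ?J (amp n G 0) k (z1 \<alpha>)
     + of_real (sqrt 8) * cnj Fres_lim * cis (k * D2 \<alpha>) * ?J (amp n G pi) k (z2 \<alpha>)) {-pi..pi}"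
      by (intro has_integral_add has_integral_mult_right integrable_integral)
    ultimately show ?thesis by (simp only: integral_unique)
  qed
  define S where "S = sqrt 8 * norm Fres_lim"
  have S: "S \<ge> 0" by (simp add: S_def)
  show thesis
  proof (rule that[of "S * C1 + S * C2 + 1" "max k1 k2"])
    fix k \<alpha> assume k: "max k1 k2 \<le> k"
    have k1: "k \<ge> 1" using k C1 by simp
    define E1 where "E1 = of_real (sqrt k) * ?J (amp n G 0) k (z1 \<alpha>) - ?L (amp n G 0) k (z1 \<alpha>)"
    define E2 where "E2 = of_real (sqrt k) * ?J (amp n G pi) k (z2 \<alpha>) - ?L (amp n G pi) k (z2 \<alpha>)"
    have "of_real (sqrt k) * integral {-pi..pi} (\<lambda>s. n s * V_lead G k s * cis (k * ph \<alpha> s)) - T_lead n G k \<alpha>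
       = of_real (sqrt 8) * Fres_lim * cis (k * D1 \<alpha>) * E1 + of_real (sqrt 8) * cnj Fres_lim * cis (k * D2 \<alpha>) * E2"
      unfolding eq T_lead_def E1_def E2_def by (simp only: right_diff_distrib distrib_left mult_ac) simp
    also have "norm \<dots> \<le> S * norm E1 + S * norm E2"
      by (rule order.trans[OF norm_triangle_ineq]) (simp add: norm_mult S_def)
    also have "\<dots> \<le> S * (C1 * (1 + ln k) / sqrt k) + S * (C2 * (1 + ln k) / sqrt k)"
      unfolding E1_def E2_def using S k by (intro add_mono mult_left_mono B1 B2) auto
    also have "\<dots> = (S * C1 + S * C2) * ((1 + ln k) / sqrt k)" by (simp add: algebra_simps add_divide_distrib)
    also have "\<dots> \<le> (S * C1 + S * C2 + 1) * ((1 + ln k) / sqrt k)"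
      using k1 by (intro mult_right_mono) auto
    finally show "norm (of_real (sqrt k) * integral {-pi..pi} (\<lambda>s. n s * V_lead G k s * cis (k * ph \<alpha> s)) - T_lead n G k \<alpha>)
        \<le> (S * C1 + S * C2 + 1) * (1 + ln k) / sqrt k" by simp
  qed (use C1 C2 S in \<open>auto intro!: add_nonneg_pos\<close>)
qed

lemma continuous_on_Arg_z:
  assumes "C1_periodic A"
  shows "continuous_on S (\<lambda>\<alpha>. A (Arg (z1 \<alpha>) + c))" "continuous_on S (\<lambda>\<alpha>. A (Arg (z2 \<alpha>) + c))"
proof -
  have "continuous_on UNIV (\<lambda>s. A (s + c))"
    by (rule continuous_on_compose2[OF C1_periodic_continuous[OF assms]]) (auto intro!: continuous_intros)
  moreover have "A (s + 2 * pi + c) = A (s + c)" for s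
    using C1_periodic_per[OF assms, of "s + c"] by (simp add: add_ac)
  ultimately have c: "continuous_on (- {0}) (\<lambda>z. A (Arg z + c))"
    by (intro continuous_on_periodic_Arg[of "\<lambda>s. A (s + c)"]) auto
  show "continuous_on S (\<lambda>\<alpha>. A (Arg (z1 \<alpha>) + c))" "continuous_on S (\<lambda>\<alpha>. A (Arg (z2 \<alpha>) + c))"
    by (rule continuous_on_compose2[OF c z_continuous(1)], use z1_nz in auto,
        rule continuous_on_compose2[OF c z_continuous(2)], use z2_nz in auto)
qed

lemma D_continuous: "continuous_on S D1" "continuous_on S D2"
  unfolding D1_def D2_def by (intro continuous_intros)+

lemma amp_Arg_continuous:
  assumes n: "C1_periodic n" and G: "C1_periodic G"
  shows "continuous_on S (\<lambda>\<alpha>. amp n G c (Arg (z1 \<alpha>)))" "continuous_on S (\<lambda>\<alpha>. amp n G c (Arg (z1 \<alpha>) + pi))"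
    "continuous_on S (\<lambda>\<alpha>. amp n G c (Arg (z2 \<alpha>)))" "continuous_on S (\<lambda>\<alpha>. amp n G c (Arg (z2 \<alpha>) + pi))"
  using continuous_on_Arg_z[OF amp_C1_periodic[OF n G], of S c 0] continuous_on_Arg_z[OF amp_C1_periodic[OF n G], of S c pi]
  by simp_all

lemma T_lead_continuous:
  assumes n: "C1_periodic n" and G: "C1_periodic G"
  shows "continuous_on S (T_lead n G k)"
  unfolding T_lead_def
  by (intro continuous_intros amp_Arg_continuous[OF n G] D_continuous z_continuous) (use z1_nz z2_nz in auto)

text \<open>Interchanging the integrals pairs the error of the first expansion with the average
  \<open>W\<close> over \<alpha>. After multiplication by k that error is O(log k) pointwise, and
  the L^1 norm of \<open>W\<close> turns it into O(k^(-1/4) log k). The leading part needs no such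
  gain: the second expansion is applied to it for each \<alpha>, with error O(log k / sqrt
  k).\<close>

lemma reduce_to_T:
  assumes uv: "u \<le> v" "v - u \<le> 1" and g: "continuous_on {u..v} g" and Psi: "continuous_on {u..v} \<Psi>"
    and n: "C1_periodic n" and G: "C1_periodic G"
  shows "((\<lambda>k. of_real k * integral {u..v} (\<lambda>\<alpha>. g \<alpha> * cis (- (k * \<Psi> \<alpha>)) *
              integral {-pi..pi} (\<lambda>s. n s * V G k s * cis (k * ph \<alpha> s)))
            - integral {u..v} (\<lambda>\<alpha>. g \<alpha> * cis (- (k * \<Psi> \<alpha>)) * T_lead n G k \<alpha>)) \<longlongrightarrow> 0) at_top"
proof -
  obtain C1 where C1: "C1 > 0"
    "\<And>k. k \<ge> 1 \<Longrightarrow> integral {-pi..pi} (\<lambda>s. norm (integral {u..v} (\<lambda>\<alpha>. g \<alpha> * cis (- (k * \<Psi> \<alpha>)) * cis (k * ph \<alpha> s))))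
        \<le> C1 / k powr (1/4)" using W_bound[OF uv g Psi] by blast
  obtain C2 k2 where C2: "C2 > 0" "k2 \<ge> 1"
    "\<And>k s. k \<ge> k2 \<Longrightarrow> norm (of_real (sqrt k) * V G k s - V_lead G k s) \<le> C2 * (1 + ln k) / sqrt k"
    using V_asymp[OF G] by blast
  obtain C3 k3 where C3: "C3 > 0" "k3 \<ge> 1"
    "\<And>k \<alpha>. k \<ge> k3 \<Longrightarrow> norm (of_real (sqrt k) * integral {-pi..pi} (\<lambda>s. n s * V_lead G k s * cis (k * ph \<alpha> s)) - T_lead n G k \<alpha>)
        \<le> C3 * (1 + ln k) / sqrt k" using lead_asymp[OF n G] by blast
  have nc: "continuous_on A n" for A using C1_periodic_continuous[OF n] continuous_on_subset by blast
  obtain B where B: "B > 0" "\<And>s. norm (n s) \<le> B"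
    using periodic_bounded[OF C1_periodic_continuous[OF n]] C1_periodic_per[OF n] by blast
  have "bounded (g ` {u..v})" by (intro compact_imp_bounded compact_continuous_image g) auto
  then obtain M where M: "M > 0" "\<And>x. x \<in> {u..v} \<Longrightarrow> norm (g x) \<le> M"
    unfolding bounded_pos by blast
  show ?thesis
  proof (rule Lim_null_comparison)
    show "((\<lambda>k. B * C2 * (1 + ln k) * (C1 / k powr (1/4)) + M * (C3 * (1 + ln k) / sqrt k)) \<longlongrightarrow> 0) at_top"
      by real_asymp
    show "eventually (\<lambda>k. norm (of_real k * integral {u..v} (\<lambda>\<alpha>. g \<alpha> * cis (- (k * \<Psi> \<alpha>)) *
              integral {-pi..pi} (\<lambda>s. n s * V G k s * cis (k * ph \<alpha> s)))
            - integral {u..v} (\<lambda>\<alpha>. g \<alpha> * cis (- (k * \<Psi> \<alpha>)) * T_lead n G k \<alpha>))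
          \<le> B * C2 * (1 + ln k) * (C1 / k powr (1/4)) + M * (C3 * (1 + ln k) / sqrt k)) at_top"
      using eventually_ge_at_top[of "max k2 k3"]
    proof eventually_elim
      case (elim k)
      hence k: "k \<ge> 1" "k \<ge> k2" "k \<ge> k3" using C2 by auto
      have lnk: "ln k \<ge> 0" using k by simp
      define h where "h = (\<lambda>\<alpha>. g \<alpha> * cis (- (k * \<Psi> \<alpha>)))"
      have ch: "continuous_on {u..v} h" unfolding h_def by (intro continuous_intros g Psi)
      define W where "W = (\<lambda>s. integral {u..v} (\<lambda>\<alpha>. h \<alpha> * cis (k * ph \<alpha> s)))"
      have cW: "continuous_on {-pi..pi} W" unfolding W_def
      proof (rule continuous_on_integral_rect)
        have "continuous_on ({u..v} \<times> {-pi..pi}) (\<lambda>z. h (fst z))"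
          by (rule continuous_on_compose2[OF ch], auto intro!: continuous_intros)
        thus "continuous_on ({u..v} \<times> {-pi..pi}) (\<lambda>(\<alpha>, s). h \<alpha> * cis (k * ph \<alpha> s))"
          by (auto simp: case_prod_beta intro!: continuous_intros)
      qed
      have W1: "integral {-pi..pi} (\<lambda>s. norm (W s)) \<le> C1 / k powr (1/4)"
        using C1(2)[OF k(1)] by (simp add: W_def h_def)
      have cV: "continuous_on {-pi..pi} (V G k)" "continuous_on {-pi..pi} (V_lead G k)"
        using V_continuous[OF G] V_lead_continuous[OF G] by auto
      define IV where "IV = integral {u..v} (\<lambda>\<alpha>. h \<alpha> * integral {-pi..pi} (\<lambda>s. n s * V G k s * cis (k * ph \<alpha> s)))"
      define IL where "IL = integral {u..v} (\<lambda>\<alpha>. h \<alpha> * integral {-pi..pi} (\<lambda>s. n s * V_lead G k s * cis (k * ph \<alpha> s)))"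
      define IT where "IT = integral {u..v} (\<lambda>\<alpha>. h \<alpha> * T_lead n G k \<alpha>)"
      have sk: "complex_of_real k = of_real (sqrt k) * of_real (sqrt k)"
        using k by (simp flip: of_real_mult)
      have IV: "IV = integral {-pi..pi} (\<lambda>s. n s * V G k s * W s)"
        unfolding IV_def W_def by (rule swap_osc[OF ch]) (intro continuous_intros nc cV)
      have IL: "IL = integral {-pi..pi} (\<lambda>s. n s * V_lead G k s * W s)"
        unfolding IL_def W_def by (rule swap_osc[OF ch]) (intro continuous_intros nc cV)
      have hV: "((\<lambda>s. n s * V G k s * W s) has_integral IV) {-pi..pi}"
        unfolding IV by (intro integrable_integral integrable_continuous_real continuous_intros nc cV cW)
      have hL: "((\<lambda>s. n s * V_lead G k s * W s) has_integral IL) {-pi..pi}"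
        unfolding IL by (intro integrable_integral integrable_continuous_real continuous_intros nc cV cW)
      have "((\<lambda>s. of_real (sqrt k) * (n s * V G k s * W s) - n s * V_lead G k s * W s) has_integral of_real (sqrt k) * IV - IL) {-pi..pi}"
        by (intro has_integral_diff has_integral_mult_right hV hL)
      moreover have "(\<lambda>s. norm (W s)) integrable_on {-pi..pi}"
        by (intro integrable_continuous_real continuous_intros cW)
      hence "((\<lambda>s. B * (C2 * (1 + ln k) / sqrt k) * norm (W s)) has_integral B * (C2 * (1 + ln k) / sqrt k) * integral {-pi..pi} (\<lambda>s. norm (W s))) {-pi..pi}"
        by (intro has_integral_mult_right integrable_integral)
      ultimately have "norm (of_real (sqrt k) * IV - IL) \<le> (B * (C2 * (1 + ln k) / sqrt k) * integral {-pi..pi} (\<lambda>s. norm (W s))) \<bullet> 1"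
      proof (rule has_integral_norm_bound_integral_component)
        fix s
        have "of_real (sqrt k) * (n s * V G k s * W s) - n s * V_lead G k s * W s
            = n s * (of_real (sqrt k) * V G k s - V_lead G k s) * W s" by (simp add: algebra_simps)
        also have "norm \<dots> \<le> B * (C2 * (1 + ln k) / sqrt k) * norm (W s)"
          unfolding norm_mult using B C2(1) C2(3)[OF k(2)] lnk k by (intro mult_mono) (auto simp: norm_mult)
        finally show "norm (of_real (sqrt k) * (n s * V G k s * W s) - n s * V_lead G k s * W s)
             \<le> (B * (C2 * (1 + ln k) / sqrt k) * norm (W s)) \<bullet> 1" by simp
      qed
      also have "\<dots> \<le> (B * (C2 * (1 + ln k) / sqrt k) * (C1 / k powr (1/4)))"
        unfolding inner_real_def mult_1_right using B C2 lnk k by (intro mult_left_mono W1) auto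
      finally have e1: "norm (of_real (sqrt k) * IV - IL) \<le> B * (C2 * (1 + ln k) / sqrt k) * (C1 / k powr (1/4))" .
      have e1': "norm (of_real k * IV - of_real (sqrt k) * IL) \<le> B * C2 * (1 + ln k) * (C1 / k powr (1/4))"
      proof -
        have "of_real k * IV - of_real (sqrt k) * IL = of_real (sqrt k) * (of_real (sqrt k) * IV - IL)"
          unfolding sk by (simp only: right_diff_distrib mult.assoc)
        hence "norm (of_real k * IV - of_real (sqrt k) * IL) = sqrt k * norm (of_real (sqrt k) * IV - IL)"
          using k by (simp only: norm_mult norm_of_real) simp
        also have "\<dots> \<le> sqrt k * (B * (C2 * (1 + ln k) / sqrt k) * (C1 / k powr (1/4)))"
          using e1 k by (intro mult_left_mono) auto
        also have "\<dots> = B * C2 * (1 + ln k) * (C1 / k powr (1/4))" using k by simp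
        finally show ?thesis .
      qed
      let ?P = "\<lambda>\<alpha>. integral {-pi..pi} (\<lambda>s. n s * V_lead G k s * cis (k * ph \<alpha> s))"
      have cP: "continuous_on {u..v} ?P"
      proof -
        have "continuous_on ({-pi..pi} \<times> {u..v}) (\<lambda>z. n (fst z) * V_lead G k (fst z))"
          by (rule continuous_on_compose2[of "{-pi..pi}" "\<lambda>s. n s * V_lead G k s"]) (auto intro!: continuous_intros nc cV)
        hence "continuous_on ({-pi..pi} \<times> {u..v}) (\<lambda>(s, \<alpha>). n s * V_lead G k s * cis (k * ph \<alpha> s))"
          by (auto simp: case_prod_beta intro!: continuous_intros)
        from continuous_on_integral_rect[OF this] show ?thesis .
      qed
      have "((\<lambda>\<alpha>. of_real (sqrt k) * (h \<alpha> * ?P \<alpha>) - h \<alpha> * T_lead n G k \<alpha>) has_integral of_real (sqrt k) * IL - IT) {u..v}"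
        unfolding IL_def IT_def
        by (intro has_integral_diff has_integral_mult_right integrable_integral integrable_continuous_real continuous_intros ch cP T_lead_continuous n G)
      hence "norm (of_real (sqrt k) * IL - IT) \<le> (M * (C3 * (1 + ln k) / sqrt k)) * measure lborel {u..v}"
      proof (rule has_integral_bound_real[of _ "{}", rotated 2])
        fix \<alpha> assume \<alpha>: "\<alpha> \<in> {u..v} - {}"
        have "of_real (sqrt k) * (h \<alpha> * ?P \<alpha>) - h \<alpha> * T_lead n G k \<alpha> = h \<alpha> * (of_real (sqrt k) * ?P \<alpha> - T_lead n G k \<alpha>)"
          by (simp add: algebra_simps)
        also have "norm \<dots> \<le> M * (C3 * (1 + ln k) / sqrt k)"
          unfolding norm_mult using M(1) M(2)[of \<alpha>] \<alpha> C3(1) C3(3)[OF k(3)] lnk k by (intro mult_mono) (auto simp: h_def norm_mult)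
        finally show "norm (of_real (sqrt k) * (h \<alpha> * ?P \<alpha>) - h \<alpha> * T_lead n G k \<alpha>) \<le> M * (C3 * (1 + ln k) / sqrt k)" .
      qed (use M C3 lnk k in auto)
      also have "\<dots> \<le> (M * (C3 * (1 + ln k) / sqrt k)) * 1"
        using uv M C3 lnk k by (intro mult_left_mono) auto
      finally have e2: "norm (of_real (sqrt k) * IL - IT) \<le> M * (C3 * (1 + ln k) / sqrt k)" by simp
      have "of_real k * IV - IT = (of_real k * IV - of_real (sqrt k) * IL) + (of_real (sqrt k) * IL - IT)" by simp
      hence "norm (of_real k * IV - IT) \<le> B * C2 * (1 + ln k) * (C1 / k powr (1/4)) + M * (C3 * (1 + ln k) / sqrt k)"
        by (simp only:) (rule order.trans[OF norm_triangle_ineq add_mono[OF e1' e2]])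
      thus ?case by (simp only: IV_def IT_def h_def)
    qed
  qed
qed

text \<open>From here to \<open>generic_nz\<close>: the four phases differ pairwise by functions of \<open>\<alpha>\<close> with nonzero derivative
  at generic \<open>\<alpha>\<close>. This is where \<open>q \<noteq> 1\<close> enters the asymptotics.\<close>

lemma cmod_z1_sq: "(cmod (z1 \<alpha>))\<^sup>2 = (a - f * sqrt q * cos \<alpha>)\<^sup>2 + b\<^sup>2 * (q - 1)"
  and cmod_z2_sq: "(cmod (z2 \<alpha>))\<^sup>2 = (a + f * sqrt q * cos \<alpha>)\<^sup>2 + b\<^sup>2 * (q - 1)"
proof -
  have sc: "(sin \<alpha>)\<^sup>2 = 1 - (cos \<alpha>)\<^sup>2" by (simp add: sin_squared_eq)
  have b: "b\<^sup>2 = a\<^sup>2 - f\<^sup>2" using abf by simp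
  have s: "(sqrt q)\<^sup>2 = q" using q_pos by simp
  show "(cmod (z1 \<alpha>))\<^sup>2 = (a - f * sqrt q * cos \<alpha>)\<^sup>2 + b\<^sup>2 * (q - 1)"
    unfolding cmod_power2 z1_def complex.sel power2_diff power_mult_distrib s sc b by (simp add: algebra_simps)
  show "(cmod (z2 \<alpha>))\<^sup>2 = (a + f * sqrt q * cos \<alpha>)\<^sup>2 + b\<^sup>2 * (q - 1)"
    unfolding cmod_power2 z2_def complex.sel power2_sum power_mult_distrib s sc b by (simp add: algebra_simps)
qed

definition N1' :: "real \<Rightarrow> real" where
  "N1' \<alpha> = sqrt q * f * sin \<alpha> * (a - f * sqrt q * cos \<alpha>) / cmod (z1 \<alpha>)"
definition N2' :: "real \<Rightarrow> real" where
  "N2' \<alpha> = - (sqrt q * f * sin \<alpha> * (a + f * sqrt q * cos \<alpha>) / cmod (z2 \<alpha>))"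

lemma cmod_z1_deriv: "((\<lambda>\<alpha>. cmod (z1 \<alpha>)) has_real_derivative N1' \<alpha>) (at \<alpha> within S)"
  and cmod_z2_deriv: "((\<lambda>\<alpha>. cmod (z2 \<alpha>)) has_real_derivative N2' \<alpha>) (at \<alpha> within S)"
proof -
  have hc: "inverse c / 2 * (2 * x) = x / c" for c x :: real by (cases "c = 0") (simp_all add: field_simps)
  have e1: "sqrt ((a - f * sqrt q * cos \<alpha>)\<^sup>2 + b\<^sup>2 * (q - 1)) = cmod (z1 \<alpha>)" for \<alpha>
    by (metis cmod_z1_sq norm_ge_zero real_sqrt_unique)
  have e2: "sqrt ((a + f * sqrt q * cos \<alpha>)\<^sup>2 + b\<^sup>2 * (q - 1)) = cmod (z2 \<alpha>)" for \<alpha>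
    by (metis cmod_z2_sq norm_ge_zero real_sqrt_unique)
  have p1: "(a - f * sqrt q * cos \<alpha>)\<^sup>2 + b\<^sup>2 * (q - 1) > 0" unfolding cmod_z1_sq[symmetric] using z1_nz by simp
  have p2: "(a + f * sqrt q * cos \<alpha>)\<^sup>2 + b\<^sup>2 * (q - 1) > 0" unfolding cmod_z2_sq[symmetric] using z2_nz by simp
  have d1: "((\<lambda>\<alpha>. (a - f * sqrt q * cos \<alpha>)\<^sup>2 + b\<^sup>2 * (q - 1)) has_real_derivative
      2 * (sqrt q * f * sin \<alpha> * (a - f * sqrt q * cos \<alpha>))) (at \<alpha> within S)"
    by (rule derivative_eq_intros refl | simp)+
  have d2: "((\<lambda>\<alpha>. (a + f * sqrt q * cos \<alpha>)\<^sup>2 + b\<^sup>2 * (q - 1)) has_real_derivative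
      2 * (- (sqrt q * f * sin \<alpha> * (a + f * sqrt q * cos \<alpha>)))) (at \<alpha> within S)"
    by (rule derivative_eq_intros refl | simp)+
  show "((\<lambda>\<alpha>. cmod (z1 \<alpha>)) has_real_derivative N1' \<alpha>) (at \<alpha> within S)"
    using DERIV_chain2[OF DERIV_real_sqrt[OF p1] d1] unfolding e1
    by (rule DERIV_cong) (simp only: hc N1'_def minus_divide_left)
  show "((\<lambda>\<alpha>. cmod (z2 \<alpha>)) has_real_derivative N2' \<alpha>) (at \<alpha> within S)"
    using DERIV_chain2[OF DERIV_real_sqrt[OF p2] d2] unfolding e2
    by (rule DERIV_cong) (simp only: hc N2'_def minus_divide_left)
qed

lemma N'_continuous: "continuous_on S N1'" "continuous_on S N2'"
  unfolding N1'_def N2'_def using z1_nz z2_nz by (intro continuous_intros z_continuous; simp)+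

text \<open>Each excluded equation is a place where phase derivatives vanish or coincide up to sign:
  sin \<alpha> = 0 kills both \<open>N1'\<close> and \<open>N2'\<close>, the last one kills
  \<open>N1'\<close>, and cos \<alpha> = 0 makes \<open>N2'\<close> the negative of
  \<open>N1'\<close>.\<close>

definition generic :: "real \<Rightarrow> bool" where
  "generic \<alpha> \<longleftrightarrow> sin \<alpha> \<noteq> 0 \<and> cos \<alpha> \<noteq> 0 \<and> f * sqrt q * cos \<alpha> \<noteq> a"

lemma generic_nz:
  assumes "generic \<alpha>"
  shows "N1' \<alpha> \<noteq> 0" "N2' \<alpha> - N1' \<alpha> \<noteq> 0" "N2' \<alpha> + N1' \<alpha> \<noteq> 0"
proof -
  define X where "X = a - f * sqrt q * cos \<alpha>"
  define Y where "Y = a + f * sqrt q * cos \<alpha>"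
  define s where "s = sqrt q * f * sin \<alpha>"
  have s: "s \<noteq> 0" using assms q_pos f_pos by (simp add: s_def generic_def)
  have X: "X \<noteq> 0" using assms by (simp add: X_def generic_def)
  have n1: "cmod (z1 \<alpha>) > 0" "cmod (z2 \<alpha>) > 0" using z1_nz z2_nz by auto
  have N1: "N1' \<alpha> = s * (X / cmod (z1 \<alpha>))" and N2: "N2' \<alpha> = - (s * (Y / cmod (z2 \<alpha>)))"
    by (simp_all add: N1'_def N2'_def X_def Y_def s_def)
  show "N1' \<alpha> \<noteq> 0" using s X n1 by (simp add: N1)
  \<comment> \<open>The squared moduli are X^2 and Y^2 plus the same constant b^2 (q - 1). Cross
    multiplication therefore leaves (Y^2 - X^2) b^2 (q - 1) = 0, and Y^2 - X^2 is proportional to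
    cos \<alpha>.\<close>
  have ne: "(X / cmod (z1 \<alpha>))\<^sup>2 \<noteq> (Y / cmod (z2 \<alpha>))\<^sup>2"
  proof
    assume "(X / cmod (z1 \<alpha>))\<^sup>2 = (Y / cmod (z2 \<alpha>))\<^sup>2"
    hence "X\<^sup>2 * (cmod (z2 \<alpha>))\<^sup>2 = Y\<^sup>2 * (cmod (z1 \<alpha>))\<^sup>2"
      using n1 by (simp add: power_divide field_simps)
    hence "X\<^sup>2 * (Y\<^sup>2 + b\<^sup>2 * (q - 1)) = Y\<^sup>2 * (X\<^sup>2 + b\<^sup>2 * (q - 1))"
      unfolding cmod_z1_sq cmod_z2_sq X_def Y_def .
    hence "(Y\<^sup>2 - X\<^sup>2) * (b\<^sup>2 * (q - 1)) = 0" by (simp add: algebra_simps)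
    hence "Y\<^sup>2 - X\<^sup>2 = 0" using b_pos q_ne by simp
    moreover have "Y\<^sup>2 - X\<^sup>2 = 4 * (a * (f * sqrt q * cos \<alpha>))"
      by (simp add: X_def Y_def power2_eq_square algebra_simps)
    ultimately show False using assms a_pos f_pos q_pos by (simp add: generic_def)
  qed
  show "N2' \<alpha> - N1' \<alpha> \<noteq> 0"
  proof
    assume "N2' \<alpha> - N1' \<alpha> = 0"
    hence "s * (X / cmod (z1 \<alpha>)) = s * (- (Y / cmod (z2 \<alpha>)))" by (simp add: N1 N2)
    hence "X / cmod (z1 \<alpha>) = - (Y / cmod (z2 \<alpha>))" using s by (simp only: mult_cancel_left) simp
    thus False using ne by simp
  qed
  show "N2' \<alpha> + N1' \<alpha> \<noteq> 0"
  proof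
    assume "N2' \<alpha> + N1' \<alpha> = 0"
    hence "s * (X / cmod (z1 \<alpha>)) = s * (Y / cmod (z2 \<alpha>))" by (simp add: N1 N2)
    hence "X / cmod (z1 \<alpha>) = Y / cmod (z2 \<alpha>)" using s by (simp only: mult_cancel_left) simp
    thus False using ne by simp
  qed
qed

definition lead1 :: "(real \<Rightarrow> complex) \<Rightarrow> (real \<Rightarrow> complex) \<Rightarrow> real \<Rightarrow> complex" where
  "lead1 n G \<alpha> = of_real (sqrt 8) * of_real (sqrt (8 / cmod (z1 \<alpha>))) * (Fres_lim * Fres_lim) * amp n G 0 (Arg (z1 \<alpha>))"

lemma lead1_continuous:
  assumes n: "C1_periodic n" and G: "C1_periodic G"
  shows "continuous_on S (lead1 n G)"
  unfolding lead1_def using z1_nz by (intro continuous_intros amp_Arg_continuous[OF n G] z_continuous) auto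

text \<open>The conjugate phase turns the first term into a constant in k. Since D_2 - D_1 is the
  constant -2a, the other phases become -2 N_1 and -2a plus or minus N_2 minus N_1, whose
  derivatives do not vanish at generic directions.\<close>

lemma T_limit:
  assumes uv: "u \<le> v" and g: "continuous_on {u..v} g" and gen: "\<And>\<alpha>. \<alpha> \<in> {u..v} \<Longrightarrow> generic \<alpha>"
    and n: "C1_periodic n" and G: "C1_periodic G"
  shows "((\<lambda>k. integral {u..v} (\<lambda>\<alpha>. g \<alpha> * cis (- (k * (D1 \<alpha> + cmod (z1 \<alpha>)))) * T_lead n G k \<alpha>))
      \<longlongrightarrow> integral {u..v} (\<lambda>\<alpha>. g \<alpha> * lead1 n G \<alpha>)) at_top"
proof -
  define c2 where "c2 = (\<lambda>\<alpha>. g \<alpha> * (of_real (sqrt 8) * of_real (sqrt (8 / cmod (z1 \<alpha>))) * (Fres_lim * cnj Fres_lim) * amp n G 0 (Arg (z1 \<alpha>) + pi)))"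
  define c3 where "c3 = (\<lambda>\<alpha>. g \<alpha> * (of_real (sqrt 8) * of_real (sqrt (8 / cmod (z2 \<alpha>))) * (cnj Fres_lim * Fres_lim) * amp n G pi (Arg (z2 \<alpha>))))"
  define c4 where "c4 = (\<lambda>\<alpha>. g \<alpha> * (of_real (sqrt 8) * of_real (sqrt (8 / cmod (z2 \<alpha>))) * (cnj Fres_lim * cnj Fres_lim) * amp n G pi (Arg (z2 \<alpha>) + pi)))"
  define d2 where "d2 = (\<lambda>\<alpha>. - 2 * cmod (z1 \<alpha>))"
  define d3 where "d3 = (\<lambda>\<alpha>. - 2 * a + cmod (z2 \<alpha>) - cmod (z1 \<alpha>))"
  define d4 where "d4 = (\<lambda>\<alpha>. - 2 * a - cmod (z2 \<alpha>) - cmod (z1 \<alpha>))"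
  have cc: "continuous_on {u..v} c2" "continuous_on {u..v} c3" "continuous_on {u..v} c4"
    unfolding c2_def c3_def c4_def using z1_nz z2_nz
    by (intro continuous_intros amp_Arg_continuous[OF n G] z_continuous g; simp)+
  have cd: "continuous_on {u..v} d2" "continuous_on {u..v} d3" "continuous_on {u..v} d4"
    unfolding d2_def d3_def d4_def by (intro continuous_intros z_continuous)+
  have eq: "g \<alpha> * cis (- (k * (D1 \<alpha> + cmod (z1 \<alpha>)))) * T_lead n G k \<alpha>
     = g \<alpha> * lead1 n G \<alpha> + c2 \<alpha> * cis (k * d2 \<alpha>) + c3 \<alpha> * cis (k * d3 \<alpha>) + c4 \<alpha> * cis (k * d4 \<alpha>)" for k \<alpha>
  proof -
    define e where "e = cis (- (k * (D1 \<alpha> + cmod (z1 \<alpha>))))"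
    have e1: "e * cis (k * D1 \<alpha>) * cis (k * cmod (z1 \<alpha>)) = 1"
      by (simp add: e_def cis_mult algebra_simps)
    have e2: "e * cis (k * D1 \<alpha>) * cis (- (k * cmod (z1 \<alpha>))) = cis (k * d2 \<alpha>)"
      by (simp add: e_def cis_mult algebra_simps d2_def)
    have e3: "e * cis (k * D2 \<alpha>) * cis (k * cmod (z2 \<alpha>)) = cis (k * d3 \<alpha>)"
      by (simp add: e_def cis_mult algebra_simps d3_def D1_def D2_def)
    have e4: "e * cis (k * D2 \<alpha>) * cis (- (k * cmod (z2 \<alpha>))) = cis (k * d4 \<alpha>)"
      by (simp add: e_def cis_mult algebra_simps d4_def D1_def D2_def)
    have "g \<alpha> * e * T_lead n G k \<alpha> =
        g \<alpha> * lead1 n G \<alpha> * (e * cis (k * D1 \<alpha>) * cis (k * cmod (z1 \<alpha>)))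
      + c2 \<alpha> * (e * cis (k * D1 \<alpha>) * cis (- (k * cmod (z1 \<alpha>))))
      + c3 \<alpha> * (e * cis (k * D2 \<alpha>) * cis (k * cmod (z2 \<alpha>)))
      + c4 \<alpha> * (e * cis (k * D2 \<alpha>) * cis (- (k * cmod (z2 \<alpha>))))"
      unfolding T_lead_def lead1_def c2_def c3_def c4_def by (simp only: distrib_left mult_ac add_ac)
    thus ?thesis unfolding e1 e2 e3 e4 e_def[symmetric] by simp
  qed
  have "integral {u..v} (\<lambda>\<alpha>. g \<alpha> * cis (- (k * (D1 \<alpha> + cmod (z1 \<alpha>)))) * T_lead n G k \<alpha>)
     = integral {u..v} (\<lambda>\<alpha>. g \<alpha> * lead1 n G \<alpha>) + integral {u..v} (\<lambda>\<alpha>. c2 \<alpha> * cis (k * d2 \<alpha>))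
      + integral {u..v} (\<lambda>\<alpha>. c3 \<alpha> * cis (k * d3 \<alpha>)) + integral {u..v} (\<lambda>\<alpha>. c4 \<alpha> * cis (k * d4 \<alpha>))" for k
    unfolding eq
    by (intro integral_unique has_integral_add integrable_integral integrable_continuous_real continuous_intros g cc cd lead1_continuous n G)
  moreover have "((\<lambda>k. integral {u..v} (\<lambda>\<alpha>. g \<alpha> * lead1 n G \<alpha>) + integral {u..v} (\<lambda>\<alpha>. c2 \<alpha> * cis (k * d2 \<alpha>))
      + integral {u..v} (\<lambda>\<alpha>. c3 \<alpha> * cis (k * d3 \<alpha>)) + integral {u..v} (\<lambda>\<alpha>. c4 \<alpha> * cis (k * d4 \<alpha>)))
      \<longlongrightarrow> integral {u..v} (\<lambda>\<alpha>. g \<alpha> * lead1 n G \<alpha>) + 0 + 0 + 0) at_top"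
  proof (intro tendsto_add tendsto_const)
    show "((\<lambda>k. integral {u..v} (\<lambda>\<alpha>. c2 \<alpha> * cis (k * d2 \<alpha>))) \<longlongrightarrow> 0) at_top"
    proof (rule riemann_lebesgue_phase[OF uv cc(1)])
      show "(d2 has_real_derivative - 2 * N1' \<alpha>) (at \<alpha> within {u..v})" for \<alpha>
        unfolding d2_def by (intro DERIV_cmult cmod_z1_deriv)
    qed (use generic_nz gen in \<open>auto intro!: continuous_intros N'_continuous\<close>)
    show "((\<lambda>k. integral {u..v} (\<lambda>\<alpha>. c3 \<alpha> * cis (k * d3 \<alpha>))) \<longlongrightarrow> 0) at_top"
    proof (rule riemann_lebesgue_phase[OF uv cc(2)])
      show "(d3 has_real_derivative N2' \<alpha> - N1' \<alpha>) (at \<alpha> within {u..v})" for \<alpha>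
        unfolding d3_def by (auto intro!: derivative_eq_intros cmod_z1_deriv cmod_z2_deriv)
    qed (use generic_nz gen in \<open>auto intro!: continuous_intros N'_continuous\<close>)
    show "((\<lambda>k. integral {u..v} (\<lambda>\<alpha>. c4 \<alpha> * cis (k * d4 \<alpha>))) \<longlongrightarrow> 0) at_top"
    proof (rule riemann_lebesgue_phase[OF uv cc(3)])
      show "(d4 has_real_derivative - (N2' \<alpha> + N1' \<alpha>)) (at \<alpha> within {u..v})" for \<alpha>
        unfolding d4_def by (auto intro!: derivative_eq_intros cmod_z1_deriv cmod_z2_deriv)
      show "- (N2' \<alpha> + N1' \<alpha>) \<noteq> 0" if "\<alpha> \<in> {u..v}" for \<alpha> using generic_nz(3)[OF gen[OF that]] by linarith
    qed (intro continuous_intros N'_continuous)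
  qed
  ultimately show ?thesis by simp
qed

lemma main_term:
  assumes uv: "u \<le> v" "v - u \<le> 1" and g: "continuous_on {u..v} g" and gen: "\<And>\<alpha>. \<alpha> \<in> {u..v} \<Longrightarrow> generic \<alpha>"
    and n: "C1_periodic n" and G: "C1_periodic G"
  shows "((\<lambda>k. of_real k * integral {u..v} (\<lambda>\<alpha>. g \<alpha> * cis (- (k * (D1 \<alpha> + cmod (z1 \<alpha>)))) *
              integral {-pi..pi} (\<lambda>s. n s * V G k s * cis (k * ph \<alpha> s))))
      \<longlongrightarrow> integral {u..v} (\<lambda>\<alpha>. g \<alpha> * lead1 n G \<alpha>)) at_top"
proof -
  have "continuous_on {u..v} (\<lambda>\<alpha>. D1 \<alpha> + cmod (z1 \<alpha>))"
    by (intro continuous_intros D_continuous z_continuous)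
  from tendsto_add[OF reduce_to_T[OF uv g this n G] T_limit[OF uv(1) g gen n G]]
  show ?thesis by simp
qed

section \<open>The function \<open>H\<close> and its splitting into scalar terms\<close>

lemma C1_periodic_mult_cos_sin:
  assumes G: "C1_periodic G"
  shows "C1_periodic (\<lambda>\<theta>. G \<theta> * of_real (cos \<theta>))" "C1_periodic (\<lambda>\<theta>. G \<theta> * of_real (sin \<theta>))"
proof -
  have "C1_periodic (\<lambda>\<theta>. of_real (cos \<theta>))"
    by (rule C1_periodic_of_real[where g' = "\<lambda>s. - sin s"]) (auto intro!: derivative_eq_intros continuous_intros)
  thus "C1_periodic (\<lambda>\<theta>. G \<theta> * of_real (cos \<theta>))" by (rule C1_periodic_mult[OF G])
  have "C1_periodic (\<lambda>\<theta>. of_real (sin \<theta>))"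
    by (rule C1_periodic_of_real[where g' = cos]) (auto intro!: derivative_eq_intros continuous_intros)
  thus "C1_periodic (\<lambda>\<theta>. G \<theta> * of_real (sin \<theta>))" by (rule C1_periodic_mult[OF G])
qed

text \<open>(b cos s, a sin s) ds is the outward normal times the arc length element. The real
  factor is thus the flux density of the constant vector sqrt q eta - omega, with eta and omega the
  directions of angle \<alpha> and \<open>\<theta>\<close>.\<close>

definition H :: "(real \<Rightarrow> complex) \<Rightarrow> real \<Rightarrow> real \<Rightarrow> complex" where
  "H \<phi> k \<alpha> = integral {-pi..pi} (\<lambda>s. integral {-pi..pi} (\<lambda>\<theta>.
     \<phi> \<theta> * of_real ((sqrt q * cos \<alpha> - cos \<theta>) * (b * cos s) + (sqrt q * sin \<alpha> - sin \<theta>) * (a * sin s))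
      * cis (k * ((cos \<theta> + sqrt q * cos \<alpha>) * xx s + (sin \<theta> + sqrt q * sin \<alpha>) * yy s))))"

definition J :: "(real \<Rightarrow> complex) \<Rightarrow> (real \<Rightarrow> complex) \<Rightarrow> real \<Rightarrow> real \<Rightarrow> complex" where
  "J n G k \<alpha> = integral {-pi..pi} (\<lambda>s. n s * V G k s * cis (k * ph \<alpha> s))"

abbreviation "nx \<equiv> \<lambda>s. complex_of_real (b * cos s)"
abbreviation "ny \<equiv> \<lambda>s. complex_of_real (a * sin s)"

lemma n_C1_periodic: "C1_periodic nx" "C1_periodic ny"
proof -
  show "C1_periodic nx"
    by (rule C1_periodic_of_real[where g' = "\<lambda>s. - b * sin s"]) (auto intro!: derivative_eq_intros continuous_intros)
  show "C1_periodic ny"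
    by (rule C1_periodic_of_real[where g' = "\<lambda>s. a * cos s"]) (auto intro!: derivative_eq_intros continuous_intros)
qed

lemma J_continuous:
  assumes n: "C1_periodic n" and G: "C1_periodic G"
  shows "continuous_on {u..v} (J n G k)"
proof -
  have nc: "continuous_on A n" for A using C1_periodic_continuous[OF n] continuous_on_subset by blast
  have "continuous_on ({-pi..pi} \<times> {u..v}) (\<lambda>z. n (fst z) * V G k (fst z))"
    by (rule continuous_on_compose2[of "{-pi..pi}" "\<lambda>s. n s * V G k s"]) (auto intro!: continuous_intros nc V_continuous[OF G])
  hence "continuous_on ({-pi..pi} \<times> {u..v}) (\<lambda>(s, \<alpha>). n s * V G k s * cis (k * ph \<alpha> s))"
    by (auto simp: case_prod_beta intro!: continuous_intros)
  from continuous_on_integral_rect[OF this] show ?thesis unfolding J_def .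
qed

text \<open>Pulls the dependence on \<alpha> out of the amplitude, so that \<open>main_term\<close>,
  stated for a fixed amplitude and density, applies to each of four terms.\<close>

lemma H_split:
  assumes \<phi>: "C1_periodic \<phi>"
  shows "H \<phi> k \<alpha> = of_real (sqrt q * cos \<alpha>) * J nx \<phi> k \<alpha> + of_real (sqrt q * sin \<alpha>) * J ny \<phi> k \<alpha>
     - J nx (\<lambda>\<theta>. \<phi> \<theta> * of_real (cos \<theta>)) k \<alpha> - J ny (\<lambda>\<theta>. \<phi> \<theta> * of_real (sin \<theta>)) k \<alpha>"
proof -
  let ?c = "\<lambda>\<theta>. \<phi> \<theta> * complex_of_real (cos \<theta>)" and ?s = "\<lambda>\<theta>. \<phi> \<theta> * complex_of_real (sin \<theta>)"
  note cs = C1_periodic_mult_cos_sin[OF \<phi>]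
  have Vi: "((\<lambda>\<theta>. G \<theta> * cis (k * (cos \<theta> * xx s + sin \<theta> * yy s))) has_integral V G k s) {-pi..pi}" if "C1_periodic G" for G s
    unfolding V_def
    by (intro integrable_integral integrable_continuous_real continuous_intros continuous_on_subset[OF C1_periodic_continuous[OF that]]) auto
  have inner: "integral {-pi..pi} (\<lambda>\<theta>.
     \<phi> \<theta> * of_real ((sqrt q * cos \<alpha> - cos \<theta>) * (b * cos s) + (sqrt q * sin \<alpha> - sin \<theta>) * (a * sin s))
      * cis (k * ((cos \<theta> + sqrt q * cos \<alpha>) * xx s + (sin \<theta> + sqrt q * sin \<alpha>) * yy s)))
    = of_real (sqrt q * cos \<alpha>) * (nx s * V \<phi> k s * cis (k * ph \<alpha> s)) + of_real (sqrt q * sin \<alpha>) * (ny s * V \<phi> k s * cis (k * ph \<alpha> s))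
      - nx s * V ?c k s * cis (k * ph \<alpha> s) - ny s * V ?s k s * cis (k * ph \<alpha> s)" for s
  proof (rule integral_unique)
    have "((\<lambda>\<theta>. (of_real (sqrt q * cos \<alpha>) * nx s * cis (k * ph \<alpha> s)) * (\<phi> \<theta> * cis (k * (cos \<theta> * xx s + sin \<theta> * yy s)))
       + (of_real (sqrt q * sin \<alpha>) * ny s * cis (k * ph \<alpha> s)) * (\<phi> \<theta> * cis (k * (cos \<theta> * xx s + sin \<theta> * yy s)))
       - (nx s * cis (k * ph \<alpha> s)) * (?c \<theta> * cis (k * (cos \<theta> * xx s + sin \<theta> * yy s)))
       - (ny s * cis (k * ph \<alpha> s)) * (?s \<theta> * cis (k * (cos \<theta> * xx s + sin \<theta> * yy s))))
      has_integral (of_real (sqrt q * cos \<alpha>) * nx s * cis (k * ph \<alpha> s)) * V \<phi> k s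
       + (of_real (sqrt q * sin \<alpha>) * ny s * cis (k * ph \<alpha> s)) * V \<phi> k s
       - (nx s * cis (k * ph \<alpha> s)) * V ?c k s - (ny s * cis (k * ph \<alpha> s)) * V ?s k s) {-pi..pi}"
      by (intro has_integral_diff has_integral_add has_integral_mult_right Vi \<phi> cs)
    moreover have "(of_real (sqrt q * cos \<alpha>) * nx s * cis (k * ph \<alpha> s)) * (\<phi> \<theta> * cis (k * (cos \<theta> * xx s + sin \<theta> * yy s)))
       + (of_real (sqrt q * sin \<alpha>) * ny s * cis (k * ph \<alpha> s)) * (\<phi> \<theta> * cis (k * (cos \<theta> * xx s + sin \<theta> * yy s)))
       - (nx s * cis (k * ph \<alpha> s)) * (?c \<theta> * cis (k * (cos \<theta> * xx s + sin \<theta> * yy s)))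
       - (ny s * cis (k * ph \<alpha> s)) * (?s \<theta> * cis (k * (cos \<theta> * xx s + sin \<theta> * yy s)))
      = \<phi> \<theta> * of_real ((sqrt q * cos \<alpha> - cos \<theta>) * (b * cos s) + (sqrt q * sin \<alpha> - sin \<theta>) * (a * sin s))
      * cis (k * ((cos \<theta> + sqrt q * cos \<alpha>) * xx s + (sin \<theta> + sqrt q * sin \<alpha>) * yy s))" for \<theta>
    proof -
      have e: "k * ((cos \<theta> + sqrt q * cos \<alpha>) * xx s + (sin \<theta> + sqrt q * sin \<alpha>) * yy s)
         = k * (cos \<theta> * xx s + sin \<theta> * yy s) + k * ph \<alpha> s"
        by (simp add: ph_def algebra_simps)
      show ?thesis unfolding e cis_mult[symmetric] by (simp add: algebra_simps)
    qed
    ultimately show "((\<lambda>\<theta>.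
     \<phi> \<theta> * of_real ((sqrt q * cos \<alpha> - cos \<theta>) * (b * cos s) + (sqrt q * sin \<alpha> - sin \<theta>) * (a * sin s))
      * cis (k * ((cos \<theta> + sqrt q * cos \<alpha>) * xx s + (sin \<theta> + sqrt q * sin \<alpha>) * yy s)))
    has_integral of_real (sqrt q * cos \<alpha>) * (nx s * V \<phi> k s * cis (k * ph \<alpha> s)) + of_real (sqrt q * sin \<alpha>) * (ny s * V \<phi> k s * cis (k * ph \<alpha> s))
      - nx s * V ?c k s * cis (k * ph \<alpha> s) - ny s * V ?s k s * cis (k * ph \<alpha> s)) {-pi..pi}"
      by (simp only: mult_ac)
  qed
  have Ji: "((\<lambda>s. n s * V G k s * cis (k * ph \<alpha> s)) has_integral J n G k \<alpha>) {-pi..pi}" if "C1_periodic n" "C1_periodic G" for n G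
    unfolding J_def
    by (intro integrable_integral integrable_continuous_real continuous_intros V_continuous that continuous_on_subset[OF C1_periodic_continuous[OF that(1)]]) auto
  show ?thesis unfolding H_def inner
    by (intro integral_unique has_integral_diff has_integral_add has_integral_mult_right Ji n_C1_periodic \<phi> cs)
qed

text \<open>A ray from the origin must leave the ellipse traced by \<open>z1\<close>, which
  surrounds the origin because f < a sqrt q. \<open>h\<close> is the quadratic form of that ellipse
  along the ray, before division by q; it is below q at 0 and the intermediate value theorem finds
  the crossing.\<close>

lemma exists_alpha:
  obtains \<alpha> where "cis (Arg (z1 \<alpha>)) = cis s"
proof -
  define h where "h = (\<lambda>N. ((N * cos s + f) / a)\<^sup>2 + (N * sin s / b)\<^sup>2)"
  \<comment> \<open>At this distance from the origin the point is at least a sqrt q away from the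
    centre, and both semi-axes are at most a sqrt q.\<close>
  define N0 where "N0 = f + a * sqrt q"
  have N0: "N0 > 0" using f_pos a_pos q_pos by (simp add: N0_def add_pos_pos)
  have h0: "h 0 < q" using f_less a_pos by (simp add: h_def power_divide field_simps)
  have hN: "q \<le> h N0"
  proof -
    have ba: "b\<^sup>2 \<le> a\<^sup>2" using abf by simp
    have "(N0 * sin s)\<^sup>2 / a\<^sup>2 \<le> (N0 * sin s)\<^sup>2 / b\<^sup>2"
      using ba a_pos b_pos by (intro divide_left_mono) auto
    moreover have "(N0 - f)\<^sup>2 \<le> (N0 * cos s + f)\<^sup>2 + (N0 * sin s)\<^sup>2"
    proof -
      have "(N0 * cos s + f)\<^sup>2 + (N0 * sin s)\<^sup>2 = N0\<^sup>2 * ((cos s)\<^sup>2 + (sin s)\<^sup>2) + 2 * N0 * f * cos s + f\<^sup>2"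
        by algebra
      also have "\<dots> = N0\<^sup>2 + 2 * N0 * f * cos s + f\<^sup>2" by simp
      finally have e: "(N0 * cos s + f)\<^sup>2 + (N0 * sin s)\<^sup>2 = N0\<^sup>2 + 2 * N0 * f * cos s + f\<^sup>2" .
      have "(2 * N0 * f) * (-1) \<le> (2 * N0 * f) * cos s" using N0 f_pos by (intro mult_left_mono) auto
      thus ?thesis unfolding e power2_diff by linarith
    qed
    hence "(N0 - f)\<^sup>2 / a\<^sup>2 \<le> (N0 * cos s + f)\<^sup>2 / a\<^sup>2 + (N0 * sin s)\<^sup>2 / a\<^sup>2"
      unfolding add_divide_distrib[symmetric] by (intro divide_right_mono) auto
    moreover have "(N0 - f)\<^sup>2 / a\<^sup>2 = q" using a_pos q_pos by (simp add: N0_def power_mult_distrib)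
    ultimately show ?thesis by (simp only: h_def power_divide)
  qed
  have "\<exists>N\<ge>0. N \<le> N0 \<and> h N = q"
    by (rule IVT') (use h0 hN N0 in \<open>auto simp: h_def intro!: continuous_intros\<close>, use a_pos b_pos in auto)
  then obtain N where N: "N \<ge> 0" "h N = q" by blast
  have Np: "N > 0" using N h0 by (cases "N = 0") auto
  define c1 where "c1 = ((N * cos s + f) / a) / sqrt q"
  define s1 where "s1 = (N * sin s / b) / sqrt q"
  have "c1\<^sup>2 + s1\<^sup>2 = h N / q"
    using q_pos unfolding c1_def s1_def h_def power_divide[of _ "sqrt q"] by (simp add: add_divide_distrib)
  hence "c1\<^sup>2 + s1\<^sup>2 = 1" using N q_pos by simp
  then obtain \<alpha> where \<alpha>: "c1 = cos \<alpha>" "s1 = sin \<alpha>" using sincos_total_2pi by metis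
  have "z1 \<alpha> = of_real N * cis s"
    using a_pos b_pos q_pos by (simp add: z1_def complex_eq_iff c1_def s1_def flip: \<alpha>)
  hence "cis (Arg (z1 \<alpha>)) = cis s" using Np by (simp add: cis_Arg sgn_eq norm_mult)
  thus thesis using that by blast
qed

section \<open>Generic directions and the final contradiction\<close>

lemma countable_cos_eq: "countable {x::real. cos x = c}"
proof (cases "\<exists>y. cos y = c")
  case True
  then obtain y where y: "cos y = c" by blast
  have "{x. cos x = c} \<subseteq> (\<Union>n::int. {y + 2 * of_int n * pi, - y + 2 * of_int n * pi})"
    using y cos_eq by (auto elim!: Ints_cases simp: cos_eq)
  thus ?thesis by (rule countable_subset) auto
qed auto

lemma countable_not_generic: "countable {\<alpha>. \<not> generic \<alpha>}"
proof -
  have "{\<alpha>. \<not> generic \<alpha>} \<subseteq> {x. cos x = 1} \<union> {x. cos x = -1} \<union> {x. cos x = 0} \<union> {x. cos x = a / (f * sqrt q)}"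
  proof
    fix \<alpha> assume "\<alpha> \<in> {\<alpha>. \<not> generic \<alpha>}"
    moreover have "cos \<alpha> = 1 \<or> cos \<alpha> = -1" if "sin \<alpha> = 0" using that sin_zero_abs_cos_one by fastforce
    moreover have "cos \<alpha> = a / (f * sqrt q)" if "f * sqrt q * cos \<alpha> = a" using that f_pos q_pos by (simp add: field_simps)
    ultimately show "\<alpha> \<in> {x. cos x = 1} \<union> {x. cos x = -1} \<union> {x. cos x = 0} \<union> {x. cos x = a / (f * sqrt q)}"
      by (auto simp: generic_def)
  qed
  thus ?thesis by (rule countable_subset) (auto intro!: countable_Un countable_cos_eq)
qed

lemma open_generic: "open {\<alpha>. generic \<alpha>}"
  unfolding generic_def by (intro open_Collect_conj open_Collect_neq continuous_intros)

text \<open>The real amplitude factor of \<open>H\<close> at the stationary pair of the first term: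
  eccentric angle \<open>Arg (z1 \<alpha>)\<close> and density direction \<open>th\<close> of
  it.\<close>

definition brk :: "real \<Rightarrow> real" where
  "brk \<alpha> = (let s = Arg (z1 \<alpha>) in (sqrt q * cos \<alpha> - cos (th s)) * (b * cos s) + (sqrt q * sin \<alpha> - sin (th s)) * (a * sin s))"

text \<open>With \<open>\<omega>\<close> the direction of the boundary point and \<open>\<nu>\<close> its normal, \<open>\<surd>q \<eta> + \<omega>\<close> is a multiple of \<open>\<nu>\<close> at the stationary
  point, so \<open>(\<surd>q \<eta> - \<omega>) \<cdot> \<nu>\<close> is a nonzero multiple of \<open>(\<surd>q \<eta> - \<omega>) \<cdot> (\<surd>q \<eta> + \<omega>) = q - 1\<close>.\<close>

lemma brk_nz: "brk \<alpha> \<noteq> 0"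
proof -
  define s where "s = Arg (z1 \<alpha>)"
  define N where "N = cmod (z1 \<alpha>)"
  \<comment> \<open>Read off from the second coordinate: N sin s / b and b sin s / r, each divided
    by a sin s. The first coordinate gives the same factor because b^2 = a^2 - f^2.\<close>
  define \<tau> where "\<tau> = N / (a * b) + b / (a * rr s)"
  have r: "rr s > 0" by (rule rr_pos)
  have "N * cos s = Re (z1 \<alpha>)" "N * sin s = Im (z1 \<alpha>)"
    using rcis_cmod_Arg[of "z1 \<alpha>"] unfolding s_def N_def by (metis Re_rcis, metis Im_rcis)
  hence c: "sqrt q * cos \<alpha> = (N * cos s + f) / a" and sn: "sqrt q * sin \<alpha> = N * sin s / b"
    using a_pos b_pos by (simp_all add: z1_def field_simps)
  have ct: "cos (th s) = (a * cos s - f) / rr s" and st: "sin (th s) = b * sin s / rr s"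
    using cos_th[of s] sin_th[of s] r by (simp_all add: xx_def yy_def field_simps)
  have p1: "sqrt q * cos \<alpha> + cos (th s) = b * cos s * \<tau>"
  proof -
    have "f * rr s + a * (a * cos s - f) = b\<^sup>2 * cos s"
      using abf unfolding rr_def by algebra
    hence "f / a + (a * cos s - f) / rr s = b\<^sup>2 * cos s / (a * rr s)"
      using a_pos r by (simp add: field_simps)
    moreover have "b * cos s * \<tau> = N * cos s / a + b\<^sup>2 * cos s / (a * rr s)"
      using b_pos by (simp add: \<tau>_def distrib_left power2_eq_square mult_ac)
    ultimately show ?thesis unfolding c ct by (simp add: add_divide_distrib)
  qed
  have p2: "sqrt q * sin \<alpha> + sin (th s) = a * sin s * \<tau>"
    unfolding sn st \<tau>_def using a_pos b_pos r by (simp add: distrib_left mult_ac)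
  have "brk \<alpha> * \<tau> = (sqrt q * cos \<alpha> - cos (th s)) * (sqrt q * cos \<alpha> + cos (th s))
       + (sqrt q * sin \<alpha> - sin (th s)) * (sqrt q * sin \<alpha> + sin (th s))"
    unfolding p1 p2 by (simp add: brk_def Let_def s_def[symmetric] algebra_simps)
  also have "\<dots> = (sqrt q)\<^sup>2 * ((cos \<alpha>)\<^sup>2 + (sin \<alpha>)\<^sup>2) - ((cos (th s))\<^sup>2 + (sin (th s))\<^sup>2)"
    by algebra
  also have "\<dots> = q - 1" using q_pos by simp
  finally show ?thesis using q_ne by auto
qed

text \<open>Averaging \<open>H\<close> over a short interval of generic directions, against the
  conjugate phase and a weight, has a limit after multiplication by k. The zeros force it to be 0,
  while the weight is chosen to make it nonzero.\<close>

lemma no_unbounded_zeros: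
  assumes \<phi>: "C1_periodic \<phi>" and nz: "\<phi> \<theta>0 \<noteq> 0"
    and kn: "filterlim kn at_top sequentially"
    and zero: "\<And>n \<alpha>. H \<phi> (kn n) \<alpha> = 0"
  shows False
proof -
  note cs = C1_periodic_mult_cos_sin[OF \<phi>]
  have \<phi>th: "C1_periodic (\<lambda>s. \<phi> (th s))"
  proof -
    obtain th' where th': "\<And>s. (th has_real_derivative th' s) (at s)" "continuous_on UNIV th'" using th_deriv by blast
    show ?thesis by (rule C1_periodic_lift[OF \<phi> th' cis_th_periodic])
  qed
  define F where "F = (\<lambda>\<alpha>. \<phi> (th (Arg (z1 \<alpha>))))"
  have cF: "continuous_on S F" for S
    using continuous_on_Arg_z(1)[OF \<phi>th, of S 0] by (simp add: F_def)
  obtain s0 where s0: "th s0 = \<theta>0" using th_surj by blast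
  obtain \<alpha>0 where "cis (Arg (z1 \<alpha>0)) = cis s0" using exists_alpha by blast
  from periodic_cis_cong[of "\<lambda>s. \<phi> (th s)", OF C1_periodic_per[OF \<phi>th] this]
  have F0: "F \<alpha>0 \<noteq> 0" using nz s0 by (simp add: F_def)
  have "open {\<alpha>. F \<alpha> \<noteq> 0}" using cF by (intro open_Collect_neq continuous_intros) auto
  then obtain e where e: "e > 0" "ball \<alpha>0 e \<subseteq> {\<alpha>. F \<alpha> \<noteq> 0}"
    using F0 openE[of "{\<alpha>. F \<alpha> \<noteq> 0}" \<alpha>0] by auto
  \<comment> \<open>\<open>\<alpha>0\<close> itself may fail to be generic; since the exceptions are
    countable, a generic point with F nonzero lies nearby.\<close>
  have "uncountable (ball \<alpha>0 e)" using e by (simp add: ball_eq_greaterThanLessThan uncountable_open_interval)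
  hence "\<not> ball \<alpha>0 e \<subseteq> {\<alpha>. \<not> generic \<alpha>}" using countable_not_generic countable_subset by blast
  then obtain \<alpha>1 where \<alpha>1: "F \<alpha>1 \<noteq> 0" "generic \<alpha>1" using e by blast
  have "open ({\<alpha>. F \<alpha> \<noteq> 0} \<inter> {\<alpha>. generic \<alpha>})"
    using \<open>open {\<alpha>. F \<alpha> \<noteq> 0}\<close> open_generic by blast
  then obtain d where d: "d > 0" "cball \<alpha>1 d \<subseteq> {\<alpha>. F \<alpha> \<noteq> 0} \<inter> {\<alpha>. generic \<alpha>}"
    using \<alpha>1 open_contains_cball by blast
  \<comment> \<open>The cap 1/2 keeps the interval within length 1, where the kernel bound
    holds.\<close>
  define u where "u = \<alpha>1 - min d (1/2)"
  define v where "v = \<alpha>1 + min d (1/2)"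
  have uv: "u < v" "v - u \<le> 1" using d by (auto simp: u_def v_def)
  have sub: "F \<alpha> \<noteq> 0" "generic \<alpha>" if "\<alpha> \<in> {u..v}" for \<alpha>
  proof -
    have "\<alpha> \<in> cball \<alpha>1 d" using that by (auto simp: u_def v_def dist_real_def min_def split: if_splits)
    thus "F \<alpha> \<noteq> 0" "generic \<alpha>" using d by auto
  qed
  \<comment> \<open>The limit integrand carries the factor F times \<open>brk\<close>; this weight
    completes it to |F|^2 times the square of \<open>brk\<close>, so up to the constant
    \<open>Fres_lim\<close> squared the limit integrand \<open>w\<close> is nonnegative.\<close>
  define g where "g = (\<lambda>\<alpha>. cnj (F \<alpha>) * of_real (brk \<alpha>))"
  \<comment> \<open>\<open>Arg\<close> jumps at its cut, but \<open>brk\<close> contains only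
    cosines and sines of \<open>Arg\<close> and of \<open>th\<close> composed with it, which are
    functions of the direction.\<close>
  have cbrk: "continuous_on S (\<lambda>\<alpha>. complex_of_real (brk \<alpha>))" for S
  proof -
    have id: "C1_periodic (\<lambda>s. of_real 1)" by (rule C1_periodic_of_real[where g' = "\<lambda>_. 0"]) auto
    obtain th' where th': "\<And>s. (th has_real_derivative th' s) (at s)" "continuous_on UNIV th'" using th_deriv by blast
    note A = C1_periodic_mult_cos_sin[OF id]
    note B = C1_periodic_lift[OF A(1) th' cis_th_periodic] C1_periodic_lift[OF A(2) th' cis_th_periodic]
    have c4: "continuous_on S (\<lambda>\<alpha>. complex_of_real (cos (Arg (z1 \<alpha>))))" "continuous_on S (\<lambda>\<alpha>. complex_of_real (sin (Arg (z1 \<alpha>))))"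
      "continuous_on S (\<lambda>\<alpha>. complex_of_real (cos (th (Arg (z1 \<alpha>)))))" "continuous_on S (\<lambda>\<alpha>. complex_of_real (sin (th (Arg (z1 \<alpha>)))))"
      using continuous_on_Arg_z(1)[OF A(1), of S 0] continuous_on_Arg_z(1)[OF A(2), of S 0]
        continuous_on_Arg_z(1)[OF B(1), of S 0] continuous_on_Arg_z(1)[OF B(2), of S 0] by simp_all
    have c2: "continuous_on S (\<lambda>\<alpha>. complex_of_real (cos \<alpha>))" "continuous_on S (\<lambda>\<alpha>. complex_of_real (sin \<alpha>))"
      by (intro continuous_intros)+
    show ?thesis unfolding brk_def Let_def of_real_add of_real_mult of_real_diff
      by (intro continuous_on_add continuous_on_mult continuous_on_diff continuous_on_const c4 c2)
  qed
  have cg: "continuous_on S g" for S unfolding g_def by (intro continuous_intros cF cbrk)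
  define E where "E = (\<lambda>k \<alpha>. cis (- (k * (D1 \<alpha> + cmod (z1 \<alpha>)))))"
  define g1 where "g1 = (\<lambda>\<alpha>. g \<alpha> * of_real (sqrt q * cos \<alpha>))"
  define g2 where "g2 = (\<lambda>\<alpha>. g \<alpha> * of_real (sqrt q * sin \<alpha>))"
  have cg12: "continuous_on S g1" "continuous_on S g2" for S
    unfolding g1_def g2_def by (intro continuous_intros cg)+
  let ?c = "\<lambda>\<theta>. \<phi> \<theta> * complex_of_real (cos \<theta>)" and ?s = "\<lambda>\<theta>. \<phi> \<theta> * complex_of_real (sin \<theta>)"
  define S where "S = (\<lambda>h n G k. of_real k * integral {u..v} (\<lambda>\<alpha>. h \<alpha> * E k \<alpha> * J n G k \<alpha>))"
  define L where "L = (\<lambda>h n G. integral {u..v} (\<lambda>\<alpha>. h \<alpha> * lead1 n G \<alpha>))"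
  have lim: "(S h n G \<longlongrightarrow> L h n G) at_top" if "continuous_on {u..v} h" "C1_periodic n" "C1_periodic G" for h n G
    unfolding S_def L_def E_def J_def by (rule main_term) (use uv sub that in auto)
  have sum0: "S g1 nx \<phi> k + S g2 ny \<phi> k - S g nx ?c k - S g ny ?s k = 0" if "\<And>\<alpha>. H \<phi> k \<alpha> = 0" for k
  proof -
    have cE: "continuous_on {u..v} (E k)" unfolding E_def by (intro continuous_intros D_continuous z_continuous)
    have hi: "((\<lambda>\<alpha>. h \<alpha> * E k \<alpha> * J n G k \<alpha>) has_integral integral {u..v} (\<lambda>\<alpha>. h \<alpha> * E k \<alpha> * J n G k \<alpha>)) {u..v}"
      if "continuous_on {u..v} h" "C1_periodic n" "C1_periodic G" for h n G
      by (intro integrable_integral integrable_continuous_real continuous_intros J_continuous cE that)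
    have "((\<lambda>\<alpha>. g1 \<alpha> * E k \<alpha> * J nx \<phi> k \<alpha> + g2 \<alpha> * E k \<alpha> * J ny \<phi> k \<alpha> - g \<alpha> * E k \<alpha> * J nx ?c k \<alpha> - g \<alpha> * E k \<alpha> * J ny ?s k \<alpha>)
       has_integral integral {u..v} (\<lambda>\<alpha>. g1 \<alpha> * E k \<alpha> * J nx \<phi> k \<alpha>) + integral {u..v} (\<lambda>\<alpha>. g2 \<alpha> * E k \<alpha> * J ny \<phi> k \<alpha>)
         - integral {u..v} (\<lambda>\<alpha>. g \<alpha> * E k \<alpha> * J nx ?c k \<alpha>) - integral {u..v} (\<lambda>\<alpha>. g \<alpha> * E k \<alpha> * J ny ?s k \<alpha>)) {u..v}"
      by (intro has_integral_diff has_integral_add hi cg12 cg n_C1_periodic \<phi> cs)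
    moreover have "g1 \<alpha> * E k \<alpha> * J nx \<phi> k \<alpha> + g2 \<alpha> * E k \<alpha> * J ny \<phi> k \<alpha> - g \<alpha> * E k \<alpha> * J nx ?c k \<alpha> - g \<alpha> * E k \<alpha> * J ny ?s k \<alpha> = 0" for \<alpha>
    proof -
      have "g1 \<alpha> * E k \<alpha> * J nx \<phi> k \<alpha> + g2 \<alpha> * E k \<alpha> * J ny \<phi> k \<alpha> - g \<alpha> * E k \<alpha> * J nx ?c k \<alpha> - g \<alpha> * E k \<alpha> * J ny ?s k \<alpha>
        = g \<alpha> * E k \<alpha> * H \<phi> k \<alpha>"
        unfolding H_split[OF \<phi>] g1_def g2_def by (simp only: distrib_left right_diff_distrib mult_ac)
      thus ?thesis using that by simp
    qed
    ultimately have "integral {u..v} (\<lambda>\<alpha>. g1 \<alpha> * E k \<alpha> * J nx \<phi> k \<alpha>) + integral {u..v} (\<lambda>\<alpha>. g2 \<alpha> * E k \<alpha> * J ny \<phi> k \<alpha>)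
         - integral {u..v} (\<lambda>\<alpha>. g \<alpha> * E k \<alpha> * J nx ?c k \<alpha>) - integral {u..v} (\<lambda>\<alpha>. g \<alpha> * E k \<alpha> * J ny ?s k \<alpha>) = 0"
      by (simp only: has_integral_0_eq)
    thus ?thesis unfolding S_def by (simp only: distrib_left[symmetric] right_diff_distrib[symmetric]) simp
  qed
  have "((\<lambda>k. S g1 nx \<phi> k + S g2 ny \<phi> k - S g nx ?c k - S g ny ?s k) \<longlongrightarrow> L g1 nx \<phi> + L g2 ny \<phi> - L g nx ?c - L g ny ?s) at_top"
    by (intro tendsto_add tendsto_diff lim cg cg12 n_C1_periodic \<phi> cs)
  from filterlim_compose[OF this kn] have "(\<lambda>n. 0 :: complex) \<longlonglongrightarrow> L g1 nx \<phi> + L g2 ny \<phi> - L g nx ?c - L g ny ?s"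
    by (simp only: sum0[OF zero])
  hence L0: "L g1 nx \<phi> + L g2 ny \<phi> - L g nx ?c - L g ny ?s = 0" by (simp add: LIMSEQ_const_iff)
  define w where "w = (\<lambda>\<alpha>. sqrt 8 * sqrt (8 / cmod (z1 \<alpha>)) * (1 / sqrt (rr (Arg (z1 \<alpha>)))) * (cmod (F \<alpha>))\<^sup>2 * (brk \<alpha>)\<^sup>2)"
  have hi: "((\<lambda>\<alpha>. h \<alpha> * lead1 n G \<alpha>) has_integral L h n G) {u..v}"
      if "continuous_on {u..v} h" "C1_periodic n" "C1_periodic G" for h n G
    unfolding L_def by (intro integrable_integral integrable_continuous_real continuous_intros lead1_continuous that)
  have "((\<lambda>\<alpha>. g1 \<alpha> * lead1 nx \<phi> \<alpha> + g2 \<alpha> * lead1 ny \<phi> \<alpha> - g \<alpha> * lead1 nx ?c \<alpha> - g \<alpha> * lead1 ny ?s \<alpha>)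
      has_integral L g1 nx \<phi> + L g2 ny \<phi> - L g nx ?c - L g ny ?s) {u..v}"
    by (intro has_integral_diff has_integral_add hi cg12 cg n_C1_periodic \<phi> cs)
  moreover have "g1 \<alpha> * lead1 nx \<phi> \<alpha> + g2 \<alpha> * lead1 ny \<phi> \<alpha> - g \<alpha> * lead1 nx ?c \<alpha> - g \<alpha> * lead1 ny ?s \<alpha>
     = (Fres_lim * Fres_lim) * of_real (w \<alpha>)" for \<alpha>
  proof -
    define W where "W = complex_of_real (sqrt 8) * of_real (sqrt (8 / cmod (z1 \<alpha>))) * of_real (1 / sqrt (rr (Arg (z1 \<alpha>))))"
    have "g1 \<alpha> * lead1 nx \<phi> \<alpha> + g2 \<alpha> * lead1 ny \<phi> \<alpha> - g \<alpha> * lead1 nx ?c \<alpha> - g \<alpha> * lead1 ny ?s \<alpha>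
      = (Fres_lim * Fres_lim) * (W * (F \<alpha> * cnj (F \<alpha>)) * (of_real (brk \<alpha>) * of_real (brk \<alpha>)))"
      unfolding g1_def g2_def g_def lead1_def amp_def add_0_right W_def F_def brk_def Let_def of_real_add of_real_mult of_real_diff
      by (simp only: distrib_left distrib_right left_diff_distrib right_diff_distrib mult_ac) simp
    also have "F \<alpha> * cnj (F \<alpha>) = of_real ((cmod (F \<alpha>))\<^sup>2)" by (simp only: complex_norm_square)
    finally show ?thesis by (simp only: W_def w_def of_real_mult power2_eq_square[of "brk \<alpha>"])
  qed
  ultimately have "((\<lambda>\<alpha>. (Fres_lim * Fres_lim) * of_real (w \<alpha>)) has_integral 0) {u..v}" by (simp only: L0)
  hence "((\<lambda>\<alpha>. inverse (Fres_lim * Fres_lim) * ((Fres_lim * Fres_lim) * of_real (w \<alpha>))) has_integral inverse (Fres_lim * Fres_lim) * 0) {u..v}"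
    by (rule has_integral_mult_right)
  hence "((\<lambda>\<alpha>. complex_of_real (w \<alpha>)) has_integral 0) {u..v}"
    using Fres_lim_nonzero by (simp add: field_simps)
  from has_integral_Re[OF this] have w0: "(w has_integral 0) {u..v}" by simp
  have cw: "continuous_on {u..v} w"
  proof -
    have "continuous_on {u..v} (\<lambda>\<alpha>. complex_of_real (1 / sqrt (rr (Arg (z1 \<alpha>)))))"
      using continuous_on_Arg_z(1)[OF C1_periodic_inv_sqrt_rr, of "{u..v}" 0] by simp
    from continuous_on_Re[OF this] have 1: "continuous_on {u..v} (\<lambda>\<alpha>. 1 / sqrt (rr (Arg (z1 \<alpha>))))" by simp
    from continuous_on_Re[OF cbrk[of "{u..v}"]] have 2: "continuous_on {u..v} brk" by simp
    show ?thesis unfolding w_def using z1_nz by (intro continuous_intros 1 2 cF z_continuous) auto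
  qed
  have "w u = 0"
    by (rule has_integral_0_cbox_imp_0[of u v w]) (use cw w0 uv rr_pos in \<open>auto simp: w_def less_imp_le\<close>)
  moreover have "w u > 0"
    unfolding w_def using sub[of u] uv z1_nz rr_pos brk_nz by (intro mult_pos_pos) auto
  ultimately show False by simp
qed

end

section \<open>The Fourier transform of the ellipse\<close>

text \<open>Transfers plane integrals to the product type, where Fubini's theorem is available; the
  two measures agree on boxes.\<close>

lemma lborel_vec2: "lborel = distr (lborel :: (real \<times> real) measure) borel (\<lambda>z. vector [fst z, snd z] :: real^2)"
proof (rule lborel_eqI)
  have m: "(\<lambda>z. vector [fst z, snd z] :: real^2) \<in> borel_measurable (borel :: (real \<times> real) measure)"
  proof (rule borel_measurable_continuous_onI)
    have "(\<lambda>z. vector [fst z, snd z] :: real^2) = (\<lambda>z. fst z *\<^sub>R axis 1 1 + snd z *\<^sub>R axis 2 1)"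
      by (auto simp: fun_eq_iff vec_eq_iff forall_2 axis_def)
    thus "continuous_on UNIV (\<lambda>z. vector [fst z, snd z] :: real^2)" by (simp only:) (intro continuous_intros)
  qed
  fix l u :: "real^2"
  assume lu: "\<And>b. b \<in> Basis \<Longrightarrow> l \<bullet> b \<le> u \<bullet> b"
  have le: "l $ 1 \<le> u $ 1" "l $ 2 \<le> u $ 2"
    using lu[of "axis 1 1"] lu[of "axis 2 1"] by (simp_all add: inner_axis axis_in_Basis_iff)
  have "(\<lambda>z. vector [fst z, snd z] :: real^2) -` box l u \<inter> space lborel = box (l $ 1, l $ 2) (u $ 1, u $ 2)"
  proof -
    have "z \<in> box (l $ 1, l $ 2) (u $ 1, u $ 2) \<longleftrightarrow> l $ 1 < fst z \<and> fst z < u $ 1 \<and> l $ 2 < snd z \<and> snd z < u $ 2" for z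
      by (auto simp: mem_box Basis_prod_def inner_prod_def)
    thus ?thesis by (auto simp: mem_box_cart forall_2)
  qed
  hence "emeasure (distr lborel borel (\<lambda>z. vector [fst z, snd z] :: real^2)) (box l u) = emeasure lborel (box (l $ 1, l $ 2) (u $ 1, u $ 2))"
    using m by (subst emeasure_distr) auto
  also have "\<dots> = ennreal ((u $ 1 - l $ 1) * (u $ 2 - l $ 2))"
    using le by (subst emeasure_lborel_box) (auto simp: Basis_prod_def inner_Pair_0 prod.union_disjoint)
  also have "\<dots> = (\<Prod>b\<in>Basis. (u - l) \<bullet> b)"
  proof -
    have B: "(Basis :: (real^2) set) = {axis 1 1, axis 2 1}" by (auto simp: Basis_vec_def UNIV_2)
    have ne: "axis 1 (1::real) \<noteq> (axis 2 1 :: real^2)" by (simp add: axis_eq_axis)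
    show ?thesis unfolding B using ne by (simp add: inner_axis)
  qed
  finally show "emeasure (distr lborel borel (\<lambda>z. vector [fst z, snd z] :: real^2)) (box l u) = (\<Prod>b\<in>Basis. (u - l) \<bullet> b)" .
qed auto

text \<open>The affine change of variables, stated as an identity of measures so that it can be
  rewritten under any integral. On a box it reduces to the volume of a linear image.\<close>

lemma lborel_affine_linear:
  fixes g :: "real^2 \<Rightarrow> real^2" and c :: "real^2"
  assumes g: "linear g" "det (matrix g) \<noteq> 0"
  shows "lborel = density (distr lborel borel (\<lambda>y. c + g y)) (\<lambda>_. ennreal \<bar>det (matrix g)\<bar>)"
proof (rule lborel_eqI)
  have gm: "(\<lambda>y. c + g y) \<in> borel_measurable borel"
    by (intro borel_measurable_continuous_onI continuous_intros linear_continuous_on linear_conv_bounded_linear[THEN iffD1] g)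
  fix l u :: "real^2"
  assume lu: "\<And>b. b \<in> Basis \<Longrightarrow> l \<bullet> b \<le> u \<bullet> b"
  have "inj g" using g(2) det_nz_iff_inj[OF g(1)] by simp
  from linear_injective_isomorphism[OF g(1) this]
  obtain h where "linear h \<and> (\<forall>x. h (g x) = x) \<and> (\<forall>x. g (h x) = x)" by auto
  hence h: "linear h" "\<And>x. h (g x) = x" "\<And>x. g (h x) = x" by simp_all
  define P where "P = h ` box (l - c) (u - c)"
  have P: "P \<in> lmeasurable" unfolding P_def by (intro measurable_linear_image h) auto
  have gP: "g ` P = box (l - c) (u - c)" by (simp add: P_def image_image h)
  have "(\<lambda>y. c + g y) -` box l u = P"
  proof -
    have "c + g y \<in> box l u \<longleftrightarrow> g y \<in> box (l - c) (u - c)" for y by (auto simp: mem_box inner_diff_left inner_add_left algebra_simps)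
    moreover have "g y \<in> box (l - c) (u - c) \<longleftrightarrow> y \<in> P" for y
    proof
      assume "g y \<in> box (l - c) (u - c)"
      hence "h (g y) \<in> P" unfolding P_def by (rule imageI)
      thus "y \<in> P" by (simp only: h(2))
    qed (auto simp: P_def h(3))
    ultimately show ?thesis by auto
  qed
  hence "emeasure (density (distr lborel borel (\<lambda>y. c + g y)) (\<lambda>_. ennreal \<bar>det (matrix g)\<bar>)) (box l u)
      = ennreal \<bar>det (matrix g)\<bar> * emeasure lborel P"
    using gm by (subst emeasure_density) (auto simp: nn_integral_cmult emeasure_distr nn_integral_distr)
  also have "emeasure lborel P = ennreal (measure lebesgue P)"
  proof -
    have "P \<in> sets borel"
      using measurable_sets[OF gm, of "box l u"] \<open>(\<lambda>y. c + g y) -` box l u = P\<close> by simp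
    hence "emeasure lborel P = emeasure lebesgue P" by simp
    thus ?thesis using P by (simp add: emeasure_eq_measure2 fmeasurableD2)
  qed
  also have "ennreal \<bar>det (matrix g)\<bar> * \<dots> = ennreal (measure lebesgue (g ` P))"
    using measure_linear_image[OF g(1) P] by (simp add: ennreal_mult)
  also have "\<dots> = (\<Prod>b\<in>Basis. (u - l) \<bullet> b)"
    unfolding gP using lu by (simp add: measure_lborel_box_eq inner_diff_left)
  finally show "emeasure (density (distr lborel borel (\<lambda>y. c + g y)) (\<lambda>_. ennreal \<bar>det (matrix g)\<bar>)) (box l u) = (\<Prod>b\<in>Basis. (u - l) \<bullet> b)" .
qed simp

text \<open>The Fourier transform of the unit disc at frequency (P, Q).\<close>

definition disc_int :: "real \<Rightarrow> real \<Rightarrow> complex" where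
  "disc_int P Q = (LINT z|lborel. indicator {z :: real \<times> real. (fst z)\<^sup>2 + (snd z)\<^sup>2 < 1} z *\<^sub>R cis (P * fst z + Q * snd z))"

lemma disc_integrable:
  "integrable lborel (\<lambda>z. indicator {z :: real \<times> real. (fst z)\<^sup>2 + (snd z)\<^sup>2 < 1} z *\<^sub>R cis (P * fst z + Q * snd z))"
proof -
  have "integrable lborel (\<lambda>z. indicator (cbox (-1,-1) (1,1)) z *\<^sub>R cis (P * fst z + Q * snd z))"
    by (rule borel_integrable_compact) (auto intro!: continuous_intros)
  moreover have "{z :: real \<times> real. (fst z)\<^sup>2 + (snd z)\<^sup>2 < 1} \<in> sets lborel"
    by (auto intro!: borel_open open_Collect_less continuous_intros)
  moreover have "{z :: real \<times> real. (fst z)\<^sup>2 + (snd z)\<^sup>2 < 1} \<subseteq> cbox (-1,-1) (1,1)"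
  proof
    fix z :: "real \<times> real" assume "z \<in> {z. (fst z)\<^sup>2 + (snd z)\<^sup>2 < 1}"
    hence "(fst z)\<^sup>2 + (snd z)\<^sup>2 < 1" by simp
    hence "(fst z)\<^sup>2 \<le> 1" "(snd z)\<^sup>2 \<le> 1" using zero_le_power2[of "fst z"] zero_le_power2[of "snd z"] by linarith+
    hence "\<bar>fst z\<bar> \<le> 1" "\<bar>snd z\<bar> \<le> 1" by (simp_all add: abs_square_le_1)
    thus "z \<in> cbox (-1,-1) (1,1)" by (cases z) (auto simp: cbox_Pair_eq abs_le_iff)
  qed
  ultimately have "set_integrable lborel {z :: real \<times> real. (fst z)\<^sup>2 + (snd z)\<^sup>2 < 1} (\<lambda>z. cis (P * fst z + Q * snd z))"
    using set_integrable_subset[of lborel "cbox (-1,-1) (1,1)" "\<lambda>z. cis (P * fst z + Q * snd z)"]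
    by (simp add: set_integrable_def)
  thus ?thesis by (simp add: set_integrable_def)
qed

lemma LINT_Ioo:
  fixes F :: "real \<Rightarrow> complex"
  assumes "continuous_on {u..v} F"
  shows "(LINT x|lborel. indicator {u<..<v} x *\<^sub>R F x) = integral {u..v} F"
proof -
  have "set_integrable lborel {u..v} F" unfolding set_integrable_def
    by (rule borel_integrable_compact[OF _ assms]) auto
  hence "set_integrable lborel {u<..<v} F" by (rule set_integrable_subset) auto
  from set_borel_integral_eq_integral[OF this]
  have "F integrable_on {u<..<v}" "(LINT x:{u<..<v}|lborel. F x) = integral {u<..<v} F" by auto
  moreover have "integral {u<..<v} F = integral {u..v} F"
    by (rule integral_unique)
       (use integrable_continuous_real[OF assms] in \<open>simp add: has_integral_Icc_iff_Ioo[symmetric] integrable_integral\<close>)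
  ultimately show ?thesis by (simp add: set_lebesgue_integral_def)
qed

lemma has_integral_cis_linear:
  assumes "u \<le> v"
  shows "((\<lambda>x. \<i> * of_real P * cis (P * x + Q)) has_integral cis (P * v + Q) - cis (P * u + Q)) {u..v}"
proof (rule fundamental_theorem_of_calculus[OF assms])
  fix x
  have "((\<lambda>x. P * x + Q) has_real_derivative P) (at x within {u..v})" by (auto intro!: derivative_eq_intros)
  from has_vector_derivative_cis[OF this]
  show "((\<lambda>x. cis (P * x + Q)) has_vector_derivative \<i> * of_real P * cis (P * x + Q)) (at x within {u..v})"
    by (simp add: scaleR_conv_of_real mult_ac)
qed

text \<open>The fundamental theorem of calculus along one horizontal chord. Multiplying by i P
  instead of dividing keeps the case P = 0 included.\<close>

lemma slice_integral:
  "\<i> * of_real P * (LINT x|lborel. indicator {x. x\<^sup>2 + y\<^sup>2 < 1} x *\<^sub>R cis (P * x + Q))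
     = indicator {-1<..<1} y *\<^sub>R (cis (P * sqrt (1 - y\<^sup>2) + Q) - cis (- P * sqrt (1 - y\<^sup>2) + Q))"
proof (cases "y \<in> {-1<..<1}")
  case True
  define r where "r = sqrt (1 - y\<^sup>2)"
  have y: "y\<^sup>2 < 1" using True by (simp add: abs_square_less_1 abs_less_iff)
  have r: "r > 0" "r\<^sup>2 = 1 - y\<^sup>2" using y by (simp_all add: r_def)
  have "x\<^sup>2 + y\<^sup>2 < 1 \<longleftrightarrow> x \<in> {-r<..<r}" for x
  proof -
    have "x\<^sup>2 + y\<^sup>2 < 1 \<longleftrightarrow> x\<^sup>2 < r\<^sup>2" unfolding r(2) by auto
    also have "\<dots> \<longleftrightarrow> \<bar>x\<bar> < \<bar>r\<bar>" using abs_le_square_iff[of r x] by (simp only: not_le[symmetric])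
    finally show ?thesis using r by auto
  qed
  hence S: "{x. x\<^sup>2 + y\<^sup>2 < 1} = {-r<..<r}" by blast
  have "(LINT x|lborel. indicator {x. x\<^sup>2 + y\<^sup>2 < 1} x *\<^sub>R cis (P * x + Q)) = integral {-r..r} (\<lambda>x. cis (P * x + Q))"
    unfolding S by (rule LINT_Ioo) (intro continuous_intros)
  moreover have "\<i> * of_real P * integral {-r..r} (\<lambda>x. cis (P * x + Q)) = integral {-r..r} (\<lambda>x. \<i> * of_real P * cis (P * x + Q))"
    by simp
  moreover have "integral {-r..r} (\<lambda>x. \<i> * of_real P * cis (P * x + Q)) = cis (P * r + Q) - cis (P * (-r) + Q)"
    using r by (intro integral_unique has_integral_cis_linear) auto
  ultimately show ?thesis using True by (simp add: r_def)
next
  case False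
  hence "\<not> y\<^sup>2 < 1" by (auto simp: abs_square_less_1 abs_less_iff)
  hence "{x::real. x\<^sup>2 + y\<^sup>2 < 1} = {}" using zero_le_power2 by (auto simp: not_less) (smt (verit) zero_le_power2)
  thus ?thesis using False by simp
qed

text \<open>With y = sin s the first term is the right half of the circle. The second becomes the
  left half under s -> pi - s, where cos changes sign and so accounts for the minus sign.\<close>

lemma boundary_param:
  "integral {-1..1} (\<lambda>y. cis (P * sqrt (1 - y\<^sup>2) + Q * y) - cis (- P * sqrt (1 - y\<^sup>2) + Q * y))
     = integral {-pi..pi} (\<lambda>s. of_real (cos s) * cis (P * cos s + Q * sin s))"
proof -
  define F where "F = (\<lambda>P y. cis (P * sqrt (1 - y\<^sup>2) + Q * y))"
  define h where "h = (\<lambda>s. of_real (cos s) * cis (P * cos s + Q * sin s))"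
  have cF: "continuous_on A (F P)" for A P unfolding F_def by (intro continuous_intros)
  have ch: "continuous_on A h" for A unfolding h_def by (intro continuous_intros)
  have sub: "((\<lambda>s. of_real (cos s) * cis (P * cos s + Q * sin s)) has_integral integral {-1..1} (F P)) {-(pi/2)..pi/2}" for P
  proof -
    have "((\<lambda>s. cos s *\<^sub>R F P (sin s)) has_integral integral {sin (-(pi/2))..sin (pi/2)} (F P)) {-(pi/2)..pi/2}"
      by (rule has_integral_substitution[where c = "-1" and d = 1])
         (auto intro!: derivative_eq_intros cF)
    hence "((\<lambda>s. cos s *\<^sub>R F P (sin s)) has_integral integral {-1..1} (F P)) {-(pi/2)..pi/2}" by simp
    thus ?thesis
    proof (rule has_integral_eq[rotated])
      fix s assume s: "s \<in> {-(pi/2)..pi/2}"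
      have "sqrt (1 - (sin s)\<^sup>2) = cos s" using s by (simp add: cos_squared_eq[symmetric] cos_ge_zero)
      thus "cos s *\<^sub>R F P (sin s) = of_real (cos s) * cis (P * cos s + Q * sin s)" by (simp add: F_def scaleR_conv_of_real)
    qed
  qed
  have 1: "integral {-1..1} (F P) = integral {-(pi/2)..pi/2} h" using integral_unique[OF sub[of P]] by (simp add: h_def)
  have "(((\<lambda>s. of_real (cos s) * cis (- P * cos s + Q * sin s)) \<circ> (\<lambda>s. (-1) *\<^sub>R s + pi)) has_integral integral {-1..1} (F (-P))) {pi/2..3*pi/2}"
    using has_integral_affinity[OF sub[of "-P", unfolded cbox_interval[symmetric]], of "-1" pi] by (simp add: o_def add.commute)
  hence "((\<lambda>s. - h s) has_integral integral {-1..1} (F (-P))) {pi/2..3*pi/2}"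
    by (rule has_integral_eq[rotated]) (simp add: o_def h_def cos_add sin_add add.commute)
  from has_integral_neg[OF this] have 2: "integral {pi/2..3*pi/2} h = - integral {-1..1} (F (-P))" by (simp add: integral_unique)
  have "integral {-1..1} (\<lambda>y. F P y - F (-P) y) = integral {-1..1} (F P) - integral {-1..1} (F (-P))"
    by (intro integral_diff integrable_continuous_real cF)
  also have "\<dots> = integral {-(pi/2)..pi/2} h + integral {pi/2..3*pi/2} h" using 1 2 by simp
  also have "\<dots> = integral {-(pi/2)..3*pi/2} h"
    by (intro Henstock_Kurzweil_Integration.integral_combine integrable_continuous_real ch) auto
  also have "\<dots> = integral {-pi..pi} (\<lambda>s. h (s + pi/2))"
  proof -
    have "(h has_integral integral {-(pi/2)..3*pi/2} h) (cbox (-(pi/2)) (3*pi/2))"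
      using integrable_integral[OF integrable_continuous_real[OF ch]] by simp
    from has_integral_affinity[OF this, of 1 "pi/2"]
    have "((\<lambda>s. h (s + pi/2)) has_integral integral {-(pi/2)..3*pi/2} h) ((\<lambda>x. x - pi/2) ` {-(pi/2)..3*pi/2})" by simp
    moreover have "(\<lambda>x. x - pi/2) ` {-(pi/2)..3*pi/2} = {-pi..pi}"
    proof -
      have "-(pi/2) - pi/2 = - pi" "3*pi/2 - pi/2 = pi" by simp_all
      thus ?thesis using image_add_atLeastAtMost'[of "- (pi/2)" "-(pi/2)" "3*pi/2"] by simp
    qed
    ultimately have "((\<lambda>s. h (s + pi/2)) has_integral integral {-(pi/2)..3*pi/2} h) {-pi..pi}" by simp
    thus ?thesis by (simp add: integral_unique)
  qed
  also have "\<dots> = integral {-pi..pi} h"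
    by (rule integral_periodic_shift[OF ch]) (simp add: h_def)
  finally show ?thesis by (simp add: F_def h_def)
qed

text \<open>The divergence theorem on the disc for the field (exponential, 0), obtained by Fubini
  and chord-wise integration.\<close>

lemma disc_int_x: "\<i> * of_real P * disc_int P Q = integral {-pi..pi} (\<lambda>s. of_real (cos s) * cis (P * cos s + Q * sin s))"
proof -
  let ?G = "\<lambda>x y. indicator {z :: real \<times> real. (fst z)\<^sup>2 + (snd z)\<^sup>2 < 1} (x, y) *\<^sub>R cis (P * x + Q * y)"
  have int: "integrable (lborel \<Otimes>\<^sub>M lborel) (\<lambda>(x, y). ?G x y)"
    using disc_integrable[of P Q] unfolding lborel_prod by (simp add: case_prod_unfold)
  have "disc_int P Q = (LINT y|lborel. (LINT x|lborel. ?G x y))"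
    using lborel_pair.integral_snd[OF int] unfolding lborel_prod by (simp add: disc_int_def case_prod_unfold)
  hence "\<i> * of_real P * disc_int P Q = (LINT y|lborel. \<i> * of_real P * (LINT x|lborel. ?G x y))" by simp
  also have "\<dots> = (LINT y|lborel. indicator {-1<..<1} y *\<^sub>R (cis (P * sqrt (1 - y\<^sup>2) + Q * y) - cis (- P * sqrt (1 - y\<^sup>2) + Q * y)))"
  proof (rule Bochner_Integration.integral_cong[OF refl])
    fix y
    have "(LINT x|lborel. ?G x y) = (LINT x|lborel. indicator {x. x\<^sup>2 + y\<^sup>2 < 1} x *\<^sub>R cis (P * x + Q * y))"
      by (intro Bochner_Integration.integral_cong refl) (simp add: indicator_def)
    thus "\<i> * of_real P * (LINT x|lborel. ?G x y) = indicator {-1<..<1} y *\<^sub>R (cis (P * sqrt (1 - y\<^sup>2) + Q * y) - cis (- P * sqrt (1 - y\<^sup>2) + Q * y))"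
      by (simp only: slice_integral)
  qed
  also have "\<dots> = integral {-1..1} (\<lambda>y. cis (P * sqrt (1 - y\<^sup>2) + Q * y) - cis (- P * sqrt (1 - y\<^sup>2) + Q * y))"
    by (rule LINT_Ioo) (intro continuous_intros)
  finally show ?thesis by (simp only: boundary_param)
qed

lemma disc_int_swap: "disc_int P Q = disc_int Q P"
proof -
  have int: "integrable (lborel \<Otimes>\<^sub>M lborel) (\<lambda>(x, y). indicator {z :: real \<times> real. (fst z)\<^sup>2 + (snd z)\<^sup>2 < 1} (x, y) *\<^sub>R cis (P * x + Q * y))" for P Q
    using disc_integrable[of P Q] unfolding lborel_prod by (simp add: case_prod_unfold)
  have "disc_int P Q = (LINT y|lborel. (LINT x|lborel. indicator {z :: real \<times> real. (fst z)\<^sup>2 + (snd z)\<^sup>2 < 1} (x, y) *\<^sub>R cis (P * x + Q * y)))"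
    using lborel_pair.integral_snd[OF int] unfolding lborel_prod by (simp add: disc_int_def case_prod_unfold)
  also have "\<dots> = (LINT y|lborel. (LINT x|lborel. indicator {z :: real \<times> real. (fst z)\<^sup>2 + (snd z)\<^sup>2 < 1} (y, x) *\<^sub>R cis (Q * y + P * x)))"
    by (simp add: indicator_def add.commute)
  also have "\<dots> = disc_int Q P"
    using lborel_pair.integral_fst[OF int] unfolding lborel_prod by (simp add: disc_int_def case_prod_unfold)
  finally show ?thesis .
qed

text \<open>Follows from \<open>disc_int_x\<close> by exchanging the coordinates, which on the
  circle is s -> pi/2 - s.\<close>

lemma disc_int_y: "\<i> * of_real Q * disc_int P Q = integral {-pi..pi} (\<lambda>s. of_real (sin s) * cis (P * cos s + Q * sin s))"
proof -
  define h where "h = (\<lambda>s. of_real (sin s) * cis (P * cos s + Q * sin s))"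
  have ch: "continuous_on A h" for A unfolding h_def by (intro continuous_intros)
  have "integral {-pi..pi} h = integral {-pi..pi} (\<lambda>s. h (s + pi/2))"
    by (rule integral_periodic_shift[OF ch, symmetric]) (simp add: h_def)
  also have "\<dots> = integral {-pi..pi} (\<lambda>s. h (pi/2 - s))"
    using Henstock_Kurzweil_Integration.integral_reflect_real[of pi "-pi" "\<lambda>s. h (s + pi/2)"] by (simp add: add.commute)
  also have "\<dots> = integral {-pi..pi} (\<lambda>s. of_real (cos s) * cis (Q * cos s + P * sin s))"
    by (simp add: h_def cos_diff sin_diff add.commute)
  also have "\<dots> = \<i> * of_real Q * disc_int Q P" by (rule disc_int_x[symmetric])
  finally show ?thesis by (simp add: h_def disc_int_swap[of P Q])
qed

text \<open>The affine image of the disc: a b is the Jacobian, and the factor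
  \<open>cis (- p1 * f)\<close> comes from the centre, which has coordinates (-f, 0) along the
  axes.\<close>

lemma ellipse_integral:
  fixes c :: "real^2"
  assumes ab: "0 < a" "0 < b" and c: "c = (- f) *\<^sub>R vector [cos t, sin t]"
  shows "(LINT x:ellipse_region c t a b|lborel. cis (p1 * (cos t * x$1 + sin t * x$2) + p2 * (- sin t * x$1 + cos t * x$2)))
     = of_real (a * b) * cis (- p1 * f) * disc_int (p1 * a) (p2 * b)"
proof -
  define g where "g = (\<lambda>y::real^2. vector [a * y$1 * cos t - b * y$2 * sin t, a * y$1 * sin t + b * y$2 * cos t] :: real^2)"
  have lin: "linear g"
    by (rule linearI) (simp_all add: g_def vec_eq_iff forall_2 algebra_simps)
  have "det (matrix g) = a * b"
  proof -
    have "det (matrix g) = a * cos t * (b * cos t) + b * sin t * (a * sin t)"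
      by (simp add: det_2 matrix_def g_def axis_def)
    also have "\<dots> = a * b * ((cos t)\<^sup>2 + (sin t)\<^sup>2)" by algebra
    finally show ?thesis by simp
  qed
  hence det: "det (matrix g) \<noteq> 0" "\<bar>det (matrix g)\<bar> = a * b" using ab by auto
  define F where "F = (\<lambda>x. indicator (ellipse_region c t a b) x *\<^sub>R cis (p1 * (cos t * x$1 + sin t * x$2) + p2 * (- sin t * x$1 + cos t * x$2)))"
  have op: "ellipse_region c t a b \<in> sets borel"
    unfolding ellipse_region_def by (intro borel_open open_Collect_less continuous_intros) (use ab in auto)
  have mF: "F \<in> borel_measurable borel"
    unfolding F_def using op
    by (intro borel_measurable_scaleR borel_measurable_indicator borel_measurable_continuous_onI continuous_intros) auto
  have mg: "(\<lambda>y. c + g y) \<in> borel_measurable borel"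
    by (intro borel_measurable_continuous_onI continuous_intros linear_continuous_on linear_conv_bounded_linear[THEN iffD1] lin)
  have mv: "(\<lambda>z. vector [fst z, snd z] :: real^2) \<in> borel_measurable (borel :: (real \<times> real) measure)"
  proof (rule borel_measurable_continuous_onI)
    have "(\<lambda>z. vector [fst z, snd z] :: real^2) = (\<lambda>z. fst z *\<^sub>R axis 1 1 + snd z *\<^sub>R axis 2 1)"
      by (auto simp: fun_eq_iff vec_eq_iff forall_2 axis_def)
    thus "continuous_on UNIV (\<lambda>z. vector [fst z, snd z] :: real^2)" by (simp only:) (intro continuous_intros)
  qed
  have mFg: "(\<lambda>y. F (c + g y)) \<in> borel_measurable borel" by (rule measurable_compose[OF mg mF])
  have "(LINT x|lborel. F x) = (LINT x|density (distr lborel borel (\<lambda>y. c + g y)) (\<lambda>_. ennreal (a * b)). F x)"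
    using lborel_affine_linear[OF lin det(1), of c] unfolding det(2) by simp
  also have "\<dots> = (LINT x|distr lborel borel (\<lambda>y. c + g y). (a * b) *\<^sub>R F x)"
    using ab mF by (subst integral_density) auto
  also have "\<dots> = (a * b) *\<^sub>R (LINT y|lborel. F (c + g y))"
    using mF mg by (subst integral_distr) auto
  also have "(LINT y|lborel. F (c + g y)) = (LINT y|distr lborel borel (\<lambda>z. vector [fst z, snd z] :: real^2). F (c + g y))"
    using lborel_vec2 by simp
  also have "\<dots> = (LINT z|(lborel :: (real \<times> real) measure). F (c + g (vector [fst z, snd z])))"
    using mFg mv by (subst integral_distr) auto
  also have "\<dots> = (LINT z|(lborel :: (real \<times> real) measure). cis (- p1 * f) * (indicator {z :: real \<times> real. (fst z)\<^sup>2 + (snd z)\<^sup>2 < 1} z *\<^sub>R cis (p1 * a * fst z + p2 * b * snd z)))"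
  proof (rule Bochner_Integration.integral_cong[OF refl])
    fix z :: "real \<times> real"
    define x where "x = c + g (vector [fst z, snd z])"
    have sc: "(sin t)\<^sup>2 = 1 - (cos t)\<^sup>2" by (simp add: sin_squared_eq)
    have x1: "x $ 1 - c $ 1 = a * fst z * cos t - b * snd z * sin t" and x2: "x $ 2 - c $ 2 = a * fst z * sin t + b * snd z * cos t"
      by (simp_all add: x_def g_def)
    have u1: "cos t * (x $ 1 - c $ 1) + sin t * (x $ 2 - c $ 2) = a * fst z"
    proof -
      have "cos t * (x $ 1 - c $ 1) + sin t * (x $ 2 - c $ 2) = a * fst z * ((cos t)\<^sup>2 + (sin t)\<^sup>2)" unfolding x1 x2 by algebra
      thus ?thesis by simp
    qed
    have u2: "- sin t * (x $ 1 - c $ 1) + cos t * (x $ 2 - c $ 2) = b * snd z"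
    proof -
      have "- sin t * (x $ 1 - c $ 1) + cos t * (x $ 2 - c $ 2) = b * snd z * ((cos t)\<^sup>2 + (sin t)\<^sup>2)" unfolding x1 x2 by algebra
      thus ?thesis by simp
    qed
    have mem: "x \<in> ellipse_region c t a b \<longleftrightarrow> (fst z)\<^sup>2 + (snd z)\<^sup>2 < 1"
      unfolding ellipse_region_def mem_Collect_eq u1 u2 using ab by simp
    have v1: "cos t * c $ 1 + sin t * c $ 2 = - f"
    proof -
      have "cos t * c $ 1 + sin t * c $ 2 = - f * ((cos t)\<^sup>2 + (sin t)\<^sup>2)" unfolding c by (simp add: power2_eq_square algebra_simps del: sin_cos_squared_add sin_cos_squared_add2 sin_cos_squared_add3)
      thus ?thesis by simp
    qed
    have v2: "- sin t * c $ 1 + cos t * c $ 2 = 0" unfolding c by simp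
    have e: "p1 * (cos t * x$1 + sin t * x$2) + p2 * (- sin t * x$1 + cos t * x$2) = - p1 * f + (p1 * a * fst z + p2 * b * snd z)"
    proof -
      have "cos t * x$1 + sin t * x$2 = a * fst z + (- f)" using u1 v1 by (simp add: algebra_simps)
      moreover have "- sin t * x$1 + cos t * x$2 = b * snd z" using u2 v2 by (simp add: algebra_simps)
      ultimately show ?thesis by (simp only:) (simp add: algebra_simps)
    qed
    show "F (c + g (vector [fst z, snd z])) = cis (- p1 * f) * (indicator {z :: real \<times> real. (fst z)\<^sup>2 + (snd z)\<^sup>2 < 1} z *\<^sub>R cis (p1 * a * fst z + p2 * b * snd z))"
    proof -
      have "cis (p1 * (cos t * x$1 + sin t * x$2) + p2 * (- sin t * x$1 + cos t * x$2)) = cis (- p1 * f) * cis (p1 * a * fst z + p2 * b * snd z)"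
        unfolding e by (simp only: cis_mult)
      thus ?thesis unfolding x_def[symmetric] F_def using mem by (simp only: indicator_def mem_Collect_eq) simp
    qed
  qed
  also have "\<dots> = cis (- p1 * f) * disc_int (p1 * a) (p2 * b)"
    by (simp only: disc_int_def integral_mult_right_zero)
  finally show ?thesis by (simp add: set_lebesgue_integral_def F_def scaleR_conv_of_real mult.assoc)
qed

text \<open>The divergence theorem on the ellipse for the constant vector (m1, m2) times the plane
  wave of frequency (p1, p2), in coordinates along the axes.\<close>

lemma ellipse_boundary_integral:
  fixes c :: "real^2"
  assumes ab: "0 < a" "0 < b" and c: "c = (- f) *\<^sub>R vector [cos t, sin t]"
  shows "\<i> * of_real (m1 * p1 + m2 * p2) *
      (LINT x:ellipse_region c t a b|lborel. cis (p1 * (cos t * x$1 + sin t * x$2) + p2 * (- sin t * x$1 + cos t * x$2)))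
     = integral {-pi..pi} (\<lambda>s. of_real (m1 * (b * cos s) + m2 * (a * sin s)) * cis (p1 * (a * cos s - f) + p2 * (b * sin s)))"
proof -
  let ?e = "\<lambda>s. cis (p1 * a * cos s + p2 * b * sin s)"
  have "\<i> * of_real (m1 * p1 + m2 * p2) * (of_real (a * b) * cis (- p1 * f) * disc_int (p1 * a) (p2 * b))
    = cis (- p1 * f) * (of_real (m1 * b) * (\<i> * of_real (p1 * a) * disc_int (p1 * a) (p2 * b)) + of_real (m2 * a) * (\<i> * of_real (p2 * b) * disc_int (p1 * a) (p2 * b)))"
    by (simp add: algebra_simps)
  also have "\<dots> = cis (- p1 * f) * (of_real (m1 * b) * integral {-pi..pi} (\<lambda>s. of_real (cos s) * ?e s) + of_real (m2 * a) * integral {-pi..pi} (\<lambda>s. of_real (sin s) * ?e s))"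
    by (simp only: disc_int_x disc_int_y)
  also have "\<dots> = integral {-pi..pi} (\<lambda>s. cis (- p1 * f) * (of_real (m1 * b) * (of_real (cos s) * ?e s) + of_real (m2 * a) * (of_real (sin s) * ?e s)))"
    by (intro integral_unique[symmetric] has_integral_mult_right has_integral_add integrable_integral integrable_continuous_real continuous_intros)
  also have "\<dots> = integral {-pi..pi} (\<lambda>s. of_real (m1 * (b * cos s) + m2 * (a * sin s)) * cis (p1 * (a * cos s - f) + p2 * (b * sin s)))"
  proof (rule Henstock_Kurzweil_Integration.integral_cong)
    fix s
    have e: "p1 * (a * cos s - f) + p2 * (b * sin s) = - p1 * f + (p1 * a * cos s + p2 * b * sin s)" by (simp add: algebra_simps)
    show "cis (- p1 * f) * (of_real (m1 * b) * (of_real (cos s) * ?e s) + of_real (m2 * a) * (of_real (sin s) * ?e s))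
      = of_real (m1 * (b * cos s) + m2 * (a * sin s)) * cis (p1 * (a * cos s - f) + p2 * (b * sin s))"
      unfolding e cis_mult[symmetric] by (simp add: algebra_simps)
  qed
  finally show ?thesis by (simp only: ellipse_integral[OF ab c])
qed

section \<open>Orthogonality to plane waves\<close>

definition sq_int :: "'a measure \<Rightarrow> ('a \<Rightarrow> complex) \<Rightarrow> bool" where
  "sq_int M f \<longleftrightarrow> f \<in> borel_measurable M \<and> integrable M (\<lambda>x. (cmod (f x))\<^sup>2)"

lemma (in finite_measure) sq_int_mult_integrable:
  assumes f: "sq_int M f" and w: "w \<in> borel_measurable M" "\<And>x. x \<in> space M \<Longrightarrow> cmod (w x) \<le> B"
  shows "integrable M (\<lambda>x. f x * w x)"
proof (rule Bochner_Integration.integrable_bound)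
  show "integrable M (\<lambda>x. \<bar>B\<bar> * (1 + (cmod (f x))\<^sup>2))" using f by (auto simp: sq_int_def)
  show "(\<lambda>x. f x * w x) \<in> borel_measurable M" using f w by (auto simp: sq_int_def)
  show "AE x in M. norm (f x * w x) \<le> norm (\<bar>B\<bar> * (1 + (cmod (f x))\<^sup>2))"
  proof (rule AE_I2)
    fix x assume x: "x \<in> space M"
    have "cmod (f x) \<le> 1 + (cmod (f x))\<^sup>2"
      using zero_le_power2[of "cmod (f x) - 1/2"] by (simp add: power2_eq_square algebra_simps)
    hence "cmod (f x) * cmod (w x) \<le> (1 + (cmod (f x))\<^sup>2) * \<bar>B\<bar>"
      using w(2)[OF x] by (intro mult_mono) auto
    thus "norm (f x * w x) \<le> norm (\<bar>B\<bar> * (1 + (cmod (f x))\<^sup>2))" by (simp add: norm_mult mult.commute)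
  qed
qed

lemma sq_int_diff:
  assumes "sq_int M f" "sq_int M g"
  shows "sq_int M (\<lambda>x. f x - g x)"
  unfolding sq_int_def
proof
  show m: "(\<lambda>x. f x - g x) \<in> borel_measurable M" using assms by (auto simp: sq_int_def)
  show "integrable M (\<lambda>x. (cmod (f x - g x))\<^sup>2)"
  proof (rule Bochner_Integration.integrable_bound)
    show "integrable M (\<lambda>x. 2 * (cmod (f x))\<^sup>2 + 2 * (cmod (g x))\<^sup>2)" using assms by (auto simp: sq_int_def)
    show "(\<lambda>x. (cmod (f x - g x))\<^sup>2) \<in> borel_measurable M" using m by measurable
    have "(cmod (f x - g x))\<^sup>2 \<le> 2 * (cmod (f x))\<^sup>2 + 2 * (cmod (g x))\<^sup>2" for x
    proof -
      have "(cmod (f x - g x))\<^sup>2 \<le> (cmod (f x) + cmod (g x))\<^sup>2" by (intro power_mono norm_triangle_ineq4) auto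
      also have "\<dots> \<le> 2 * (cmod (f x))\<^sup>2 + 2 * (cmod (g x))\<^sup>2"
        using zero_le_power2[of "cmod (f x) - cmod (g x)"] by (simp add: power2_eq_square algebra_simps)
      finally show ?thesis .
    qed
    thus "AE x in M. norm ((cmod (f x - g x))\<^sup>2) \<le> norm (2 * (cmod (f x))\<^sup>2 + 2 * (cmod (g x))\<^sup>2)" by simp
  qed
qed

lemma (in finite_measure) sq_int_bounded:
  assumes "f \<in> borel_measurable M" "\<And>x. x \<in> space M \<Longrightarrow> cmod (f x) \<le> B"
  shows "sq_int M f"
  unfolding sq_int_def
proof
  show "integrable M (\<lambda>x. (cmod (f x))\<^sup>2)"
    by (rule integrable_const_bound[of _ "B\<^sup>2"]) (use assms in \<open>auto intro!: AE_I2 power_mono\<close>)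
qed (rule assms)

text \<open>\<open>S\<close> is only required to dominate |e|^2 because the approximation in
  \<open>H10\<close> controls three squares through one sum; each of them is fed in separately. The
  Cauchy-Schwarz inequality is replaced by |e| <= delta/2 + |e|^2/(2 delta).\<close>

lemma (in finite_measure) sq_int_tendsto_imp_L1:
  fixes e :: "nat \<Rightarrow> 'a \<Rightarrow> complex" and S :: "nat \<Rightarrow> 'a \<Rightarrow> real"
  assumes e: "\<And>n. sq_int M (e n)" and S: "\<And>n. integrable M (S n)" "\<And>n x. (cmod (e n x))\<^sup>2 \<le> S n x"
    and lim: "(\<lambda>n. integral\<^sup>L M (S n)) \<longlonglongrightarrow> 0"
    and w: "w \<in> borel_measurable M" "\<And>x. x \<in> space M \<Longrightarrow> cmod (w x) \<le> 1"
  shows "(\<lambda>n. integral\<^sup>L M (\<lambda>x. e n x * w x)) \<longlonglongrightarrow> 0"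
proof (rule Lim_null_comparison)
  define I where "I = (\<lambda>n. integral\<^sup>L M (S n))"
  \<comment> \<open>The square root of \<open>I n\<close> balances the two terms; the added null
    sequence keeps it positive when \<open>I n\<close> is 0.\<close>
  define \<delta> where "\<delta> = (\<lambda>n. sqrt (I n + 1 / (real n + 1)))"
  define m where "m = measure M (space M)"
  have I0: "I n \<ge> 0" for n unfolding I_def
    by (rule Bochner_Integration.integral_nonneg) (use S(2) in \<open>auto intro: order.trans[OF zero_le_power2]\<close>)
  have d0: "\<delta> n > 0" for n using I0[of n] by (auto simp: \<delta>_def add_nonneg_pos)
  have "(\<lambda>n. I n + 1 / (real n + 1)) \<longlonglongrightarrow> 0 + 0"
    using lim LIMSEQ_inverse_real_of_nat unfolding I_def by (intro tendsto_add) (auto simp: inverse_eq_divide add.commute)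
  hence "\<delta> \<longlonglongrightarrow> 0" unfolding \<delta>_def using tendsto_real_sqrt[of _ 0] by simp
  hence "(\<lambda>n. \<delta> n * ((m + 1) / 2)) \<longlonglongrightarrow> 0 * ((m + 1) / 2)" by (intro tendsto_intros)
  thus "(\<lambda>n. \<delta> n * ((m + 1) / 2)) \<longlonglongrightarrow> 0" by simp
  show "\<forall>\<^sub>F n in sequentially. norm (integral\<^sup>L M (\<lambda>x. e n x * w x)) \<le> \<delta> n * ((m + 1) / 2)"
  proof (rule always_eventually, rule allI)
    fix n
    have "norm (integral\<^sup>L M (\<lambda>x. e n x * w x)) \<le> integral\<^sup>L M (\<lambda>x. norm (e n x * w x))"
      by (rule integral_norm_bound)
    also have "\<dots> \<le> integral\<^sup>L M (\<lambda>x. \<delta> n / 2 + S n x / (2 * \<delta> n))"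
    proof (rule integral_mono)
      show "integrable M (\<lambda>x. norm (e n x * w x))" using sq_int_mult_integrable[OF e w] by (rule integrable_norm)
      show "integrable M (\<lambda>x. \<delta> n / 2 + S n x / (2 * \<delta> n))" using S by auto
      fix x assume x: "x \<in> space M"
      have "norm (e n x * w x) \<le> cmod (e n x) * 1" unfolding norm_mult using w(2)[OF x] by (intro mult_left_mono) auto
      also have "\<dots> \<le> \<delta> n / 2 + (cmod (e n x))\<^sup>2 / (2 * \<delta> n)"
        using d0[of n] zero_le_power2[of "cmod (e n x) - \<delta> n"] by (simp add: field_simps power2_eq_square)
      also have "\<dots> \<le> \<delta> n / 2 + S n x / (2 * \<delta> n)"
        using d0[of n] S(2) by (intro add_left_mono divide_right_mono) auto
      finally show "norm (e n x * w x) \<le> \<delta> n / 2 + S n x / (2 * \<delta> n)" .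
    qed
    also have "\<dots> = \<delta> n / 2 * m + I n / (2 * \<delta> n)"
      using S by (simp add: I_def m_def)
    also have "\<dots> \<le> \<delta> n / 2 * m + \<delta> n / 2"
    proof -
      have "I n \<le> \<delta> n * \<delta> n" using I0[of n] by (simp add: \<delta>_def)
      thus ?thesis using d0[of n] by (simp add: field_simps)
    qed
    also have "\<dots> = \<delta> n * ((m + 1) / 2)" by (simp add: algebra_simps add_divide_distrib)
    finally show "norm (integral\<^sup>L M (\<lambda>x. e n x * w x)) \<le> \<delta> n * ((m + 1) / 2)" .
  qed
qed

text \<open>Test functions here are C^1, so max(x, 0)^2, written as \<open>p\<close>, is smooth
  enough; the cutoff is p(1 - s) / (p(1 - s) + p(s)).\<close>

lemma cutoff_exists:
  obtains \<theta> \<theta>' :: "real \<Rightarrow> real" where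
    "\<forall>s. (\<theta> has_real_derivative \<theta>' s) (at s)" "continuous_on UNIV \<theta>'"
    "\<forall>s\<le>0. \<theta> s = 1" "\<forall>s\<ge>1. \<theta> s = 0" "\<forall>s. \<bar>\<theta> s\<bar> \<le> 1" "\<forall>s<0. \<theta>' s = 0"
proof -
  define p where "p = (\<lambda>x::real. (x * x + x * \<bar>x\<bar>) / 2)"
  define p' where "p' = (\<lambda>x::real. x + \<bar>x\<bar>)"
  have abs: "((\<lambda>x. x * \<bar>x\<bar>) has_real_derivative 2 * \<bar>x\<bar>) (at x)" for x :: real
  proof (rule linorder_cases[of x 0])
    assume x: "x = 0"
    have "(\<lambda>h::real. \<bar>h\<bar>) \<midarrow>0\<rightarrow> 0" by (rule tendsto_rabs_zero) (rule tendsto_ident_at)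
    moreover have "eventually (\<lambda>h::real. \<bar>h\<bar> = h * \<bar>h\<bar> / h) (at 0)" by (auto simp: eventually_at_filter)
    ultimately have "(\<lambda>h::real. h * \<bar>h\<bar> / h) \<midarrow>0\<rightarrow> 0" by (rule Lim_transform_eventually)
    thus ?thesis using x by (simp add: DERIV_def)
  next
    assume x: "x < 0"
    have "((\<lambda>x. - (x * x)) has_real_derivative 2 * \<bar>x\<bar>) (at x)" using x by (auto intro!: derivative_eq_intros)
    thus ?thesis
      by (rule has_field_derivative_transform_within_open[where S = "{..<0}"]) (use x in auto)
  next
    assume x: "0 < x"
    have "((\<lambda>x. x * x) has_real_derivative 2 * \<bar>x\<bar>) (at x)" using x by (auto intro!: derivative_eq_intros)
    thus ?thesis
      by (rule has_field_derivative_transform_within_open[where S = "{0<..}"]) (use x in auto)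
  qed
  have dp: "(p has_real_derivative p' x) (at x)" for x
  proof -
    have "((\<lambda>x. (x * x + x * \<bar>x\<bar>) / 2) has_real_derivative (1 * x + 1 * x + 2 * \<bar>x\<bar>) / 2) (at x)"
      by (intro DERIV_cdivide DERIV_add DERIV_mult DERIV_ident abs)
    thus ?thesis unfolding p_def p'_def by (rule DERIV_cong) simp
  qed
  have pneg: "p x = 0" if "x \<le> 0" for x using that by (simp add: p_def)
  have ppos: "p x > 0" if "x > 0" for x using that by (simp add: p_def)
  have pnn: "p x \<ge> 0" for x using pneg[of x] ppos[of x] by (cases "x \<le> 0") auto
  have den: "p (1 - s) + p s > 0" for s
    using ppos[of s] ppos[of "1 - s"] pnn[of s] pnn[of "1 - s"] by (cases "s > 0") (auto simp: add_nonneg_pos add_pos_nonneg)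
  have pc: "continuous_on UNIV p" "continuous_on UNIV p'" unfolding p_def p'_def by (intro continuous_intros; simp)+
  define \<theta> where "\<theta> = (\<lambda>s. p (1 - s) / (p (1 - s) + p s))"
  define \<theta>' where "\<theta>' = (\<lambda>s. (- p' (1 - s) * (p (1 - s) + p s) - p (1 - s) * (- p' (1 - s) + p' s)) / ((p (1 - s) + p s) * (p (1 - s) + p s)))"
  have d1: "((\<lambda>s. p (1 - s)) has_real_derivative - p' (1 - s)) (at s)" for s
  proof -
    have "((\<lambda>s. 1 - s) has_real_derivative -1) (at s)" by (auto intro!: derivative_eq_intros)
    from DERIV_chain2[OF dp this] show ?thesis by simp
  qed
  have D: "(\<theta> has_real_derivative \<theta>' s) (at s)" for s
    unfolding \<theta>_def \<theta>'_def using den[of s] by (intro DERIV_divide DERIV_add d1 dp) auto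
  have pc1: "continuous_on UNIV (\<lambda>s. p (1 - s))" "continuous_on UNIV (\<lambda>s. p' (1 - s))"
    by (rule continuous_on_compose2[OF pc(1)], auto intro!: continuous_intros,
        rule continuous_on_compose2[OF pc(2)], auto intro!: continuous_intros)
  have C: "continuous_on UNIV \<theta>'"
    unfolding \<theta>'_def using den by (intro continuous_intros pc pc1) (auto simp: less_imp_neq[symmetric])
  have one: "\<theta> s = 1" if "s \<le> 0" for s using that den[of s] pneg[of s] by (simp add: \<theta>_def)
  have "\<theta>' s = 0" if "s < 0" for s
  proof -
    have "((\<lambda>_. 1 :: real) has_real_derivative 0) (at s)" by simp
    hence "(\<theta> has_real_derivative 0) (at s)"
      by (rule has_field_derivative_transform_within_open[where S = "{..<0}"]) (use one that in auto)
    thus ?thesis using D DERIV_unique by blast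
  qed
  moreover have "\<theta> s = 0" if "s \<ge> 1" for s using that pneg[of "1 - s"] by (simp add: \<theta>_def)
  moreover have "\<bar>\<theta> s\<bar> \<le> 1" for s using den[of s] pnn[of s] pnn[of "1 - s"] by (simp add: \<theta>_def divide_le_eq)
  ultimately show thesis using that[of \<theta> \<theta>'] D C one by blast
qed

section \<open>Test functions, their products with plane waves, and cutoffs adapted to the
  ellipse\<close>

lemma test_fn_has_derivative:
  "test_fn \<psi> \<Longrightarrow> (\<psi> has_derivative frechet_derivative \<psi> (at x)) (at x)"
  by (simp add: test_fn_def flip: frechet_derivative_works)

lemma pd_eq: "(\<psi> has_derivative D) (at x) \<Longrightarrow> pd \<psi> i x = D (axis i 1)"
  unfolding pd_def by (metis frechet_derivative_at)

lemma test_fn_continuous: "test_fn \<psi> \<Longrightarrow> continuous_on A \<psi>"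
  by (meson continuous_at_imp_continuous_on differentiable_imp_continuous_within test_fn_def)

lemma pd_zero_outside:
  assumes "x \<notin> closure {x. \<psi> x \<noteq> 0}"
  shows "pd \<psi> i x = 0"
proof -
  have "((\<lambda>_. 0) has_derivative (\<lambda>_. 0)) (at x)" by simp
  hence "(\<psi> has_derivative (\<lambda>_. 0)) (at x)"
    by (rule has_derivative_transform_within_open[OF _ open_Compl[OF closed_closure[of "{x. \<psi> x \<noteq> 0}"]]])
       (use assms closure_subset[of "{x. \<psi> x \<noteq> 0}"] in auto)
  thus ?thesis by (simp add: pd_eq)
qed

lemma zero_outside: "x \<notin> closure {x. \<psi> x \<noteq> 0} \<Longrightarrow> \<psi> x = 0"
  using closure_subset[of "{x. \<psi> x \<noteq> 0}"] by auto

lemma compact_support_bounded: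
  fixes h :: "real^2 \<Rightarrow> complex"
  assumes "continuous_on UNIV h" "compact K" "\<And>x. x \<notin> K \<Longrightarrow> h x = 0"
  obtains B where "B > 0" "\<And>x. cmod (h x) \<le> B"
proof -
  have "bounded (h ` K)" by (intro compact_imp_bounded compact_continuous_image assms continuous_on_subset[OF assms(1)]) auto
  then obtain B where B: "B > 0" "\<And>x. x \<in> K \<Longrightarrow> cmod (h x) \<le> B" unfolding bounded_pos by blast
  have "cmod (h x) \<le> B" for x using B assms(3)[of x] by (cases "x \<in> K") auto
  thus thesis using B that by blast
qed

lemma compact_support_integrable:
  fixes h :: "real^2 \<Rightarrow> complex"
  assumes "continuous_on UNIV h" "compact K" "\<And>x. x \<notin> K \<Longrightarrow> h x = 0"
  shows "integrable lborel h"
proof -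
  have "integrable lborel (\<lambda>x. indicator K x *\<^sub>R h x)"
    by (rule borel_integrable_compact[OF assms(2)]) (rule continuous_on_subset[OF assms(1)], simp)
  moreover have "(\<lambda>x. indicator K x *\<^sub>R h x) = h" using assms(3) by (auto simp: fun_eq_iff indicator_def)
  ultimately show ?thesis by simp
qed

text \<open>Difference quotients have integral zero by translation invariance.\<close>

lemma test_fn_integral_pd:
  assumes \<psi>: "test_fn \<psi>"
  shows "(LINT x|lborel. pd \<psi> i x) = 0"
proof -
  define K where "K = closure {x. \<psi> x \<noteq> 0}"
  define e where "e = (axis i 1 :: real^2)"
  have ne: "norm e = 1" by (simp add: e_def norm_axis_1)
  have K: "compact K" using \<psi> by (simp add: K_def test_fn_def)
  have c: "continuous_on UNIV (pd \<psi> i)" using \<psi> by (simp add: test_fn_def)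
  obtain B where B: "B > 0" "\<And>x. cmod (pd \<psi> i x) \<le> B"
    using compact_support_bounded[OF c K] pd_zero_outside unfolding K_def by metis
  obtain R where R: "R > 0" "\<And>x. x \<in> K \<Longrightarrow> norm x \<le> R"
    using compact_imp_bounded[OF K] unfolding bounded_pos by blast
  have i\<psi>: "integrable lborel \<psi>"
    using compact_support_integrable[OF test_fn_continuous[OF \<psi>] K] zero_outside unfolding K_def by metis
  define h where "h = (\<lambda>n::nat. (1 / (real n + 1)) *\<^sub>R e)"
  define q where "q = (\<lambda>n x. of_real (real n + 1) * (\<psi> (h n + x) - \<psi> x))"
  have m: "\<psi> \<in> borel_measurable borel" using test_fn_continuous[OF \<psi>] by (rule borel_measurable_continuous_onI)
  have mh: "(\<lambda>x. \<psi> (h n + x)) \<in> borel_measurable borel" for n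
    by (rule measurable_compose[OF _ m]) simp
  have tr: "integrable lborel (\<lambda>x. \<psi> (h n + x))" "(LINT x|lborel. \<psi> (h n + x)) = (LINT x|lborel. \<psi> x)" for n
  proof -
    have d: "distr lborel borel ((+) (h n)) = (lborel :: (real^2) measure)" by (rule lborel_distr_plus)
    show "integrable lborel (\<lambda>x. \<psi> (h n + x))"
      using i\<psi> integrable_distr_eq[of "(+) (h n)" lborel borel \<psi>] m unfolding d by simp
    show "(LINT x|lborel. \<psi> (h n + x)) = (LINT x|lborel. \<psi> x)"
      using integral_distr[of "(+) (h n)" lborel borel \<psi>] m unfolding d by simp
  qed
  have q0: "(LINT x|lborel. q n x) = 0" for n
    unfolding q_def using tr i\<psi> by simp
  \<comment> \<open>The increments have norm at most 1, so all difference quotients vanish outside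
    the ball of radius R + 1; inside, the mean value inequality gives the bound of the
    derivative.\<close>
  have qb: "norm (q n x) \<le> indicator (cball 0 (R + 1)) x * B" for n x
  proof (cases "x \<in> cball 0 (R + 1)")
    case False
    have "norm (h n) \<le> 1" using ne by (simp add: h_def)
    hence "x \<notin> K" "h n + x \<notin> K" using False R(2)[of x] R(2)[of "h n + x"] norm_triangle_ineq4[of "h n + x" "h n"] by auto
    hence "\<psi> x = 0" "\<psi> (h n + x) = 0" unfolding K_def by (auto intro: zero_outside)
    thus ?thesis using False by (simp add: q_def)
  next
    case True
    define \<tau> where "\<tau> = 1 / (real n + 1)"
    have \<tau>: "\<tau> > 0" "(real n + 1) * \<tau> = 1" by (auto simp: \<tau>_def)
    have "norm (\<psi> (x + \<tau> *\<^sub>R e) - \<psi> (x + 0 *\<^sub>R e)) \<le> B * norm (\<tau> - 0)"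
    proof (rule differentiable_bound[of "{0..\<tau>}" "\<lambda>s. \<psi> (x + s *\<^sub>R e)" "\<lambda>s k. k *\<^sub>R pd \<psi> i (x + s *\<^sub>R e)"])
      fix s assume "s \<in> {0..\<tau>}"
      have 1: "((\<lambda>s. x + s *\<^sub>R e) has_derivative (\<lambda>k. k *\<^sub>R e)) (at s)"
        by (auto intro!: derivative_eq_intros)
      have lin: "linear (frechet_derivative \<psi> (at (x + s *\<^sub>R e)))"
        using test_fn_has_derivative[OF \<psi>] has_derivative_linear by blast
      have "((\<lambda>s. \<psi> (x + s *\<^sub>R e)) has_derivative (\<lambda>k. frechet_derivative \<psi> (at (x + s *\<^sub>R e)) (k *\<^sub>R e))) (at s)"
        by (rule has_derivative_compose[OF 1 test_fn_has_derivative[OF \<psi>]])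
      moreover have "frechet_derivative \<psi> (at (x + s *\<^sub>R e)) (k *\<^sub>R e) = k *\<^sub>R pd \<psi> i (x + s *\<^sub>R e)" for k
        using linear_scale[OF lin] by (simp add: pd_def e_def)
      ultimately have "((\<lambda>s. \<psi> (x + s *\<^sub>R e)) has_derivative (\<lambda>k. k *\<^sub>R pd \<psi> i (x + s *\<^sub>R e))) (at s)" by simp
      thus "((\<lambda>s. \<psi> (x + s *\<^sub>R e)) has_derivative (\<lambda>k. k *\<^sub>R pd \<psi> i (x + s *\<^sub>R e))) (at s within {0..\<tau>})"
        by (rule has_derivative_at_withinI)
      show "onorm (\<lambda>k. k *\<^sub>R pd \<psi> i (x + s *\<^sub>R e)) \<le> B"
        using B(2) by (intro onorm_le) (simp add: mult.commute[of B] mult_left_mono)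
    qed (use \<tau> in auto)
    hence "norm (\<psi> (h n + x) - \<psi> x) \<le> B * \<tau>" using \<tau> by (simp add: h_def \<tau>_def add.commute)
    hence "(real n + 1) * norm (\<psi> (h n + x) - \<psi> x) \<le> (real n + 1) * (B * \<tau>)" by (intro mult_left_mono) auto
    also have "\<dots> = B * ((real n + 1) * \<tau>)" by (simp only: mult_ac)
    finally have "(real n + 1) * norm (\<psi> (h n + x) - \<psi> x) \<le> B" using \<tau> by simp
    moreover have "norm (complex_of_real (real n + 1)) = real n + 1" by (simp only: norm_of_real)
    ultimately show ?thesis using True by (simp only: q_def norm_mult indicator_simps mult_1)
  qed
  have "(\<lambda>n. LINT x|lborel. q n x) \<longlonglongrightarrow> (LINT x|lborel. pd \<psi> i x)"
  proof (rule integral_dominated_convergence[where w = "\<lambda>x. indicator (cball 0 (R + 1)) x * B"])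
    show "pd \<psi> i \<in> borel_measurable lborel" using borel_measurable_continuous_onI[OF c] by simp
    show "q n \<in> borel_measurable lborel" for n unfolding q_def using m mh by measurable
    show "integrable lborel (\<lambda>x. indicator (cball (0::real^2) (R + 1)) x * B)"
      using borel_integrable_compact[of "cball (0::real^2) (R + 1)" "\<lambda>_. B"] by simp
    show "AE x in lborel. (\<lambda>n. q n x) \<longlonglongrightarrow> pd \<psi> i x"
    proof (rule AE_I2)
      fix x
      define D where "D = frechet_derivative \<psi> (at x)"
      have D: "(\<psi> has_derivative D) (at x)" unfolding D_def by (rule test_fn_has_derivative[OF \<psi>])
      have lin: "linear D" using D has_derivative_linear by blast
      have "(\<lambda>k. norm (\<psi> (x + k) - \<psi> x - D k) / norm k) \<midarrow>0\<rightarrow> 0" using D by (simp add: has_derivative_at)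
      moreover have "filterlim h (at 0) sequentially"
      proof (rule filterlim_atI)
        have "(\<lambda>n. inverse (real (Suc n)) *\<^sub>R e) \<longlonglongrightarrow> 0 *\<^sub>R e" by (intro tendsto_intros LIMSEQ_inverse_real_of_nat)
        thus "h \<longlonglongrightarrow> 0" by (simp add: h_def inverse_eq_divide add.commute)
        show "\<forall>\<^sub>F n in sequentially. h n \<noteq> 0" using ne by (auto simp: h_def)
      qed
      ultimately have "(\<lambda>n. norm (\<psi> (x + h n) - \<psi> x - D (h n)) / norm (h n)) \<longlonglongrightarrow> 0" by (rule filterlim_compose)
      moreover have "norm (\<psi> (x + h n) - \<psi> x - D (h n)) / norm (h n) = norm (q n x - pd \<psi> i x)" for n
      proof -
        have "D (h n) = of_real (1 / (real n + 1)) * pd \<psi> i x"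
          using linear_scale[OF lin] by (simp add: h_def pd_def D_def e_def scaleR_conv_of_real)
        hence "q n x - pd \<psi> i x = of_real (real n + 1) * (\<psi> (x + h n) - \<psi> x - D (h n))"
        proof -
          assume a: "D (h n) = of_real (1 / (real n + 1)) * pd \<psi> i x"
          have "complex_of_real (real n + 1) * of_real (1 / (real n + 1)) = 1"
            unfolding of_real_mult[symmetric] by simp
          hence "complex_of_real (real n + 1) * D (h n) = pd \<psi> i x" unfolding a by (simp only: mult.assoc[symmetric]) simp
          thus ?thesis by (simp only: q_def right_diff_distrib add.commute)
        qed
        moreover have "norm (h n) = 1 / (real n + 1)" using ne by (simp add: h_def)
        moreover have "norm (complex_of_real (real n + 1)) = real n + 1" by (simp only: norm_of_real)
        ultimately show ?thesis by (simp only: norm_mult) simp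
      qed
      ultimately have "(\<lambda>n. norm (q n x - pd \<psi> i x)) \<longlonglongrightarrow> 0" by simp
      thus "(\<lambda>n. q n x) \<longlonglongrightarrow> pd \<psi> i x" using LIM_zero_cancel tendsto_norm_zero_iff by blast
    qed
    show "AE x in lborel. norm (q n x) \<le> indicator (cball 0 (R + 1)) x * B" for n using qb by simp
  qed
  thus ?thesis using q0 by (simp add: LIMSEQ_const_iff)
qed

lemma test_fn_mult_wave:
  fixes P1 P2 :: real
  defines "w \<equiv> (\<lambda>x::real^2. cis (P1 * x$1 + P2 * x$2))"
  assumes \<psi>: "test_fn \<psi>"
  shows "test_fn (\<lambda>x. \<psi> x * w x)"
    "pd (\<lambda>x. \<psi> x * w x) i x = pd \<psi> i x * w x + \<psi> x * (\<i> * of_real (if i = 1 then P1 else P2) * w x)"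
    "closure {x. \<psi> x * w x \<noteq> 0} = closure {x. \<psi> x \<noteq> 0}"
proof -
  have w0: "w x \<noteq> 0" for x by (simp add: w_def)
  have dw: "(w has_derivative (\<lambda>h. (P1 * h$1 + P2 * h$2) *\<^sub>R (\<i> * w x))) (at x)" for x
  proof -
    have l: "((\<lambda>x::real^2. P1 * x$1 + P2 * x$2) has_derivative (\<lambda>h. P1 * h$1 + P2 * h$2)) (at x)"
      by (intro has_derivative_add has_derivative_mult_right bounded_linear_imp_has_derivative bounded_linear_vec_nth)
    have "(cis has_derivative (\<lambda>k. k *\<^sub>R (\<i> * cis (P1 * x$1 + P2 * x$2)))) (at (P1 * x$1 + P2 * x$2))"
      using has_vector_derivative_cis[OF DERIV_ident] by (simp add: has_vector_derivative_def)
    from has_derivative_compose[OF l this] show ?thesis by (simp add: w_def)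
  qed
  have D: "((\<lambda>x. \<psi> x * w x) has_derivative
      (\<lambda>h. \<psi> x * ((P1 * h$1 + P2 * h$2) *\<^sub>R (\<i> * w x)) + frechet_derivative \<psi> (at x) h * w x)) (at x)" for x
    by (rule has_derivative_mult[OF test_fn_has_derivative[OF \<psi>] dw])
  have ax: "P1 * (axis i 1 :: real^2) $ 1 + P2 * (axis i 1 :: real^2) $ 2 = (if i = 1 then P1 else P2)" for i :: 2
    using exhaust_2[of i] by (auto simp: axis_def)
  show pd: "pd (\<lambda>x. \<psi> x * w x) i x = pd \<psi> i x * w x + \<psi> x * (\<i> * of_real (if i = 1 then P1 else P2) * w x)" for i x
    using pd_eq[OF D] unfolding ax by (simp add: pd_def scaleR_conv_of_real mult_ac)
  show cl: "closure {x. \<psi> x * w x \<noteq> 0} = closure {x. \<psi> x \<noteq> 0}" using w0 by simp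
  have cw: "continuous_on UNIV w" unfolding w_def by (intro continuous_intros)
  show "test_fn (\<lambda>x. \<psi> x * w x)"
    unfolding test_fn_def cl
  proof (intro conjI allI)
    show "(\<lambda>x. \<psi> x * w x) differentiable at x" for x using D by (auto simp: differentiable_def)
    have "pd (\<lambda>x. \<psi> x * w x) i = (\<lambda>x. pd \<psi> i x * w x + \<psi> x * (\<i> * of_real (if i = 1 then P1 else P2) * w x))" for i
      using pd by (rule ext)
    thus "continuous_on UNIV (pd (\<lambda>x. \<psi> x * w x) i)" for i
      using \<psi> cw test_fn_continuous[OF \<psi>] by (auto simp: test_fn_def intro!: continuous_intros)
    show "compact (closure {x. \<psi> x \<noteq> 0})" using \<psi> by (simp add: test_fn_def)
  qed
qed

definition qform :: "real^2 \<Rightarrow> real \<Rightarrow> real \<Rightarrow> real \<Rightarrow> real^2 \<Rightarrow> real" where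
  "qform c t a b x = ((cos t * (x$1 - c$1) + sin t * (x$2 - c$2)) / a)\<^sup>2
       + ((- sin t * (x$1 - c$1) + cos t * (x$2 - c$2)) / b)\<^sup>2"

lemma qform_bounded:
  assumes "0 < a" "0 < b"
  shows "compact {x. qform c t a b x \<le> s}"
proof -
  have cl: "closed {x. qform c t a b x \<le> s}"
    unfolding qform_def by (intro closed_Collect_le continuous_intros) (use assms in auto)
  have "{x. qform c t a b x \<le> s} \<subseteq> cball c (sqrt ((a\<^sup>2 + b\<^sup>2) * s))"
  proof
    fix x assume "x \<in> {x. qform c t a b x \<le> s}"
    hence q: "qform c t a b x \<le> s" by simp
    define X where "X = cos t * (x$1 - c$1) + sin t * (x$2 - c$2)"
    define Y where "Y = - sin t * (x$1 - c$1) + cos t * (x$2 - c$2)"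
    have qe: "qform c t a b x = X\<^sup>2 / a\<^sup>2 + Y\<^sup>2 / b\<^sup>2" by (simp add: qform_def X_def Y_def power_divide)
    have "(dist x c)\<^sup>2 = (x$1 - c$1)\<^sup>2 + (x$2 - c$2)\<^sup>2"
      by (simp add: dist_norm norm_vec_def L2_set_def sum_2 UNIV_2)
    also have "\<dots> = X\<^sup>2 + Y\<^sup>2"
    proof -
      have "X\<^sup>2 + Y\<^sup>2 = ((cos t)\<^sup>2 + (sin t)\<^sup>2) * ((x$1 - c$1)\<^sup>2 + (x$2 - c$2)\<^sup>2)" unfolding X_def Y_def by algebra
      thus ?thesis by simp
    qed
    also have "\<dots> = a\<^sup>2 * (X\<^sup>2 / a\<^sup>2) + b\<^sup>2 * (Y\<^sup>2 / b\<^sup>2)" using assms by simp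
    also have "\<dots> \<le> (a\<^sup>2 + b\<^sup>2) * (X\<^sup>2 / a\<^sup>2) + (a\<^sup>2 + b\<^sup>2) * (Y\<^sup>2 / b\<^sup>2)"
      by (intro add_mono mult_right_mono) auto
    also have "\<dots> = (a\<^sup>2 + b\<^sup>2) * qform c t a b x" by (simp only: qe distrib_left)
    also have "\<dots> \<le> (a\<^sup>2 + b\<^sup>2) * s" using q by (intro mult_left_mono) auto
    finally have "dist x c \<le> sqrt ((a\<^sup>2 + b\<^sup>2) * s)" by (rule real_le_rsqrt)
    thus "x \<in> cball c (sqrt ((a\<^sup>2 + b\<^sup>2) * s))" by (simp add: dist_commute)
  qed
  hence "bounded {x. qform c t a b x \<le> s}" by (rule bounded_subset[OF bounded_cball])
  thus ?thesis using cl by (simp add: compact_eq_bounded_closed)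
qed

text \<open>Two choices of (A, B) are used: (-1, 1) for a test function equal to 1 on the ellipse,
  and (1 - n, n + 1) for cutoffs supported inside it that exhaust it. The last clause shows that the
  derivative vanishes wherever \<open>\<theta>'\<close> does.\<close>

lemma qform_cutoff:
  assumes ab: "0 < a" "0 < b" and B: "B > 0"
    and \<theta>: "\<forall>s. (\<theta> has_real_derivative \<theta>' s) (at s)" "continuous_on UNIV \<theta>'" "\<forall>s\<ge>1. \<theta> s = 0"
  shows "test_fn (\<lambda>x. of_real (\<theta> (A + B * qform c t a b x)))"
    "closure {x. complex_of_real (\<theta> (A + B * qform c t a b x)) \<noteq> 0} \<subseteq> {x. qform c t a b x \<le> (1 - A) / B}"
    "\<exists>d. \<forall>x. pd (\<lambda>x. of_real (\<theta> (A + B * qform c t a b x))) i x = of_real (\<theta>' (A + B * qform c t a b x) * d x)"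
proof -
  let ?\<psi> = "\<lambda>x. complex_of_real (\<theta> (A + B * qform c t a b x))"
  define X where "X = (\<lambda>x::real^2. (cos t * (x$1 - c$1) + sin t * (x$2 - c$2)) / a)"
  define Y where "Y = (\<lambda>x::real^2. (- sin t * (x$1 - c$1) + cos t * (x$2 - c$2)) / b)"
  define X' where "X' = (\<lambda>h::real^2. (cos t * h$1 + sin t * h$2) / a)"
  define Y' where "Y' = (\<lambda>h::real^2. (- sin t * h$1 + cos t * h$2) / b)"
  define N' where "N' = (\<lambda>x h. 2 * X x * X' h + 2 * Y x * Y' h)"
  have N: "qform c t a b x = (X x)\<^sup>2 + (Y x)\<^sup>2" for x by (simp add: qform_def X_def Y_def)
  have nth: "((\<lambda>x::real^2. x $ j) has_derivative (\<lambda>h. h $ j)) (at x)" for j x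
    by (intro bounded_linear_imp_has_derivative bounded_linear_vec_nth)
  have dX: "(X has_derivative X') (at x)" for x
    unfolding X_def X'_def using ab by (auto intro!: derivative_eq_intros nth)
  have dY: "(Y has_derivative Y') (at x)" for x
    unfolding Y_def Y'_def using ab by (auto intro!: derivative_eq_intros nth)
  have dN: "((\<lambda>x. A + B * qform c t a b x) has_derivative (\<lambda>h. B * N' x h)) (at x)" for x
    unfolding N N'_def by (auto intro!: derivative_eq_intros dX dY simp: algebra_simps)
  have D: "(?\<psi> has_derivative (\<lambda>h. of_real (\<theta>' (A + B * qform c t a b x) * (B * N' x h)))) (at x)" for x
  proof -
    have "(\<theta> has_derivative (\<lambda>k. \<theta>' (A + B * qform c t a b x) * k)) (at (A + B * qform c t a b x))"
      using \<theta>(1) by (simp add: has_field_derivative_def)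
    from has_derivative_compose[OF dN this]
    have "((\<lambda>x. \<theta> (A + B * qform c t a b x)) has_derivative (\<lambda>h. \<theta>' (A + B * qform c t a b x) * (B * N' x h))) (at x)" .
    thus ?thesis by (rule has_derivative_of_real)
  qed
  have pd: "pd ?\<psi> i x = of_real (\<theta>' (A + B * qform c t a b x) * (B * N' x (axis i 1)))" for i x by (rule pd_eq[OF D])
  show "\<exists>d. \<forall>x. pd ?\<psi> i x = of_real (\<theta>' (A + B * qform c t a b x) * d x)"
    by (intro exI[of _ "\<lambda>x. B * N' x (axis i 1)"] allI pd)
  have sub: "{x. ?\<psi> x \<noteq> 0} \<subseteq> {x. qform c t a b x \<le> (1 - A) / B}"
  proof
    fix x assume "x \<in> {x. ?\<psi> x \<noteq> 0}"
    hence "A + B * qform c t a b x < 1" using \<theta>(3) by (auto simp: not_le[symmetric])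
    thus "x \<in> {x. qform c t a b x \<le> (1 - A) / B}" using B by (simp add: field_simps)
  qed
  have comp: "compact {x. qform c t a b x \<le> (1 - A) / B}" by (rule qform_bounded[OF ab])
  show cl: "closure {x. ?\<psi> x \<noteq> 0} \<subseteq> {x. qform c t a b x \<le> (1 - A) / B}"
    using sub comp by (meson closure_minimal compact_imp_closed)
  show "test_fn ?\<psi>"
    unfolding test_fn_def
  proof (intro conjI allI)
    show "?\<psi> differentiable at x" for x using D by (auto simp: differentiable_def)
    show "continuous_on UNIV (pd ?\<psi> i)" for i
    proof -
      have e: "pd ?\<psi> i = (\<lambda>x. of_real (\<theta>' (A + B * qform c t a b x) * (B * N' x (axis i 1))))" using pd by (rule ext)
      have cq: "continuous_on UNIV (\<lambda>x. A + B * qform c t a b x)"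
        using dN by (meson continuous_at_imp_continuous_on has_derivative_continuous)
      have "continuous_on UNIV (\<lambda>x. \<theta>' (A + B * qform c t a b x))" by (rule continuous_on_compose2[OF \<theta>(2) cq]) auto
      moreover have "continuous_on UNIV (\<lambda>x. N' x (axis i 1))" unfolding N'_def X_def Y_def using ab by (intro continuous_intros) auto
      ultimately show ?thesis unfolding e by (intro continuous_intros)
    qed
    have "compact ({x. qform c t a b x \<le> (1 - A) / B} \<inter> closure {x. ?\<psi> x \<noteq> 0})" using comp by (rule compact_Int_closed) simp
    thus "compact (closure {x. ?\<psi> x \<noteq> 0})" using cl by (simp add: Int_absorb1)
  qed
qed

text \<open>Let A be the pairing of the gradient of u - v with that of w. Green's formula tested
  with w gives A - k^2 q (integral of u w) + k^2 (integral of v w) = 0. Since u - v is a limit of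
  compactly supported functions and w solves Laplace(w) = -k^2 q w, also A - k^2 q (integral of (u -
  v) w) = 0. Subtraction leaves k^2 (1 - q) (integral of v w) = 0.\<close>

lemma non_scattering_orthogonal:
  fixes P1 P2 :: real and v :: "real^2 \<Rightarrow> complex"
  defines "w \<equiv> (\<lambda>x::real^2. cis (P1 * x$1 + P2 * x$2))"
  assumes ab: "0 < a" "0 < b" and k: "k \<noteq> 0" and q: "q \<noteq> 1" and P: "P1\<^sup>2 + P2\<^sup>2 = k\<^sup>2 * q"
    and ns: "non_scattering (ellipse_region c t a b) q k v"
  shows "(LINT x:ellipse_region c t a b|lborel. v x * w x) = 0"
proof -
  define \<Omega> where "\<Omega> = ellipse_region c t a b"
  have \<Omega>: "\<Omega> = {x. qform c t a b x < 1}" by (simp add: \<Omega>_def ellipse_region_def qform_def)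
  have op: "open \<Omega>" unfolding \<Omega> qform_def by (intro open_Collect_less continuous_intros) (use ab in auto)
  hence \<Omega>s: "\<Omega> \<in> sets lborel" by simp
  define M where "M = restrict_space (lborel :: (real^2) measure) \<Omega>"
  have spM: "space M = \<Omega>" by (simp add: M_def space_restrict_space)
  have "emeasure lborel \<Omega> \<le> emeasure lborel {x. qform c t a b x \<le> 1}"
    by (rule emeasure_mono) (use qform_bounded[OF ab, of c t 1] in \<open>auto simp: \<Omega> compact_imp_closed borel_closed\<close>)
  also have "\<dots> < \<infinity>" using emeasure_bounded_finite[OF compact_imp_bounded[OF qform_bounded[OF ab, of c t 1]]] by simp
  finally have "emeasure lborel \<Omega> < \<infinity>" .
  moreover have "emeasure M \<Omega> = emeasure lborel \<Omega>"
    unfolding M_def by (rule emeasure_restrict_space) (use \<Omega>s in auto)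
  ultimately interpret finite_measure M
    by (intro finite_measureI) (simp add: spM)
  have LM: "(LINT x:\<Omega>|lborel. f x) = integral\<^sup>L M f" for f :: "real^2 \<Rightarrow> complex"
    unfolding M_def set_lebesgue_integral_def using \<Omega>s by (subst integral_restrict_space) auto
  have LMr: "(LINT x:\<Omega>|lborel. f x) = integral\<^sup>L M f" for f :: "real^2 \<Rightarrow> real"
    unfolding M_def set_lebesgue_integral_def using \<Omega>s by (subst integral_restrict_space) auto
  have L2: "L2_on \<Omega> f \<longleftrightarrow> sq_int M f" for f
    unfolding L2_on_def sq_int_def M_def set_borel_measurable_def set_integrable_def using \<Omega>s
    by (simp add: borel_measurable_restrict_space_iff integrable_restrict_space)
  have mM: "f \<in> borel_measurable M" if "continuous_on UNIV f" for f :: "real^2 \<Rightarrow> complex"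
    unfolding M_def using borel_measurable_continuous_onI[OF that] by (intro measurable_restrict_space1) simp
  have cw: "continuous_on UNIV w" unfolding w_def by (intro continuous_intros)
  have wm: "w \<in> borel_measurable M" by (rule mM[OF cw])
  have nw: "cmod (w x) \<le> 1" for x by (simp add: w_def)
  obtain u gu gv where u: "H1_grad \<Omega> u gu" and v: "H1_grad \<Omega> v gv" and z: "H10 \<Omega> (\<lambda>x. u x - v x)"
    and green: "\<And>\<psi>. test_fn \<psi> \<Longrightarrow>
         (LINT x:\<Omega>|lborel. gu 1 x * pd \<psi> 1 x + gu 2 x * pd \<psi> 2 x - complex_of_real (k\<^sup>2 * q) * u x * \<psi> x)
       = (LINT x:\<Omega>|lborel. gv 1 x * pd \<psi> 1 x + gv 2 x * pd \<psi> 2 x - complex_of_real (k\<^sup>2) * v x * \<psi> x)"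
    using ns unfolding non_scattering_def \<Omega>_def by blast
  obtain g \<psi> where g: "H1_grad \<Omega> (\<lambda>x. u x - v x) g" and \<psi>: "\<And>n. test_fn (\<psi> n)" "\<And>n. closure {x. \<psi> n x \<noteq> 0} \<subseteq> \<Omega>"
    and lim: "(\<lambda>n. LINT x:\<Omega>|lborel. (cmod (\<psi> n x - (u x - v x)))\<^sup>2
              + (cmod (pd (\<psi> n) 1 x - g 1 x))\<^sup>2 + (cmod (pd (\<psi> n) 2 x - g 2 x))\<^sup>2) \<longlonglongrightarrow> 0"
    using z unfolding H10_def by blast
  have sq: "sq_int M u" "sq_int M v" "sq_int M (\<lambda>x. u x - v x)" "\<And>i. sq_int M (gu i)" "\<And>i. sq_int M (gv i)" "\<And>i. sq_int M (g i)"
    using u v g by (simp_all add: H1_grad_def L2)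
  define d where "d = (\<lambda>i x. gu i x - gv i x)"
  have sqd: "sq_int M (d i)" for i unfolding d_def by (rule sq_int_diff[OF sq(4) sq(5)])
  have ints: "integrable M (\<lambda>x. f x * w x)" if "sq_int M f" for f
    by (rule sq_int_mult_integrable[OF that wm nw])
  obtain \<theta> \<theta>' where \<theta>: "\<forall>s. (\<theta> has_real_derivative \<theta>' s) (at s)" "continuous_on UNIV \<theta>'"
    "\<forall>s\<le>0. \<theta> s = 1" "\<forall>s\<ge>1. \<theta> s = 0" "\<forall>s. \<bar>\<theta> s\<bar> \<le> 1" "\<forall>s<0. \<theta>' s = 0"
    by (rule cutoff_exists)
  have tb: "\<exists>B. \<forall>x. cmod (\<Phi> x) \<le> B" "\<exists>B. \<forall>x. cmod (pd \<Phi> i x) \<le> B" "continuous_on UNIV (pd \<Phi> i)" "continuous_on UNIV \<Phi>"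
    if t: "test_fn \<Phi>" for \<Phi> i
  proof -
    have K: "compact (closure {x. \<Phi> x \<noteq> 0})" and c: "continuous_on UNIV (pd \<Phi> i)" using t by (simp_all add: test_fn_def)
    show "\<exists>B. \<forall>x. cmod (\<Phi> x) \<le> B"
      using compact_support_bounded[OF test_fn_continuous[OF t] K zero_outside[of _ \<Phi>]] by blast
    show "\<exists>B. \<forall>x. cmod (pd \<Phi> i x) \<le> B"
      using compact_support_bounded[OF c K pd_zero_outside[where \<psi> = \<Phi> and i = i]] by blast
    show "continuous_on UNIV (pd \<Phi> i)" "continuous_on UNIV \<Phi>" using c test_fn_continuous[OF t] by auto
  qed
  have sqt: "sq_int M \<Phi>" "sq_int M (pd \<Phi> i)" if t: "test_fn \<Phi>" for \<Phi> i
  proof -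
    obtain B where "\<And>x. cmod (\<Phi> x) \<le> B" using tb(1)[OF t] by blast
    thus "sq_int M \<Phi>" by (rule sq_int_bounded[OF mM[OF tb(4)[OF t]]])
    obtain B where "\<And>x. cmod (pd \<Phi> i x) \<le> B" using tb(2)[OF t] by blast
    thus "sq_int M (pd \<Phi> i)" by (rule sq_int_bounded[OF mM[OF tb(3)[OF t]]])
  qed
  have intt: "integrable M (\<lambda>x. f x * \<Phi> x)" "integrable M (\<lambda>x. f x * pd \<Phi> i x)" if f: "sq_int M f" and t: "test_fn \<Phi>" for f \<Phi> i
  proof -
    obtain B where "\<And>x. cmod (\<Phi> x) \<le> B" using tb(1)[OF t] by blast
    thus "integrable M (\<lambda>x. f x * \<Phi> x)" by (rule sq_int_mult_integrable[OF f mM[OF tb(4)[OF t]]])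
    obtain B where "\<And>x. cmod (pd \<Phi> i x) \<le> B" using tb(2)[OF t] by blast
    thus "integrable M (\<lambda>x. f x * pd \<Phi> i x)" by (rule sq_int_mult_integrable[OF f mM[OF tb(3)[OF t]]])
  qed
  define p where "p = (\<lambda>i::2. \<i> * complex_of_real (if i = 1 then P1 else P2))"
  have p12: "p 1 * p 1 + p 2 * p 2 = - complex_of_real (k\<^sup>2 * q)"
    unfolding P[symmetric] by (simp add: p_def power2_eq_square algebra_simps)

  have step1: "integral\<^sup>L M (\<lambda>x. d 1 x * w x) * p 1 + integral\<^sup>L M (\<lambda>x. d 2 x * w x) * p 2
      - of_real (k\<^sup>2 * q) * integral\<^sup>L M (\<lambda>x. u x * w x) + of_real (k\<^sup>2) * integral\<^sup>L M (\<lambda>x. v x * w x) = 0"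
  proof -
    \<comment> \<open>The wave itself has no compact support. On the ellipse the argument of the
      cutoff is negative, so the product with w has the values and derivatives of w there.\<close>
    define X0 where "X0 = (\<lambda>x. complex_of_real (\<theta> (-1 + 1 * qform c t a b x)))"
    note qc = qform_cutoff[OF ab zero_less_one \<theta>(1,2,4), of "-1" c t, folded X0_def]
    define W where "W = (\<lambda>x. X0 x * w x)"
    have tW: "test_fn W" unfolding W_def w_def by (rule test_fn_mult_wave(1)[OF qc(1)])
    have one: "X0 x = 1" "pd X0 i x = 0" if "x \<in> \<Omega>" for x i
    proof -
      have neg: "-1 + 1 * qform c t a b x < 0" using that by (simp add: \<Omega>)
      thus "X0 x = 1" using \<theta>(3) by (simp add: X0_def)
      obtain dd where "\<forall>x. pd X0 i x = of_real (\<theta>' (-1 + 1 * qform c t a b x) * dd x)" using qc(3)[of i] by blast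
      thus "pd X0 i x = 0" using neg \<theta>(6) by simp
    qed
    have W: "W x = w x" "pd W i x = p i * w x" if "x \<in> \<Omega>" for x i
      using one[OF that] unfolding W_def w_def test_fn_mult_wave(2)[OF qc(1)] by (simp_all add: p_def)
    have "integral\<^sup>L M (\<lambda>x. gu 1 x * pd W 1 x + gu 2 x * pd W 2 x - of_real (k\<^sup>2 * q) * u x * W x)
        = integral\<^sup>L M (\<lambda>x. gu 1 x * w x * p 1 + gu 2 x * w x * p 2 - of_real (k\<^sup>2 * q) * (u x * w x))"
      by (rule Bochner_Integration.integral_cong) (auto simp: spM W mult_ac)
    also have "\<dots> = integral\<^sup>L M (\<lambda>x. gu 1 x * w x) * p 1 + integral\<^sup>L M (\<lambda>x. gu 2 x * w x) * p 2 - of_real (k\<^sup>2 * q) * integral\<^sup>L M (\<lambda>x. u x * w x)"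
      using ints sq by simp
    finally have L: "integral\<^sup>L M (\<lambda>x. gu 1 x * pd W 1 x + gu 2 x * pd W 2 x - of_real (k\<^sup>2 * q) * u x * W x) = \<dots>" .
    have "integral\<^sup>L M (\<lambda>x. gv 1 x * pd W 1 x + gv 2 x * pd W 2 x - of_real (k\<^sup>2) * v x * W x)
        = integral\<^sup>L M (\<lambda>x. gv 1 x * w x * p 1 + gv 2 x * w x * p 2 - of_real (k\<^sup>2) * (v x * w x))"
      by (rule Bochner_Integration.integral_cong) (auto simp: spM W mult_ac)
    also have "\<dots> = integral\<^sup>L M (\<lambda>x. gv 1 x * w x) * p 1 + integral\<^sup>L M (\<lambda>x. gv 2 x * w x) * p 2 - of_real (k\<^sup>2) * integral\<^sup>L M (\<lambda>x. v x * w x)"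
      using ints sq by simp
    finally have R: "integral\<^sup>L M (\<lambda>x. gv 1 x * pd W 1 x + gv 2 x * pd W 2 x - of_real (k\<^sup>2) * v x * W x) = \<dots>" .
    have "integral\<^sup>L M (\<lambda>x. d i x * w x) = integral\<^sup>L M (\<lambda>x. gu i x * w x) - integral\<^sup>L M (\<lambda>x. gv i x * w x)" for i
      unfolding d_def left_diff_distrib using ints sq by (intro Bochner_Integration.integral_diff) auto
    thus ?thesis using green[OF tW] unfolding LM L R by (simp only: left_diff_distrib) (simp add: algebra_simps)
  qed

  \<comment> \<open>\<open>H10\<close> comes with its own weak gradient \<open>g\<close> of u - v.
    It agrees with the difference of the given gradients when paired with test functions supported
    in the ellipse, and cutoffs carry this over to w.\<close>
  have step2: "integral\<^sup>L M (\<lambda>x. d i x * w x) = integral\<^sup>L M (\<lambda>x. g i x * w x)" for i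
  proof -
    have same: "integral\<^sup>L M (\<lambda>x. d i x * \<Phi> x) = integral\<^sup>L M (\<lambda>x. g i x * \<Phi> x)"
      if t: "test_fn \<Phi>" "closure {x. \<Phi> x \<noteq> 0} \<subseteq> \<Omega>" for \<Phi>
    proof -
      have "integral\<^sup>L M (\<lambda>x. u x * pd \<Phi> i x) = - integral\<^sup>L M (\<lambda>x. gu i x * \<Phi> x)"
        "integral\<^sup>L M (\<lambda>x. v x * pd \<Phi> i x) = - integral\<^sup>L M (\<lambda>x. gv i x * \<Phi> x)"
        "integral\<^sup>L M (\<lambda>x. (u x - v x) * pd \<Phi> i x) = - integral\<^sup>L M (\<lambda>x. g i x * \<Phi> x)"
        using u v g t unfolding H1_grad_def LM by blast+
      moreover have "integral\<^sup>L M (\<lambda>x. (u x - v x) * pd \<Phi> i x) = integral\<^sup>L M (\<lambda>x. u x * pd \<Phi> i x) - integral\<^sup>L M (\<lambda>x. v x * pd \<Phi> i x)"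
        unfolding left_diff_distrib by (intro Bochner_Integration.integral_diff intt sq t)
      moreover have "integral\<^sup>L M (\<lambda>x. d i x * \<Phi> x) = integral\<^sup>L M (\<lambda>x. gu i x * \<Phi> x) - integral\<^sup>L M (\<lambda>x. gv i x * \<Phi> x)"
        unfolding d_def left_diff_distrib by (intro Bochner_Integration.integral_diff intt sq t)
      ultimately show ?thesis by (simp add: algebra_simps)
    qed
    \<comment> \<open>Equals 1 where \<open>qform\<close> is at most (n - 1)/(n + 1) and 0 where it
      is at least n/(n + 1), so the support stays strictly inside while the plateau exhausts the
      ellipse.\<close>
    define X where "X = (\<lambda>n::nat. \<lambda>x. complex_of_real (\<theta> ((1 - real n) + (real n + 1) * qform c t a b x)))"
    have n1: "0 < real n + 1" for n by simp
    note qc = qform_cutoff[OF ab n1 \<theta>(1,2,4), of "1 - real n" n c t for n, folded X_def]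
    have tX: "test_fn (\<lambda>x. X n x * w x)" "closure {x. X n x * w x \<noteq> 0} \<subseteq> \<Omega>" for n
    proof -
      show "test_fn (\<lambda>x. X n x * w x)" unfolding w_def X_def by (rule test_fn_mult_wave(1)[OF qform_cutoff(1)[OF ab n1 \<theta>(1,2,4)]])
      have "closure {x. X n x \<noteq> 0} \<subseteq> {x. qform c t a b x \<le> (1 - (1 - real n)) / (real n + 1)}"
        unfolding X_def by (rule qform_cutoff(2)[OF ab n1 \<theta>(1,2,4)])
      also have "\<dots> \<subseteq> \<Omega>"
      proof
        fix x assume "x \<in> {x. qform c t a b x \<le> (1 - (1 - real n)) / (real n + 1)}"
        hence q: "qform c t a b x \<le> (1 - (1 - real n)) / (real n + 1)" by (simp only: mem_Collect_eq)
        have "(1 - (1 - real n)) / (real n + 1) < 1" by (simp add: divide_less_eq)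
        from le_less_trans[OF q this] show "x \<in> \<Omega>" by (simp only: \<Omega> mem_Collect_eq)
      qed
      finally show "closure {x. X n x * w x \<noteq> 0} \<subseteq> \<Omega>" by (simp add: w_def)
    qed
    have conv: "(\<lambda>n. integral\<^sup>L M (\<lambda>x. h x * (X n x * w x))) \<longlonglongrightarrow> integral\<^sup>L M (\<lambda>x. h x * w x)" if h: "sq_int M h" for h
    proof (rule integral_dominated_convergence[where w = "\<lambda>x. norm (h x * w x)"])
      show "(\<lambda>x. h x * w x) \<in> borel_measurable M" using ints[OF h] by (rule borel_measurable_integrable)
      show "(\<lambda>x. h x * (X n x * w x)) \<in> borel_measurable M" for n
        using intt(1)[OF h tX(1)] by (rule borel_measurable_integrable)
      show "integrable M (\<lambda>x. norm (h x * w x))" using ints[OF h] by (rule integrable_norm)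
      show "AE x in M. (\<lambda>n. h x * (X n x * w x)) \<longlonglongrightarrow> h x * w x"
      proof (rule AE_I2)
        fix x assume "x \<in> space M"
        hence N: "qform c t a b x < 1" by (simp add: spM \<Omega>)
        obtain n0 :: nat where n0: "2 / (1 - qform c t a b x) < real n0" using reals_Archimedean2 by blast
        have "X n x = 1" if "n \<ge> n0" for n
        proof -
          have "2 < real n0 * (1 - qform c t a b x)" using n0 N by (simp add: field_simps)
          also have "\<dots> \<le> (real n + 1) * (1 - qform c t a b x)" using N that by (intro mult_right_mono) auto
          finally have "(1 - real n) + (real n + 1) * qform c t a b x \<le> 0" by (simp add: algebra_simps)
          thus ?thesis using \<theta>(3) by (simp add: X_def)
        qed
        hence "eventually (\<lambda>n. h x * (X n x * w x) = h x * w x) sequentially"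
          unfolding eventually_sequentially by (intro exI[of _ n0]) simp
        thus "(\<lambda>n. h x * (X n x * w x)) \<longlonglongrightarrow> h x * w x" by (rule tendsto_eventually)
      qed
      show "AE x in M. norm (h x * (X n x * w x)) \<le> norm (h x * w x)" for n
      proof (rule AE_I2)
        fix x
        have "cmod (X n x) \<le> 1" using \<theta>(5) by (simp add: X_def)
        hence "cmod (h x) * (cmod (X n x) * cmod (w x)) \<le> cmod (h x) * (1 * cmod (w x))"
          by (intro mult_left_mono mult_right_mono) auto
        thus "norm (h x * (X n x * w x)) \<le> norm (h x * w x)" by (simp add: norm_mult)
      qed
    qed
    have "(\<lambda>n. integral\<^sup>L M (\<lambda>x. d i x * (X n x * w x))) \<longlonglongrightarrow> integral\<^sup>L M (\<lambda>x. g i x * w x)"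
      using conv[OF sq(6)[of i]] by (simp only: same[OF tX])
    with conv[OF sqd[of i]] show ?thesis by (rule LIMSEQ_unique)
  qed

  have step3: "integral\<^sup>L M (\<lambda>x. g 1 x * w x) * p 1 + integral\<^sup>L M (\<lambda>x. g 2 x * w x) * p 2
      - of_real (k\<^sup>2 * q) * integral\<^sup>L M (\<lambda>x. (u x - v x) * w x) = 0"
  proof -
    \<comment> \<open>The product with w is again a test function supported in the ellipse, so its
      partial derivatives integrate to 0; the product rule gives the rest.\<close>
    have pw: "integral\<^sup>L M (\<lambda>x. pd (\<psi> n) i x * w x) = - (p i * integral\<^sup>L M (\<lambda>x. \<psi> n x * w x))" for n i
    proof -
      define \<Phi> where "\<Phi> = (\<lambda>x. \<psi> n x * w x)"
      have t: "test_fn \<Phi>" "closure {x. \<Phi> x \<noteq> 0} \<subseteq> \<Omega>" and pdP: "pd \<Phi> i x = pd (\<psi> n) i x * w x + p i * (\<psi> n x * w x)" for x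
        unfolding \<Phi>_def w_def using test_fn_mult_wave[OF \<psi>(1)[of n], of P1 P2] \<psi>(2)[of n] by (simp_all add: p_def mult_ac)
      have "integral\<^sup>L M (pd \<Phi> i) = (LINT x|lborel. indicator \<Omega> x *\<^sub>R pd \<Phi> i x)"
        using LM[of "pd \<Phi> i"] by (simp add: set_lebesgue_integral_def)
      also have "\<dots> = (LINT x|lborel. pd \<Phi> i x)"
      proof (rule Bochner_Integration.integral_cong[OF refl])
        fix x show "indicator \<Omega> x *\<^sub>R pd \<Phi> i x = pd \<Phi> i x"
          using t(2) pd_zero_outside[where x = x and \<psi> = \<Phi> and i = i] by (cases "x \<in> \<Omega>") auto
      qed
      also have "\<dots> = 0" by (rule test_fn_integral_pd[OF t(1)])
      finally have z0: "0 = integral\<^sup>L M (pd \<Phi> i)" by simp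
      have pdP': "pd \<Phi> i = (\<lambda>x. pd (\<psi> n) i x * w x + p i * (\<psi> n x * w x))" by (rule ext) (rule pdP)
      have "0 = integral\<^sup>L M (\<lambda>x. pd (\<psi> n) i x * w x + p i * (\<psi> n x * w x))"
        using z0 unfolding pdP' .
      also have "\<dots> = integral\<^sup>L M (\<lambda>x. pd (\<psi> n) i x * w x) + p i * integral\<^sup>L M (\<lambda>x. \<psi> n x * w x)"
        using ints[OF sqt(1)[OF \<psi>(1)[of n]]] ints[OF sqt(2)[OF \<psi>(1)[of n]]] by simp
      finally show ?thesis by (simp add: add_eq_0_iff2)
    qed
    define S where "S = (\<lambda>n x. (cmod (\<psi> n x - (u x - v x)))\<^sup>2
              + (cmod (pd (\<psi> n) 1 x - g 1 x))\<^sup>2 + (cmod (pd (\<psi> n) 2 x - g 2 x))\<^sup>2)"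
    have e0: "sq_int M (\<lambda>x. \<psi> n x - (u x - v x))" for n by (rule sq_int_diff[OF sqt(1)[OF \<psi>(1)] sq(3)])
    have ei: "sq_int M (\<lambda>x. pd (\<psi> n) i x - g i x)" for n i by (rule sq_int_diff[OF sqt(2)[OF \<psi>(1)] sq(6)])
    have Si: "integrable M (S n)" for n
      using e0[of n] ei[of n 1] ei[of n 2] unfolding S_def sq_int_def by (intro Bochner_Integration.integrable_add) auto
    have Slim: "(\<lambda>n. integral\<^sup>L M (S n)) \<longlonglongrightarrow> 0" using lim unfolding LMr S_def .
    have t0: "(\<lambda>n. integral\<^sup>L M (\<lambda>x. (\<psi> n x - (u x - v x)) * w x)) \<longlonglongrightarrow> 0"
      by (rule sq_int_tendsto_imp_L1[OF e0 Si _ Slim wm nw]) (simp add: S_def)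
    have t1: "(\<lambda>n. integral\<^sup>L M (\<lambda>x. (pd (\<psi> n) 1 x - g 1 x) * w x)) \<longlonglongrightarrow> 0"
      by (rule sq_int_tendsto_imp_L1[OF ei Si _ Slim wm nw]) (simp add: S_def)
    have t2: "(\<lambda>n. integral\<^sup>L M (\<lambda>x. (pd (\<psi> n) 2 x - g 2 x) * w x)) \<longlonglongrightarrow> 0"
      by (rule sq_int_tendsto_imp_L1[OF ei Si _ Slim wm nw]) (simp add: S_def)
    have dist: "integral\<^sup>L M (\<lambda>x. (h x - h' x) * w x) = integral\<^sup>L M (\<lambda>x. h x * w x) - integral\<^sup>L M (\<lambda>x. h' x * w x)"
      if "sq_int M h" "sq_int M h'" for h h'
      unfolding left_diff_distrib using ints that by (intro Bochner_Integration.integral_diff) auto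
    define Z where "Z = integral\<^sup>L M (\<lambda>x. g 1 x * w x) * p 1 + integral\<^sup>L M (\<lambda>x. g 2 x * w x) * p 2
      - of_real (k\<^sup>2 * q) * integral\<^sup>L M (\<lambda>x. (u x - v x) * w x)"
    have "(\<lambda>n. integral\<^sup>L M (\<lambda>x. (pd (\<psi> n) 1 x - g 1 x) * w x) * p 1 + integral\<^sup>L M (\<lambda>x. (pd (\<psi> n) 2 x - g 2 x) * w x) * p 2
      - of_real (k\<^sup>2 * q) * integral\<^sup>L M (\<lambda>x. (\<psi> n x - (u x - v x)) * w x)) \<longlonglongrightarrow> 0 * p 1 + 0 * p 2 - of_real (k\<^sup>2 * q) * 0"
      by (intro tendsto_intros t0 t1 t2)
    moreover have "integral\<^sup>L M (\<lambda>x. (pd (\<psi> n) 1 x - g 1 x) * w x) * p 1 + integral\<^sup>L M (\<lambda>x. (pd (\<psi> n) 2 x - g 2 x) * w x) * p 2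
      - of_real (k\<^sup>2 * q) * integral\<^sup>L M (\<lambda>x. (\<psi> n x - (u x - v x)) * w x) = - Z" for n
    proof -
      define I where "I = integral\<^sup>L M (\<lambda>x. \<psi> n x * w x)"
      have "integral\<^sup>L M (\<lambda>x. (pd (\<psi> n) 1 x - g 1 x) * w x) * p 1 + integral\<^sup>L M (\<lambda>x. (pd (\<psi> n) 2 x - g 2 x) * w x) * p 2
      - of_real (k\<^sup>2 * q) * integral\<^sup>L M (\<lambda>x. (\<psi> n x - (u x - v x)) * w x)
        = - (p 1 * p 1 + p 2 * p 2) * I - of_real (k\<^sup>2 * q) * I - Z"
        unfolding dist[OF sqt(2)[OF \<psi>(1)] sq(6)] dist[OF sqt(1)[OF \<psi>(1)] sq(3)] pw I_def[symmetric] Z_def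
        by (simp only: algebra_simps mult_minus_left mult_minus_right minus_add_distrib minus_minus)
      thus ?thesis unfolding p12 by simp
    qed
    ultimately have "(\<lambda>n::nat. - Z) \<longlonglongrightarrow> 0" by simp
    thus ?thesis unfolding Z_def[symmetric] by (simp add: LIMSEQ_const_iff)
  qed

  have uv: "integral\<^sup>L M (\<lambda>x. (u x - v x) * w x) = integral\<^sup>L M (\<lambda>x. u x * w x) - integral\<^sup>L M (\<lambda>x. v x * w x)"
    unfolding left_diff_distrib using ints sq by (intro Bochner_Integration.integral_diff) auto
  have "of_real (k\<^sup>2 * (1 - q)) * integral\<^sup>L M (\<lambda>x. v x * w x) = 0"
  proof -
    have gen: "(c1 - c2) * V = 0" if "A - c2 * U + c1 * V = 0" "A - c2 * (U - V) = 0" for c1 c2 V U A :: complex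
      using that by algebra
    have e: "complex_of_real (k\<^sup>2 * (1 - q)) = of_real (k\<^sup>2) - of_real (k\<^sup>2 * q)"
      by (simp add: algebra_simps)
    show ?thesis unfolding e
      by (rule gen[OF step1[unfolded step2] step3[unfolded uv]])
  qed
  moreover have "complex_of_real (k\<^sup>2 * (1 - q)) \<noteq> 0" using k q by (simp del: of_real_mult)
  ultimately show ?thesis using LM[of "\<lambda>x. v x * w x"] by (simp add: \<Omega>_def)
qed

section \<open>Finiteness\<close>

lemma swap_LINT:
  fixes h :: "real \<Rightarrow> real^2 \<Rightarrow> complex"
  assumes h: "continuous_on UNIV (\<lambda>(\<theta>, x). h \<theta> x)" and \<Omega>: "\<Omega> \<in> sets lborel" "\<Omega> \<subseteq> K" "compact K"
  shows "(LINT x:\<Omega>|lborel. integral {p..r} (\<lambda>\<theta>. h \<theta> x)) = integral {p..r} (\<lambda>\<theta>. LINT x:\<Omega>|lborel. h \<theta> x)"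
proof -
  have h1: "continuous_on A (\<lambda>\<theta>. h \<theta> x)" for A x
  proof -
    have "continuous_on A (\<lambda>\<theta>. (\<lambda>(\<theta>, x). h \<theta> x) (\<theta>, x))" by (rule continuous_on_compose2[OF h]) (auto intro!: continuous_intros)
    thus ?thesis by simp
  qed
  have "set_integrable lborel ({p..r} \<times> K) (\<lambda>(\<theta>, x). h \<theta> x)"
    unfolding set_integrable_def using \<Omega> by (intro borel_integrable_compact compact_Times continuous_on_subset[OF h]) auto
  moreover have "{p..r} \<times> \<Omega> \<in> sets (lborel \<Otimes>\<^sub>M lborel)" using \<Omega> by auto
  hence "{p..r} \<times> \<Omega> \<in> sets (lborel :: (real \<times> (real^2)) measure)" by (simp only: lborel_prod)
  ultimately have "set_integrable lborel ({p..r} \<times> \<Omega>) (\<lambda>(\<theta>, x). h \<theta> x)"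
    using \<Omega> by (elim set_integrable_subset) auto
  moreover have "(\<lambda>z. indicator ({p..r} \<times> \<Omega>) z *\<^sub>R (case z of (\<theta>, x) \<Rightarrow> h \<theta> x)) = (\<lambda>(\<theta>, x). indicator {p..r} \<theta> *\<^sub>R indicator \<Omega> x *\<^sub>R h \<theta> x)"
    by (auto simp: fun_eq_iff indicator_def)
  ultimately have int: "integrable (lborel \<Otimes>\<^sub>M lborel) (\<lambda>(\<theta>, x). indicator {p..r} \<theta> *\<^sub>R indicator \<Omega> x *\<^sub>R h \<theta> x)"
    unfolding set_integrable_def lborel_prod by (simp only:)
  have inner: "(LINT \<theta>|lborel. indicator {p..r} \<theta> *\<^sub>R indicator \<Omega> x *\<^sub>R h \<theta> x) = indicator \<Omega> x *\<^sub>R integral {p..r} (\<lambda>\<theta>. h \<theta> x)" for x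
  proof -
    have "set_integrable lborel {p..r} (\<lambda>\<theta>. h \<theta> x)" unfolding set_integrable_def
      by (intro borel_integrable_compact h1) auto
    from set_borel_integral_eq_integral(2)[OF this]
    have e: "(LINT \<theta>|lborel. indicator {p..r} \<theta> *\<^sub>R h \<theta> x) = integral {p..r} (\<lambda>\<theta>. h \<theta> x)" by (simp add: set_lebesgue_integral_def)
    show ?thesis by (cases "x \<in> \<Omega>") (simp_all add: e)
  qed
  have outer: "(LINT x|lborel. indicator {p..r} \<theta> *\<^sub>R indicator \<Omega> x *\<^sub>R h \<theta> x) = indicator {p..r} \<theta> *\<^sub>R (LINT x:\<Omega>|lborel. h \<theta> x)" for \<theta>
    by (cases "\<theta> \<in> {p..r}") (simp_all add: set_lebesgue_integral_def)
  have "set_integrable lborel {p..r} (\<lambda>\<theta>. LINT x:\<Omega>|lborel. h \<theta> x)"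
    using lborel_pair.integrable_fst[OF int] unfolding set_integrable_def outer .
  from set_borel_integral_eq_integral(2)[OF this]
  have "(LINT \<theta>|lborel. (LINT x|lborel. indicator {p..r} \<theta> *\<^sub>R indicator \<Omega> x *\<^sub>R h \<theta> x)) = integral {p..r} (\<lambda>\<theta>. LINT x:\<Omega>|lborel. h \<theta> x)"
    unfolding outer by (simp add: set_lebesgue_integral_def)
  moreover have "(LINT x|lborel. (LINT \<theta>|lborel. indicator {p..r} \<theta> *\<^sub>R indicator \<Omega> x *\<^sub>R h \<theta> x)) = (LINT x:\<Omega>|lborel. integral {p..r} (\<lambda>\<theta>. h \<theta> x))"
    unfolding inner by (simp add: set_lebesgue_integral_def)
  ultimately show ?thesis using lborel_pair.Fubini_integral[OF int] by (simp only:)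
qed

text \<open>Shifting the density angle by \<open>t\<close> expresses the wave in coordinates along
  the axes of the ellipse, as \<open>focal_ellipse\<close> requires.\<close>

lemma herglotz_rotate:
  assumes "continuous_on UNIV \<phi>" "\<And>s. \<phi> (s + 2 * pi) = \<phi> s"
  shows "herglotz k \<phi> x = integral {-pi..pi} (\<lambda>\<theta>. \<phi> (\<theta> + t) *
     cis (k * (cos \<theta> * (cos t * x$1 + sin t * x$2) + sin \<theta> * (- sin t * x$1 + cos t * x$2))))"
proof -
  let ?h = "\<lambda>s. \<phi> s * cis (k * (cos s * x$1 + sin s * x$2))"
  have "herglotz k \<phi> x = integral {-pi..pi} ?h" by (simp add: herglotz_def cis_conv_exp)
  also have "\<dots> = integral {-pi..pi} (\<lambda>\<theta>. ?h (\<theta> + t))"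
    by (rule integral_periodic_shift[symmetric]) (auto intro!: continuous_intros assms(1) simp: assms(2))
  also have "(\<lambda>\<theta>. ?h (\<theta> + t)) = (\<lambda>\<theta>. \<phi> (\<theta> + t) *
     cis (k * (cos \<theta> * (cos t * x$1 + sin t * x$2) + sin \<theta> * (- sin t * x$1 + cos t * x$2))))"
    by (simp add: cos_add sin_add algebra_simps)
  finally show ?thesis .
qed

section \<open>From non-scattering to zeros of \<open>H\<close>, and finiteness\<close>

context focal_ellipse begin

text \<open>In coordinates along the axes, the product of a Herglotz component and the test wave has
  frequency p = k (omega + sqrt q eta). For m = sqrt q eta - omega, the product m.p is the constant
  k (q - 1), so the boundary formula can be applied under the integral over the density
  angle.\<close>

lemma non_scattering_imp_H_zero:
  fixes c :: "real^2"
  assumes \<phi>: "C1_periodic \<phi>" and c: "c = (- f) *\<^sub>R vector [cos t, sin t]" and k: "k > 0"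
    and ns: "non_scattering (ellipse_region c t a b) q k (herglotz k \<phi>)"
  shows "H (\<lambda>\<theta>. \<phi> (\<theta> + t)) k \<alpha> = 0"
proof -
  define \<Omega> where "\<Omega> = ellipse_region c t a b"
  define X where "X = (\<lambda>x::real^2. cos t * x$1 + sin t * x$2)"
  define Y where "Y = (\<lambda>x::real^2. - sin t * x$1 + cos t * x$2)"
  define p1 where "p1 = (\<lambda>\<theta>. k * (cos \<theta> + sqrt q * cos \<alpha>))"
  define p2 where "p2 = (\<lambda>\<theta>. k * (sin \<theta> + sqrt q * sin \<alpha>))"
  define m1 where "m1 = (\<lambda>\<theta>. sqrt q * cos \<alpha> - cos \<theta>)"
  define m2 where "m2 = (\<lambda>\<theta>. sqrt q * sin \<alpha> - sin \<theta>)"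
  \<comment> \<open>(P1, P2) is k sqrt q times the direction of angle \<alpha> + t: in the original
    coordinates the test direction is turned by \<open>t\<close>.\<close>
  define P1 where "P1 = k * sqrt q * (cos \<alpha> * cos t - sin \<alpha> * sin t)"
  define P2 where "P2 = k * sqrt q * (cos \<alpha> * sin t + sin \<alpha> * cos t)"
  have c\<phi>: "continuous_on A (\<lambda>z. \<phi> (g z))" if "continuous_on A g" for A and g :: "'x::t2_space \<Rightarrow> real"
    by (rule continuous_on_compose2[OF C1_periodic_continuous[OF \<phi>] that]) auto
  have P: "P1\<^sup>2 + P2\<^sup>2 = k\<^sup>2 * q"
  proof -
    have "P1\<^sup>2 + P2\<^sup>2 = k\<^sup>2 * (sqrt q)\<^sup>2 * (((cos \<alpha>)\<^sup>2 + (sin \<alpha>)\<^sup>2) * ((cos t)\<^sup>2 + (sin t)\<^sup>2))"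
      unfolding P1_def P2_def by algebra
    thus ?thesis using q_pos by simp
  qed
  have \<Omega>q: "\<Omega> = {x. qform c t a b x < 1}" by (simp add: \<Omega>_def ellipse_region_def qform_def)
  have \<Omega>m: "\<Omega> \<in> sets lborel"
    unfolding \<Omega>_def ellipse_region_def sets_lborel by (intro borel_open open_Collect_less continuous_intros) (use a_pos b_pos in auto)
  have "(LINT x:\<Omega>|lborel. herglotz k \<phi> x * cis (P1 * x$1 + P2 * x$2)) = 0"
    unfolding \<Omega>_def using non_scattering_orthogonal[OF a_pos b_pos _ q_ne P ns] k by simp
  moreover have "herglotz k \<phi> x * cis (P1 * x$1 + P2 * x$2)
      = integral {-pi..pi} (\<lambda>\<theta>. \<phi> (\<theta> + t) * cis (p1 \<theta> * X x + p2 \<theta> * Y x))" for x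
  proof -
    have e: "k * (cos \<theta> * X x + sin \<theta> * Y x) + (P1 * x$1 + P2 * x$2) = p1 \<theta> * X x + p2 \<theta> * Y x" for \<theta>
      by (simp add: p1_def p2_def P1_def P2_def X_def Y_def algebra_simps)
    have "herglotz k \<phi> x * cis (P1 * x$1 + P2 * x$2)
       = integral {-pi..pi} (\<lambda>\<theta>. \<phi> (\<theta> + t) * cis (k * (cos \<theta> * X x + sin \<theta> * Y x)) * cis (P1 * x$1 + P2 * x$2))"
      using herglotz_rotate[OF C1_periodic_continuous[OF \<phi>] C1_periodic_per[OF \<phi>], of k x t] unfolding X_def Y_def
      by (simp only: integral_mult_left)
    thus ?thesis by (simp only: mult.assoc cis_mult e)
  qed
  ultimately have "(LINT x:\<Omega>|lborel. integral {-pi..pi} (\<lambda>\<theta>. \<phi> (\<theta> + t) * cis (p1 \<theta> * X x + p2 \<theta> * Y x))) = 0" by simp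
  moreover have "(LINT x:\<Omega>|lborel. integral {-pi..pi} (\<lambda>\<theta>. \<phi> (\<theta> + t) * cis (p1 \<theta> * X x + p2 \<theta> * Y x)))
     = integral {-pi..pi} (\<lambda>\<theta>. LINT x:\<Omega>|lborel. \<phi> (\<theta> + t) * cis (p1 \<theta> * X x + p2 \<theta> * Y x))"
  proof (rule swap_LINT[OF _ \<Omega>m _ qform_bounded[OF a_pos b_pos, of c t 1]])
    show "continuous_on UNIV (\<lambda>(\<theta>, x). \<phi> (\<theta> + t) * cis (p1 \<theta> * X x + p2 \<theta> * Y x))"
      unfolding case_prod_unfold p1_def p2_def X_def Y_def by (intro continuous_intros c\<phi>)
  qed (auto simp: \<Omega>q)
  ultimately have z: "integral {-pi..pi} (\<lambda>\<theta>. LINT x:\<Omega>|lborel. \<phi> (\<theta> + t) * cis (p1 \<theta> * X x + p2 \<theta> * Y x)) = 0" by simp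
  have mp: "m1 \<theta> * p1 \<theta> + m2 \<theta> * p2 \<theta> = k * (q - 1)" for \<theta>
  proof -
    have "m1 \<theta> * p1 \<theta> + m2 \<theta> * p2 \<theta> = k * ((sqrt q)\<^sup>2 * ((cos \<alpha>)\<^sup>2 + (sin \<alpha>)\<^sup>2) - ((cos \<theta>)\<^sup>2 + (sin \<theta>)\<^sup>2))"
      unfolding m1_def m2_def p1_def p2_def by algebra
    thus ?thesis using q_pos by simp
  qed
  let ?B = "\<lambda>\<theta> s. of_real (m1 \<theta> * (b * cos s) + m2 \<theta> * (a * sin s)) * cis (p1 \<theta> * (a * cos s - f) + p2 \<theta> * (b * sin s))"
  have bd: "\<i> * of_real (k * (q - 1)) * (LINT x:\<Omega>|lborel. \<phi> (\<theta> + t) * cis (p1 \<theta> * X x + p2 \<theta> * Y x))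
      = integral {-pi..pi} (\<lambda>s. \<phi> (\<theta> + t) * ?B \<theta> s)" for \<theta>
  proof -
    have "(LINT x:\<Omega>|lborel. \<phi> (\<theta> + t) * cis (p1 \<theta> * X x + p2 \<theta> * Y x)) = \<phi> (\<theta> + t) * (LINT x:\<Omega>|lborel. cis (p1 \<theta> * X x + p2 \<theta> * Y x))"
      by (rule set_integral_mult_right)
    moreover have "\<i> * of_real (k * (q - 1)) * (LINT x:\<Omega>|lborel. cis (p1 \<theta> * X x + p2 \<theta> * Y x)) = integral {-pi..pi} (?B \<theta>)"
      using ellipse_boundary_integral[OF a_pos b_pos c, of "m1 \<theta>" "p1 \<theta>" "m2 \<theta>" "p2 \<theta>"] unfolding mp \<Omega>_def X_def Y_def .
    ultimately show ?thesis by (simp only: integral_mult_right mult.left_commute)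
  qed
  have "0 = \<i> * of_real (k * (q - 1)) * integral {-pi..pi} (\<lambda>\<theta>. LINT x:\<Omega>|lborel. \<phi> (\<theta> + t) * cis (p1 \<theta> * X x + p2 \<theta> * Y x))"
    unfolding z by simp
  also have "\<dots> = integral {-pi..pi} (\<lambda>\<theta>. \<i> * of_real (k * (q - 1)) * (LINT x:\<Omega>|lborel. \<phi> (\<theta> + t) * cis (p1 \<theta> * X x + p2 \<theta> * Y x)))"
    by (simp only: integral_mult_right)
  also have "\<dots> = integral {-pi..pi} (\<lambda>\<theta>. integral {-pi..pi} (\<lambda>s. \<phi> (\<theta> + t) * ?B \<theta> s))"
    by (simp only: bd)
  also have "\<dots> = integral {-pi..pi} (\<lambda>s. integral {-pi..pi} (\<lambda>\<theta>. \<phi> (\<theta> + t) * ?B \<theta> s))"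
    by (rule integral_swap_rect) (unfold case_prod_unfold m1_def m2_def p1_def p2_def, intro continuous_intros c\<phi>)
  also have "\<dots> = H (\<lambda>\<theta>. \<phi> (\<theta> + t)) k \<alpha>"
  proof -
    have "p1 \<theta> * (a * cos s - f) + p2 \<theta> * (b * sin s)
        = k * ((cos \<theta> + sqrt q * cos \<alpha>) * xx s + (sin \<theta> + sqrt q * sin \<alpha>) * yy s)" for \<theta> s
      by (simp add: p1_def p2_def xx_def yy_def algebra_simps)
    thus ?thesis by (simp only: H_def m1_def m2_def mult.assoc)
  qed
  finally show ?thesis by simp
qed

text \<open>The wave number occurs only linearly in an exponent, and the domain of integration is
  compact, so differentiation under the integral applies for complex k.\<close>

lemma H_holomorphic:
  assumes \<phi>: "C1_periodic \<phi>"
  obtains h where "h holomorphic_on UNIV" "\<And>k. h (of_real k) = H \<phi> k \<alpha>"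
proof -
  define A where "A = (\<lambda>z. \<phi> (snd z) * complex_of_real ((sqrt q * cos \<alpha> - cos (snd z)) * (b * cos (fst z)) + (sqrt q * sin \<alpha> - sin (snd z)) * (a * sin (fst z))))"
  define \<Phi> where "\<Phi> = (\<lambda>z. (cos (snd z) + sqrt q * cos \<alpha>) * xx (fst z) + (sin (snd z) + sqrt q * sin \<alpha>) * yy (fst z))"
  define h where "h = (\<lambda>k::complex. integral (cbox (-pi,-pi) (pi,pi)) (\<lambda>z. A z * exp (k * (\<i> * of_real (\<Phi> z)))))"
  have c\<phi>: "continuous_on S (\<lambda>z. \<phi> (g z))" if "continuous_on S g" for S and g :: "'x::t2_space \<Rightarrow> real"
    by (rule continuous_on_compose2[OF C1_periodic_continuous[OF \<phi>] that]) auto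
  have cA: "continuous_on S (\<lambda>x. A (g x))" "continuous_on S (\<lambda>x. \<Phi> (g x))" if "continuous_on S g" for S and g :: "'x::t2_space \<Rightarrow> real \<times> real"
    unfolding A_def \<Phi>_def using that by (intro continuous_intros c\<phi>; simp)+
  have "h holomorphic_on UNIV"
    unfolding h_def
  proof (rule leibniz_rule_holomorphic)
    fix k z
    show "((\<lambda>k. A z * exp (k * (\<i> * of_real (\<Phi> z)))) has_field_derivative A z * (exp (k * (\<i> * of_real (\<Phi> z))) * (\<i> * of_real (\<Phi> z)))) (at k within UNIV)"
      by (auto intro!: derivative_eq_intros)
    show "(\<lambda>z. A z * exp (k * (\<i> * of_real (\<Phi> z)))) integrable_on cbox (-pi,-pi) (pi,pi)"
      by (intro integrable_continuous continuous_intros cA)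
    show "continuous_on (UNIV \<times> cbox (-pi,-pi) (pi,pi)) (\<lambda>(k, z). A z * (exp (k * (\<i> * of_real (\<Phi> z))) * (\<i> * of_real (\<Phi> z))))"
      unfolding case_prod_unfold by (intro continuous_intros cA)
  qed auto
  moreover have "h (of_real k) = H \<phi> k \<alpha>" for k
  proof -
    have "h (of_real k) = integral (cbox (-pi,-pi) (pi,pi)) (\<lambda>z. A z * cis (k * \<Phi> z))"
      by (simp add: h_def cis_conv_exp mult_ac)
    also have "\<dots> = integral (cbox (-pi) pi) (\<lambda>s. integral (cbox (-pi) pi) (\<lambda>\<theta>. A (s, \<theta>) * cis (k * \<Phi> (s, \<theta>))))"
      by (rule integral_prod_continuous) (intro continuous_intros cA)
    finally show ?thesis by (simp only: H_def A_def \<Phi>_def fst_conv snd_conv cbox_interval)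
  qed
  ultimately show thesis by (rule that)
qed

lemma finite_non_scattering:
  fixes c :: "real^2"
  assumes \<phi>: "C1_periodic \<phi>" and nz: "\<phi> s0 \<noteq> 0" and c: "c = (- f) *\<^sub>R vector [cos t, sin t]"
  shows "finite {k. k > 0 \<and> non_scattering (ellipse_region c t a b) q k (herglotz k \<phi>)}"
proof (rule ccontr)
  define K where "K = {k. k > 0 \<and> non_scattering (ellipse_region c t a b) q k (herglotz k \<phi>)}"
  assume "infinite {k. k > 0 \<and> non_scattering (ellipse_region c t a b) q k (herglotz k \<phi>)}"
  hence inf: "infinite K" by (simp add: K_def)
  define \<phi>t where "\<phi>t = (\<lambda>\<theta>. \<phi> (\<theta> + t))"
  have \<phi>t: "C1_periodic \<phi>t" unfolding \<phi>t_def
    by (rule C1_periodic_lift[OF \<phi>, where h' = "\<lambda>_. 1"]) (auto intro!: derivative_eq_intros simp: complex_eq_iff add_ac, simp_all add: cos_add sin_add)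
  have nzt: "\<phi>t (s0 - t) \<noteq> 0" using nz by (simp add: \<phi>t_def)
  have zero: "H \<phi>t k \<alpha> = 0" if "k \<in> K" for k \<alpha>
    using non_scattering_imp_H_zero[OF \<phi> c] that by (simp add: K_def \<phi>t_def)
  have "\<exists>kn. filterlim kn at_top sequentially \<and> (\<forall>n::nat. \<forall>\<alpha>. H \<phi>t (kn n) \<alpha> = 0)"
  proof (cases "\<exists>B. \<forall>k\<in>K. k \<le> B")
    \<comment> \<open>If the wave numbers stay bounded they accumulate, so \<open>H\<close> vanishes
      at every real k and the sequence kn = n serves as the unbounded one.\<close>
    case True
    then obtain B where B: "\<And>k. k \<in> K \<Longrightarrow> k \<le> B" by blast
    define U where "U = complex_of_real ` K"
    have "infinite U" using inf by (simp add: U_def finite_image_iff inj_on_def)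
    moreover have "U \<subseteq> cball 0 B" using B by (auto simp: U_def K_def)
    ultimately obtain \<xi> where \<xi>: "\<xi> islimpt U"
      using Heine_Borel_imp_Bolzano_Weierstrass[OF compact_cball] by blast
    have "H \<phi>t k \<alpha> = 0" for k \<alpha>
    proof -
      obtain h where h: "h holomorphic_on UNIV" "\<And>k. h (of_real k) = H \<phi>t k \<alpha>" using H_holomorphic[OF \<phi>t, of \<alpha>] by blast
      have "h (of_real k) = 0"
      proof (rule analytic_continuation[OF h(1) open_UNIV connected_UNIV subset_UNIV UNIV_I \<xi>])
        fix z assume "z \<in> U"
        thus "h z = 0" using zero h(2) by (auto simp: U_def)
      qed simp
      thus ?thesis by (simp add: h(2))
    qed
    thus ?thesis using filterlim_real_sequentially by blast
  next
    case False
    hence "\<forall>n::nat. \<exists>k\<in>K. real n < k" by (meson not_le)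
    then obtain kn where kn: "\<And>n::nat. kn n \<in> K \<and> real n < kn n" by metis
    have "filterlim kn at_top sequentially"
      by (rule filterlim_at_top_mono[OF filterlim_real_sequentially always_eventually]) (simp add: kn less_imp_le)
    thus ?thesis using zero kn by blast
  qed
  then obtain kn where "filterlim kn at_top sequentially" "\<And>n \<alpha>. H \<phi>t (kn n) \<alpha> = 0" by blast
  thus False by (rule no_unbounded_zeros[OF \<phi>t nzt])
qed

end

theorem theorem3:
  fixes q a b t :: real and c :: "real^2" and \<phi> :: "real \<Rightarrow> complex"
  assumes q_pos: "q > 0" and q_ne: "q \<noteq> 1"
    and axes: "0 < b" "b \<le> a"
    and focus: "0 \<in> ellipse_foci c t a b"
    and ecc_big: "q > 1 \<or> (1/4 < q \<and> q < 1) \<Longrightarrow>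
                  0 < (eccentricity a b)\<^sup>2 \<and> (eccentricity a b)\<^sup>2 < 3/4 - 1 / (4 * sqrt q)"
    and ecc_small: "q \<le> 1/4 \<Longrightarrow> 0 < (eccentricity a b)\<^sup>2 \<and> (eccentricity a b)\<^sup>2 < q"
    and phi_C1: "\<phi> C1_differentiable_on UNIV"
    and phi_per: "\<forall>s. \<phi> (s + 2 * pi) = \<phi> s"
    and phi_nz: "\<exists>s. \<phi> s \<noteq> 0"
  shows "finite {k. k > 0 \<and> non_scattering (ellipse_region c t a b) q k (herglotz k \<phi>)}"
proof -
  have a: "a > 0" using axes by simp
  have ba: "b\<^sup>2 \<le> a\<^sup>2" using axes by (intro power_mono) auto
  have ecc: "(eccentricity a b)\<^sup>2 = 1 - b\<^sup>2 / a\<^sup>2"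
    using ba a by (simp add: eccentricity_def)
  have e: "0 < 1 - b\<^sup>2 / a\<^sup>2" "1 - b\<^sup>2 / a\<^sup>2 < q"
  proof -
    show "0 < 1 - b\<^sup>2 / a\<^sup>2" using ecc_big ecc_small q_ne unfolding ecc by linarith
    consider "q \<le> 1/4" | "1/4 < q" "q < 1" | "q > 1" using q_ne by linarith
    thus "1 - b\<^sup>2 / a\<^sup>2 < q"
    proof cases
      case 1
      thus ?thesis using ecc_small unfolding ecc by simp
    next
      case 2
      define s where "s = sqrt q"
      have s: "s > 0" "s * s = q" using q_pos by (simp_all add: s_def)
      \<comment> \<open>Divided by 4 s this is s^2 >= 3/4 - 1/(4 s). Equality holds at s = 1/2, that
        is q = 1/4, where the two eccentricity bounds meet.\<close>
      have "0 \<le> (s + 1) * (2 * s - 1)\<^sup>2" using s by simp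
      also have "\<dots> = 4 * (s * s) * s - 3 * s + 1" by (simp add: power2_eq_square algebra_simps)
      finally have "3/4 - 1 / (4 * s) \<le> q" using s by (simp add: field_simps)
      thus ?thesis using ecc_big 2 unfolding ecc s_def by simp
    next
      case 3
      \<comment> \<open>For q > 1 it suffices that the eccentricity of an ellipse is below
        1.\<close>
      have "0 < b\<^sup>2 / a\<^sup>2" using a axes by simp
      thus ?thesis using 3 by linarith
    qed
  qed
  define f where "f = sqrt (a\<^sup>2 - b\<^sup>2)"
  have ab2: "a\<^sup>2 - b\<^sup>2 > 0" using e(1) a by (simp add: field_simps)
  have f2: "f\<^sup>2 = a\<^sup>2 - b\<^sup>2" using ab2 by (simp add: f_def)
  interpret focal_ellipse a b f q
  proof
    show "f\<^sup>2 < q * a\<^sup>2" using e(2) a unfolding f2 by (simp add: field_simps)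
  qed (use a axes ab2 f2 q_pos q_ne in \<open>auto simp: f_def\<close>)
  have \<phi>: "C1_periodic \<phi>" using phi_C1 phi_per by (simp add: C1_periodic_def)
  obtain s0 where s0: "\<phi> s0 \<noteq> 0" using phi_nz by blast
  have "0 = c + f *\<^sub>R vector [cos t, sin t] \<or> 0 = c - f *\<^sub>R (vector [cos t, sin t] :: real^2)"
    using focus by (auto simp: ellipse_foci_def f_def)
  thus ?thesis
  proof
    assume "0 = c + f *\<^sub>R vector [cos t, sin t]"
    hence "c = (- f) *\<^sub>R vector [cos t, sin t]" by (simp add: eq_neg_iff_add_eq_0)
    thus ?thesis by (rule finite_non_scattering[OF \<phi> s0])
  next
    assume "0 = c - f *\<^sub>R vector [cos t, sin t]"
    hence "c = f *\<^sub>R vector [cos t, sin t]" by simp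
    \<comment> \<open>Turning the axis direction by pi exchanges the two foci and leaves the region
      unchanged, which reduces the second focus to the first.\<close>
    hence c: "c = (- f) *\<^sub>R vector [cos (t + pi), sin (t + pi)]" by (simp add: vec_eq_iff forall_2)
    have "ellipse_region c (t + pi) a b = ellipse_region c t a b"
    proof -
      have e1: "((- u * x + - v * y) / r)\<^sup>2 = ((u * x + v * y) / r)\<^sup>2"
        and e2: "((- (- v) * x + - u * y) / r)\<^sup>2 = ((- v * x + u * y) / r)\<^sup>2" for u v x y r :: real
        unfolding power_divide by (rule arg_cong[where f = "\<lambda>z. z / r\<^sup>2"], algebra)+
      show ?thesis unfolding ellipse_region_def cos_periodic_pi sin_periodic_pi by (simp only: e1 e2)
    qed
    with finite_non_scattering[OF \<phi> s0 c] show ?thesis by simp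
  qed
qed

end
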